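(* Let $K\geq 3$ be an integer. Let $m,n_1,\ldots,n_K\to\infty$ such that $\lim m/n_j$ exists for each $j\in\{1,\ldots,K\}$, write $\mathbf{n}=(n_1,\ldots,n_K)$ and $|\mathbf{n}|=n_1+\cdots+n_K$. For each $(m,\mathbf{n})$ let $(\Gamma,s)$ be chosen uniformly at random with $\Gamma\in\Psi_{m,\mathbf{n}}$ and $s\in\mathbb{Z}_2^m$, and consider the probability that $\Gamma x=s$ has a solution $x\in\mathbb{Z}_2^{|\mathbf{n}|}$. 1. If $2<\lim m/n_j<K$ for all $j\in\{1,\ldots,K\}$, then $\Gamma x=s$ is asymptotically almost surely satisfiable, with satisfiability probability $1-O(m^{2-K})$. 2. If $\lim m/n_j>K$ for all $j\in\{1,\ldots,K\}$, then $\Gamma x=s$ is asymptotically almost surely unsatisfiable, with satisfiability probability $O(2^{-(m-|\mathbf{n}|)})$.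
   Context: $\Psi_{m,\mathbf{n}}$ is the set of 2-core $K$-XORGAME matrices: block matrices $\Gamma=(A_1\ \cdots\ A_K)\in\mathbb{Z}_2^{m\times|\mathbf{n}|}$ with $A_j\in\mathbb{Z}_2^{m\times n_j}$, such that each $A_j$ has exactly one $1$ in every row and every column of $A_j$ contains at least two $1$'s. An event holds asymptotically almost surely (a.a.s.) if its probability tends to $1$ along the given sequence. *)

theory Defs
  imports
    "HOL-Probability.Probability_Mass_Function"
    "HOL-Library.Landau_Symbols"
    "HOL-Library.Z2"
    "Jordan_Normal_Form.Matrix"
begin

text \<open>
  The field of two elements is the library type \<^typ>\<open>bit\<close>. The tuple of block widths
  $(n_1,\ldots,n_K)$ is a function read only at the indices $1,\ldots,K$. Rows and
  columns of matrices are numbered from 0, as in the matrix library.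
\<close>

definition total_width :: "nat \<Rightarrow> (nat \<Rightarrow> nat) \<Rightarrow> nat" where
  "total_width K n = (\<Sum>j = 1..K. n j)"

text \<open>The block $A_j$ of $\Gamma = (A_1\ \cdots\ A_K)$; it starts at column $n_1 + \cdots + n_{j-1}$.\<close>

definition block :: "nat \<Rightarrow> (nat \<Rightarrow> nat) \<Rightarrow> bit mat \<Rightarrow> nat \<Rightarrow> bit mat" where
  "block m n \<Gamma> j = mat m (n j) (\<lambda>(i, c). \<Gamma> $$ (i, (\<Sum>l = 1..<j. n l) + c))"

definition xorgame_matrices :: "nat \<Rightarrow> nat \<Rightarrow> (nat \<Rightarrow> nat) \<Rightarrow> bit mat set" where
  "xorgame_matrices K m n =
     {\<Gamma> \<in> carrier_mat m (total_width K n). \<forall>j\<in>{1..K}.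
        (\<forall>i<m. card {c. c < n j \<and> block m n \<Gamma> j $$ (i, c) = 1} = 1) \<and>
        (\<forall>c<n j. card {i. i < m \<and> block m n \<Gamma> j $$ (i, c) = 1} \<ge> 2)}"

text \<open>
  The set \<^term>\<open>xorgame_matrices K m n\<close> is finite, but it is empty when some block is too
  wide (for instance \<^prop>\<open>m < 2 * n j\<close>). Then \<^const>\<open>pmf_of_set\<close> is unspecified and
  \<open>sat_prob\<close> has no meaning.
\<close>

definition sat_prob :: "nat \<Rightarrow> nat \<Rightarrow> (nat \<Rightarrow> nat) \<Rightarrow> real" where
  "sat_prob K m n =
     measure_pmf.prob (pmf_of_set (xorgame_matrices K m n \<times> carrier_vec m))
       {(\<Gamma>, s). \<exists>x\<in>carrier_vec (total_width K n). \<Gamma> *\<^sub>v x = s}"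

end

theory Submission
  imports Defs "HOL-Real_Asymp.Real_Asymp"
begin

text \<open>
  A block of \<open>\<Gamma>\<close> with one 1 per row is a map from rows to columns, and the 2-core condition says that
  its fibres have at least two elements. The system has at most \<open>2 ^ |n|\<close> consistent right-hand sides,
  which settles the overdetermined regime. In the other regime the failure probability is at most the
  expected number of nonempty row sets \<open>T\<close> meeting all fibres of all \<open>K\<close> maps in even sets, that is,
  \<open>\<Sum>w\<ge>1. (m choose w) * (\<Prod>j. P j w)\<close>, where \<open>P j w\<close> is the probability that block \<open>j\<close> is even on a
  fixed set of size \<open>w\<close>.

  For \<open>w\<close> below a small multiple of \<open>m\<close>, removing two elements of \<open>T\<close> that share a fibre gives
  \<open>P j (w + 2) \<le> O((w + 1) / m) * P j w\<close>, so these terms decay geometrically from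
  \<open>w = 2\<close>, which contributes \<open>O(m powr (2 - K))\<close>.

  For larger \<open>w\<close>, coefficient extraction from \<open>(cosh x * exp y - 1 - y) ^ n\<close> bounds the number of even
  maps, while log-concavity of the coefficients of \<open>(exp z - 1 - z) ^ n\<close> bounds the total number from below up
  to a factor polynomial in \<open>m\<close>. With \<open>L = m / n\<close> this yields
  \<open>(m choose w) powr (1 / L) * P j w \<le> poly m\<close>, since the exponential rate reduces to a
  Hausdorff--Young type inequality on two points in which \<open>t powr L\<close> is replaced by \<open>exp t - 1 - t\<close>.
  As \<open>L < K\<close>, the product of the \<open>K\<close> factors is then exponentially small.
\<close>

section \<open>The two-point inequality\<close>

text \<open>The threshold \<open>K\<close> comes from sets \<open>T\<close> with about half of the
  rows. There are nearly \<open>2 ^ m\<close> of them, and the generating function bound for one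
  block is \<open>(1 / 2) ^ n\<close> up to polynomial factors, so
  \<open>(m choose w) powr (1 / L) * P j w\<close> is bounded by about
  \<open>2 powr (m / L - n) = 1\<close>. No exponential slack is left there: the two-point
  inequality is an equality at \<theta> = 1/2, and also at \<theta> = 0, which is why its proof
  traces signs through several derivatives instead of using a crude estimate.

  Slack comes only from \<open>L < K\<close>. With \<open>C = (m choose w)\<close>, the quantity
  \<open>C powr (1 / K) * P j w\<close> is a weighted geometric mean of
  \<open>C powr (1 / L) * P j w\<close> and \<open>P j w\<close>, and the latter is exponentially
  small once \<open>w\<close> is at least a fixed fraction of \<open>m\<close>. Polynomial losses
  are then harmless. Since the blocks have different widths, each of them is estimated separately
  against its share \<open>C powr (1 / K)\<close>.

  The exponent \<open>2 - K\<close> is a count of powers of \<open>m\<close>: two more rows in a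
  small \<open>T\<close> multiply the binomial coefficient by order \<open>m^2\<close> and each of
  the \<open>K\<close> probabilities by order \<open>1 / m\<close>.\<close>

definition exp_tail :: "real \<Rightarrow> real" where
  "exp_tail t = exp t - 1 - t"

text \<open>\<open>exp_tail\<close> is the exponential generating function of sets with at least two
  elements. This is \<open>z\<close> times its logarithmic derivative, the mean of a Poisson
  variable of parameter \<open>z\<close> conditioned to be at least 2;
  \<open>tail_mean z = m / n\<close> is the saddle point equation.\<close>

definition tail_mean :: "real \<Rightarrow> real" where
  "tail_mean z = z * (exp z - 1) / exp_tail z"

lemma has_derivative_exp_tail [derivative_intros]:
  "(f has_real_derivative f') (at x within S) \<Longrightarrow>
    ((\<lambda>x. exp_tail (f x)) has_real_derivative (exp (f x) - 1) * f') (at x within S)"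
  unfolding exp_tail_def by (auto intro!: derivative_eq_intros simp: algebra_simps)

lemma exp_tail_0 [simp]: "exp_tail 0 = 0"
  by (simp add: exp_tail_def)

lemma continuous_on_exp_tail [continuous_intros]:
  "continuous_on S f \<Longrightarrow> continuous_on S (\<lambda>x. exp_tail (f x))"
  unfolding exp_tail_def by (intro continuous_intros)

section \<open>Elementary estimates for the generating function and its mean\<close>

lemma exp_tail_lower:
  assumes "t \<ge> 0"
  shows "t^2 / 2 + t^3 / 6 \<le> exp_tail t"
proof -
  let ?f = "\<lambda>x. exp_tail x - (x^2 / 2 + x^3 / 6)"
  have "?f 0 \<le> ?f t"
  proof (rule DERIV_nonneg_imp_nondecreasing[OF assms])
    fix x :: real assume "0 \<le> x" "x \<le> t"
    have "(?f has_real_derivative exp x - 1 - x - x^2 / 2) (at x)"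
      by (auto intro!: derivative_eq_intros simp: algebra_simps power2_eq_square)
    moreover have "exp x - 1 - x - x^2 / 2 \<ge> 0"
      using exp_lower_Taylor_quadratic[OF \<open>0 \<le> x\<close>] by simp
    ultimately show "\<exists>y. (?f has_real_derivative y) (at x) \<and> 0 \<le> y" by blast
  qed
  then show ?thesis by (simp add: exp_tail_def)
qed

lemma exp_tail_nonneg: "exp_tail t \<ge> 0"
  using exp_ge_add_one_self[of t] unfolding exp_tail_def by linarith

lemma exp_tail_lower2: "t \<ge> 0 \<Longrightarrow> t^2 / 2 \<le> exp_tail t"
  using exp_tail_lower[of t] zero_le_power[of t 3] by linarith

lemma exp_tail_pos: "t > 0 \<Longrightarrow> exp_tail t > 0"
  using exp_tail_lower2[of t] by (smt (verit) zero_less_power divide_pos_pos)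

lemma tail_mean_alt: "z > 0 \<Longrightarrow> tail_mean z = z + z^2 / exp_tail z"
  using exp_tail_pos[of z] unfolding tail_mean_def exp_tail_def
  by (simp add: field_simps power2_eq_square)

lemma tail_mean_upper:
  assumes "z > 0" shows "tail_mean z \<le> z + 2"
proof -
  have "z^2 / exp_tail z \<le> 2"
    using exp_tail_lower2[of z] exp_tail_pos[OF assms] assms by (simp add: field_simps)
  then show ?thesis using tail_mean_alt[OF assms] by simp
qed

text \<open>The constant 2 and the slope 1/3 are the expansion at 0. After clearing denominators the
  difference vanishes at 0 with its first two derivatives, and its third derivative is
  \<open>2 * y * exp y\<close>; \<open>d3\<close> and \<open>d2\<close> integrate this back.\<close>

lemma tail_mean_lower:
  assumes "z > 0" shows "2 + z / 3 \<le> tail_mean z"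
proof -
  have d3: "0 \<le> 2 + (2*x - 2) * exp x" if "0 \<le> x" for x :: real
  proof -
    let ?f = "\<lambda>x::real. 2 + (2*x - 2) * exp x"
    have "?f 0 \<le> ?f x"
    proof (rule DERIV_nonneg_imp_nondecreasing[OF that])
      fix y :: real assume "0 \<le> y" "y \<le> x"
      have "(?f has_real_derivative 2 * y * exp y) (at y)"
        by (auto intro!: derivative_eq_intros simp: algebra_simps)
      then show "\<exists>d. (?f has_real_derivative d) (at y) \<and> 0 \<le> d" using \<open>0 \<le> y\<close>
        by (intro exI[of _ "2 * y * exp y"]) auto
    qed
    then show ?thesis by simp
  qed
  have d2: "0 \<le> 2*x + 4 + (2*x - 4) * exp x" if "0 \<le> x" for x :: real
  proof -
    let ?f = "\<lambda>x::real. 2*x + 4 + (2*x - 4) * exp x"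
    have "?f 0 \<le> ?f x"
    proof (rule DERIV_nonneg_imp_nondecreasing[OF that])
      fix y :: real assume "0 \<le> y" "y \<le> x"
      have "(?f has_real_derivative 2 + (2*y - 2) * exp y) (at y)"
        by (auto intro!: derivative_eq_intros simp: algebra_simps)
      then show "\<exists>d. (?f has_real_derivative d) (at y) \<and> 0 \<le> d" using d3[OF \<open>0 \<le> y\<close>] by blast
    qed
    then show ?thesis by simp
  qed
  let ?f = "\<lambda>x::real. x^2 + 4*x + 6 + (2*x - 6) * exp x"
  have "?f 0 \<le> ?f z"
  proof (rule DERIV_nonneg_imp_nondecreasing[OF less_imp_le[OF assms]])
    fix y :: real assume "0 \<le> y" "y \<le> z"
    have "(?f has_real_derivative 2*y + 4 + (2*y - 4) * exp y) (at y)"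
      by (auto intro!: derivative_eq_intros simp: algebra_simps)
    then show "\<exists>d. (?f has_real_derivative d) (at y) \<and> 0 \<le> d" using d2[OF \<open>0 \<le> y\<close>] by blast
  qed
  then have "(2 - 2 * z / 3) * exp_tail z \<le> z^2"
    by (simp add: exp_tail_def field_simps power2_eq_square)
  then have "2 - 2 * z / 3 \<le> z^2 / exp_tail z"
    using exp_tail_pos[OF assms] by (simp add: pos_le_divide_eq)
  then show ?thesis using tail_mean_alt[OF assms] by simp
qed

text \<open>
  Here \<open>t, h, g, k\<close> stand for \<open>t, z - t, exp_tail t, exp_tail (z - t)\<close>, so that \<open>G = exp_tail z\<close>. The
  inequality in \<open>curvature_nonneg\<close> is affine in \<open>tail_mean z - 2\<close>, which lies between \<open>z / 3\<close> and \<open>z\<close>;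
  the next two lemmas treat these two extremes.
\<close>

lemma curvature_poly_low:
  fixes t h g k :: real
  assumes "t \<ge> 0" "h \<ge> 0" "3*t^2 + t^3 \<le> 6*g" "3*h^2 + h^3 \<le> 6*k"
  defines "G \<equiv> g + (t + g) * h + (t + g + 1) * k"
  shows "0 \<le> 18*(2*G^2 + 2*G*g + 2*t*g^2 + 2*(G + g - t^2) + 2*t^3 + 4*g*t^2 - 2*t*g
            - (t + g + 1)^2 * (2*t*h + h^2))
            + 6*(t + h) * ((G + g)^2 + 4*(G + g) + (t + h)^2 - 5*t^2 - 4*t*g)" (is "0 \<le> ?U")
proof -
  have "t^3 \<ge> 0" "h^3 \<ge> 0" "t^2 \<ge> 0" "h^2 \<ge> 0" using assms by simp_all
  then have g2: "t^2 \<le> 2*g" and k2: "h^2 \<le> 2*k" and g0: "g \<ge> 0" and k0: "k \<ge> 0"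
    using assms by linarith+
  \<comment> \<open>A positivity certificate: the slacks \<open>6*g - 3*t^2 - t^3\<close> and
    \<open>6*k - 3*h^2 - h^3\<close>, their weaker forms \<open>2*g - t^2\<close> and
    \<open>2*k - h^2\<close>, and squares of \<open>t - h\<close> and \<open>h - 1\<close> absorb
    all negative coefficients. The remaining monomials have positive ones.\<close>
  have "?U = 6*(6*k - 3*h^2 - h^3) + 12*(6*g - 3*t^2 - t^3) + 6*t*(2*g - t^2) + 14*h*(6*g - 3*t^2 - t^3)
      + 18*t*h*(2*g - t^2) + 30*t*(2*k - h^2) + t*(9*(t-h)^2 + 21*t^2 + 27*h^2) + 24*t^2*(2*g - t^2)
      + t^2*(2*(t-h)^2 + 22*t^2 + 16*h^2) + 72*g*(2*k - h^2) + 66*h*g*(2*g - t^2) + t*g^2*(6*(h-1)^2 + 54)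
    + 36*k^2 + 72*g^2 + 24*h*k + 72*g*k^2 + 108*g^2*k + 6*h*k^2 + 120*h*g*k + 60*h^2*g + 12*h^3 + 78*t*k^2
      + 156*t*g*k + 96*t*h*k + 24*t^2*k + 36*g^2*k^2 + 12*h*g*k^2 + 96*h*g^2*k + 12*h^2*g*k + 42*h^2*g^2
      + 84*t*g*k^2 + 24*t*g^2*k + 12*t*h*k^2 + 180*t*h*g*k + 12*t*h^2*k + 60*t*h^2*g + 48*t^2*k^2
      + 24*t^2*g*k + 84*t^2*h*k + 18*t^2*h*g + 6*h*g^2*k^2 + 12*h^2*g^2*k + 6*h^3*g^2 + 6*t*g^2*k^2
      + 12*t*h*g*k^2 + 12*t*h*g^2*k + 24*t*h^2*g*k + 12*t*h^3*g + 12*t^2*g*k^2 + 6*t^2*h*k^2 + 24*t^2*h*g*k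
      + 12*t^2*h^2*k + 12*t^2*h^2*g + 6*t^2*h^3 + 6*t^3*k^2 + 12*t^3*h*k + 6*t^3*h^2"
    unfolding G_def by (simp add: algebra_simps power2_eq_square power3_eq_cube)
  also have "\<dots> \<ge> 0"
    by (intro add_nonneg_nonneg mult_nonneg_nonneg) (use assms g0 k0 g2 k2 in auto)
  finally show ?thesis .
qed

lemma curvature_poly_high:
  fixes t h g k :: real
  assumes "t \<ge> 0" "h \<ge> 0" "3*t^2 + t^3 \<le> 6*g" "3*h^2 + h^3 \<le> 6*k"
  defines "G \<equiv> g + (t + g) * h + (t + g + 1) * k"
  shows "0 \<le> 3*(2*G^2 + 2*G*g + 2*t*g^2 + 2*(G + g - t^2) + 2*t^3 + 4*g*t^2 - 2*t*g
            - (t + g + 1)^2 * (2*t*h + h^2))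
            + 3*(t + h) * ((G + g)^2 + 4*(G + g) + (t + h)^2 - 5*t^2 - 4*t*g)" (is "0 \<le> ?U")
proof -
  have "t^3 \<ge> 0" "h^3 \<ge> 0" "t^2 \<ge> 0" "h^2 \<ge> 0" using assms by simp_all
  then have g2: "t^2 \<le> 2*g" and k2: "h^2 \<le> 2*k" and g0: "g \<ge> 0" and k0: "k \<ge> 0"
    using assms by linarith+
  have "?U = (6*k - 3*h^2 - h^3) + 2*(6*g - 3*t^2 - t^3) + 9*t*(2*g - t^2) + 5*h*(6*g - 3*t^2 - t^3) + 3*t*h*(2*g - t^2)
    + 6*k^2 + 24*g*k + 12*g^2 + 12*h*k + 18*t*k + 12*g*k^2 + 18*g^2*k + 3*h*k^2 + 36*h*g*k + 30*h*g^2
      + 6*h^2*g + 4*h^3 + 15*t*k^2 + 42*t*g*k + 18*t*g^2 + 24*t*h*k + 15*t*h^2 + 12*t^2*k + 9*t^2*h + 5*t^3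
      + 6*g^2*k^2 + 6*h*g*k^2 + 24*h*g^2*k + 6*h^2*g*k + 15*h^2*g^2 + 18*t*g*k^2 + 12*t*g^2*k + 6*t*h*k^2
      + 42*t*h*g*k + 6*t*h*g^2 + 6*t*h^2*k + 18*t*h^2*g + 12*t^2*k^2 + 12*t^2*g*k + 18*t^2*h*k + 3*t^2*h^2
      + 2*t^3*h + 3*h*g^2*k^2 + 6*h^2*g^2*k + 3*h^3*g^2 + 3*t*g^2*k^2 + 6*t*h*g*k^2 + 6*t*h*g^2*k
      + 12*t*h^2*g*k + 3*t*h^2*g^2 + 6*t*h^3*g + 6*t^2*g*k^2 + 3*t^2*h*k^2 + 12*t^2*h*g*k + 6*t^2*h^2*k
      + 6*t^2*h^2*g + 3*t^2*h^3 + 3*t^3*k^2 + 6*t^3*h*k + 3*t^3*h^2"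
    unfolding G_def by (simp add: algebra_simps power2_eq_square power3_eq_cube)
  also have "\<dots> \<ge> 0"
    by (intro add_nonneg_nonneg mult_nonneg_nonneg) (use assms g0 k0 g2 k2 in auto)
  finally show ?thesis .
qed

text \<open>The mean value theorem as a source of signs: a function that dips below its values at
  both ends has a point with negative derivative before one with positive derivative. The sign
  analysis below climbs from one derivative to the next with it.\<close>

lemma deriv_neg_before_rise:
  fixes f f' :: "real \<Rightarrow> real"
  assumes "a < b" "continuous_on {a..b} f"
    and "\<And>x. a < x \<Longrightarrow> x < b \<Longrightarrow> (f has_real_derivative f' x) (at x)"
  shows "f b < f a \<Longrightarrow> \<exists>x. a < x \<and> x < b \<and> f' x < 0"
    and "f a < f b \<Longrightarrow> \<exists>x. a < x \<and> x < b \<and> 0 < f' x"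
proof -
  obtain l x where x: "a < x" "x < b" "(f has_real_derivative l) (at x)" "f b - f a = (b - a) * l"
    using MVT[OF assms(1,2)] assms(3) real_differentiable_def by metis
  then have "f b - f a = (b - a) * f' x" using assms(3) DERIV_unique by metis
  with x(1,2) assms(1) show "f b < f a \<Longrightarrow> \<exists>x. a < x \<and> x < b \<and> f' x < 0"
    and "f a < f b \<Longrightarrow> \<exists>x. a < x \<and> x < b \<and> 0 < f' x"
    by (smt (verit) mult_less_0_iff mult_pos_pos zero_less_mult_iff)+
qed

text \<open>Multiplied by \<open>- tp_L\<close>, this expression becomes \<open>exp t * C2 t\<close>
  in \<open>tp_E_concave_aux\<close>; its sign is the concavity used there. The addition formula for
  \<open>exp_tail (t + h)\<close> makes it polynomial in \<open>t\<close>, \<open>h\<close>,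
  \<open>g\<close>, \<open>k\<close>.\<close>

lemma curvature_nonneg:
  fixes t z :: real
  assumes "0 \<le> t" "t \<le> z" "0 < z"
  defines "G \<equiv> exp_tail z" and "g \<equiv> exp_tail t" and "L \<equiv> tail_mean z"
  shows "0 \<le> 2*G^2 + 2*G*g + 2*t*g^2 + 2*(G + g - t^2) + 2*t^3 + 4*g*t^2 - 2*t*g
            - (t + g + 1)^2 * (z^2 - t^2)
            + (L - 2) * ((G + g)^2 + 4*(G + g) + z^2 - 5*t^2 - 4*t*g)"
    (is "0 \<le> ?U0 + (L - 2) * ?A")
proof -
  define h where "h = z - t"
  define k where "k = exp_tail h"
  have h0: "h \<ge> 0" using assms by (simp add: h_def)
  have z: "z = t + h" by (simp add: h_def)
  have G: "G = g + (t + g) * h + (t + g + 1) * k"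
    unfolding G_def g_def k_def z exp_tail_def by (simp add: exp_add algebra_simps)
  have g3: "3*t^2 + t^3 \<le> 6*g" and k3: "3*h^2 + h^3 \<le> 6*k"
    using exp_tail_lower[OF assms(1)] exp_tail_lower[OF h0] by (simp_all add: g_def k_def)
  have sq: "z^2 - t^2 = 2*t*h + h^2" by (simp add: z power2_sum)
  have low_combine: "0 \<le> v + l * u" if "z * u \<le> 3 * l * u" "0 \<le> 18 * v + 6 * z * u" for u v l :: real
    using that by linarith
  have high_combine: "0 \<le> v + l * u" if "z * u \<le> l * u" "0 \<le> 3 * v + 3 * z * u" for u v l :: real
    using that by linarith
  note low = curvature_poly_low[OF assms(1) h0 g3 k3, folded G z, folded sq]
  note high = curvature_poly_high[OF assms(1) h0 g3 k3, folded G z, folded sq]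
  \<comment> \<open>The slope \<open>?A\<close> has no fixed sign; its sign decides which end of the
    range of \<open>L - 2\<close> is the worse one.\<close>
  show ?thesis
  proof (cases "?A \<ge> 0")
    case True
    have "z * ?A \<le> 3 * (L - 2) * ?A"
      using tail_mean_lower[OF assms(3)] True by (intro mult_right_mono) (auto simp: L_def)
    then show ?thesis using low_combine low by blast
  next
    case False
    have "z * ?A \<le> (L - 2) * ?A"
      using tail_mean_upper[OF assms(3)] False by (intro mult_right_mono_neg) (auto simp: L_def)
    then show ?thesis using high_combine high by blast
  qed
qed

section \<open>Sign analysis for the two-point inequality\<close>

context
  fixes z :: real
  assumes z_pos: "0 < z"
begin

text \<open>
  For \<open>\<theta> = (1 - t / z) / 2\<close> the function \<open>tp_D\<close> below is the logarithm of the quotient of the two sides of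
  the two-point inequality, divided by \<open>tp_L - 1\<close>. Its derivative has the sign of \<open>tp_W\<close>, whose
  derivative has the sign of \<open>- tp_E\<close>. A positive multiple of \<open>tp_E\<close> is concave and vanishes at \<open>z\<close>, so
  \<open>tp_E\<close> changes sign at most once, from negative to positive. Hence \<open>tp_D\<close> first increases and then
  decreases, and it vanishes at \<open>0\<close> and at \<open>z\<close>.
\<close>

definition "tp_L = tail_mean z"
definition "tp_G = exp_tail z"
text \<open>With \<open>N = exp t - 1\<close>, the derivative \<open>tp_D'\<close> is a positive
  multiple of \<open>(1 + t / z) powr tp_s * (M - z * N) - (1 - t / z) powr tp_s * (M + z *
  N)\<close>; this is where \<open>M\<close> originates.\<close>

definition "tp_M t = z * (exp z - 1) + tp_L * exp_tail t - t * (exp t - 1)"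
text \<open>The Wronskian \<open>M * N' - M' * N\<close> of \<open>tp_M\<close> and
  \<open>N = exp t - 1\<close>, left in the numerator when
  \<open>ln (M + z * N) - ln (M - z * N)\<close> is differentiated.\<close>

definition "tp_V t = exp t * (z * (exp z - 1) + tp_L - tp_L * t) + (exp t - 1)^2 - tp_L"
definition "tp_E t = (tp_L - 1) * tp_V t * (z^2 - t^2) - ((tp_M t)^2 - z^2 * (exp t - 1)^2)"

lemma tp_LG: "z * (exp z - 1) = tp_L * tp_G"
  using exp_tail_pos[OF z_pos] by (simp add: tp_L_def tp_G_def tail_mean_def)

lemma tp_L_bounds: "2 < tp_L" "tp_L \<le> z + 2"
  using tail_mean_lower[OF z_pos] tail_mean_upper[OF z_pos] z_pos by (auto simp: tp_L_def)

lemma tp_G_pos: "tp_G > 0"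
  using exp_tail_pos[OF z_pos] by (simp add: tp_G_def)

text \<open>The difference vanishes at \<open>z\<close> by \<open>tp_LG\<close> and is strictly
  decreasing: \<open>tp_L - 1 \<le> z + 1\<close> and \<open>(1 - x) * exp x \<le> 1\<close> bound
  its derivative by \<open>- z\<close>.\<close>

lemma tp_Q_pos:
  assumes "0 \<le> t" "t < z"
  shows "tp_M t - z * (exp t - 1) > 0"
proof -
  let ?f = "\<lambda>x. tp_M x - z * (exp x - 1)"
  let ?f' = "\<lambda>x. (tp_L - 1) * (exp x - 1) - x * exp x - z * exp x"
  have der: "(?f has_real_derivative ?f' x) (at x)" for x
    unfolding tp_M_def by (auto intro!: derivative_eq_intros simp: algebra_simps)
  have "?f' x < 0" if "x \<ge> 0" for x
  proof -
    have "(tp_L - 1) * (exp x - 1) \<le> (z + 1) * (exp x - 1)"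
      using tp_L_bounds that by (intro mult_right_mono) auto
    moreover have "(1 - x) * exp x \<le> 1"
    proof -
      have "1 - x \<le> exp (- x)" using exp_ge_add_one_self[of "-x"] by simp
      then have "(1 - x) * exp x \<le> exp (-x) * exp x" by (intro mult_right_mono) auto
      then show ?thesis by (simp add: exp_minus)
    qed
    ultimately show ?thesis using z_pos by (simp add: algebra_simps)
  qed
  then have "?f z < ?f t"
    using assms der by (intro DERIV_neg_imp_decreasing[of t z ?f]) (auto intro!: exI)
  moreover have "?f z = 0"
    unfolding tp_M_def using tp_LG by (simp add: tp_G_def exp_tail_def)
  ultimately show ?thesis by simp
qed

lemma tp_P_pos:
  assumes "0 \<le> t" "t < z"
  shows "tp_M t + z * (exp t - 1) > 0"
  using tp_Q_pos[OF assms] z_pos mult_nonneg_nonneg[of z "exp t - 1"] assms by (smt (verit) one_le_exp_iff)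

text \<open>
  Multiplying by \<open>exp (- t)\<close> leaves an exponential polynomial with coefficients of degree
  at most three, whose second derivative has constant sign.
\<close>

lemma tp_E_concave_aux:
  defines "l \<equiv> tp_L - 1" and "A0 \<equiv> tp_L * tp_G - tp_L"
  defines "a \<equiv> z^2 - l^2 * z^2 - A0^2" and "b \<equiv> 2 * A0 * l"
  defines "C \<equiv> \<lambda>t. exp t * (tp_L * (z^2 - t^2 - tp_L + 2 * t))
      + (l * (z^2 - t^2) * (tp_L * tp_G + tp_L - 2 - tp_L * t) - 2 * (A0 - l * t) * (tp_L - t) - 2 * z^2)
      + exp (- t) * (a + b * t)"
    and "C1 \<equiv> \<lambda>t. exp t * (tp_L * (z^2 - t^2 - tp_L + 2))
      + (l * (- 2 * t * (tp_L * tp_G + tp_L - 2) - tp_L * z^2 + 3 * tp_L * t^2) + 2 * l * tp_L + 2 * A0 - 4 * l * t)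
      + exp (- t) * (b - a - b * t)"
    and "C2 \<equiv> \<lambda>t. exp t * (tp_L * (z^2 - t^2 - tp_L + 2 - 2 * t))
      + l * (6 * tp_L * t - 2 * (tp_L * tp_G + tp_L))
      + exp (- t) * (a - 2 * b + b * t)"
  shows "exp t * C t = tp_E t"
    and "(C has_real_derivative C1 t) (at t)"
    and "(C1 has_real_derivative C2 t) (at t)"
    and "0 \<le> t \<Longrightarrow> t \<le> z \<Longrightarrow> C2 t \<le> 0"
proof -
  have e1: "exp t * exp (- t) = 1" for t :: real by (simp add: exp_minus)
  define E e where "E = exp t" and "e = exp (- t)"
  have Ee: "E * e = 1" using e1 by (simp add: E_def e_def)
  have "exp t * C t = E * (E * (tp_L * (z^2 - t^2 - tp_L + 2 * t))
      + (l * (z^2 - t^2) * (tp_L * tp_G + tp_L - 2 - tp_L * t) - 2 * (A0 - l * t) * (tp_L - t) - 2 * z^2))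
      + (E * e) * (a + b * t)"
    by (simp add: C_def E_def e_def algebra_simps)
  also have "\<dots> = tp_E t"
    unfolding Ee mult_1_left tp_E_def tp_V_def tp_M_def tp_LG exp_tail_def E_def[symmetric] l_def A0_def a_def b_def
    by (simp add: algebra_simps power2_eq_square)
  finally show "exp t * C t = tp_E t" .
  show "(C has_real_derivative C1 t) (at t)"
    unfolding C_def C1_def by (auto intro!: derivative_eq_intros simp: algebra_simps power2_eq_square)
  show "(C1 has_real_derivative C2 t) (at t)"
    unfolding C1_def C2_def by (auto intro!: derivative_eq_intros simp: algebra_simps power2_eq_square)
  assume t: "0 \<le> t" "t \<le> z"
  define g where "g = exp_tail t"
  have E: "E = t + g + 1" by (simp add: E_def g_def exp_tail_def)
  have zG: "z * (tp_G + z) = tp_L * tp_G"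
    using tp_LG by (simp add: tp_G_def exp_tail_def)
  have LG: "z^2 = tp_L * tp_G - z * tp_G" using zG by (simp add: algebra_simps power2_eq_square)
  \<comment> \<open>Multiplication by \<open>exp t\<close> removes \<open>exp (- t)\<close>, and
    \<open>exp t = t + g + 1\<close> removes the remaining exponentials, which leaves the polynomial
    of \<open>curvature_nonneg\<close>.\<close>
  have "E * C2 t = E^2 * (tp_L * (z^2 - t^2 - tp_L + 2 - 2 * t))
      + E * l * (6 * tp_L * t - 2 * (tp_L * tp_G + tp_L)) + (E * e) * (a - 2 * b + b * t)"
    by (simp add: C2_def E_def e_def algebra_simps power2_eq_square)
  also have "\<dots> = (t + g + 1)^2 * (tp_L * (z^2 - t^2 - tp_L + 2 - 2 * t))
      + (t + g + 1) * l * (6 * tp_L * t - 2 * (tp_L * tp_G + tp_L)) + (a - 2 * b + b * t)"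
    by (simp only: Ee E[symmetric] mult_1_left)
  also have "\<dots> = - tp_L * (2*tp_G^2 + 2*tp_G*g + 2*t*g^2 + 2*(tp_G + g - t^2) + 2*t^3 + 4*g*t^2 - 2*t*g
            - (t + g + 1)^2 * (z^2 - t^2)
            + (tp_L - 2) * ((tp_G + g)^2 + 4*(tp_G + g) + z^2 - 5*t^2 - 4*t*g))"
    unfolding l_def A0_def a_def b_def
    by (simp add: algebra_simps power2_eq_square power3_eq_cube)
  also have "\<dots> \<le> 0"
    using curvature_nonneg[OF t z_pos] tp_L_bounds
    by (simp add: tp_G_def tp_L_def g_def mult_nonneg_nonneg)
  finally have "E * C2 t \<le> 0" .
  moreover have "E > 0" by (simp add: E_def)
  ultimately show "C2 t \<le> 0" by (simp add: mult_le_0_iff)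
qed

lemma tp_E_concave:
  "\<exists>C C1 C2 :: real \<Rightarrow> real. (\<forall>t. exp t * C t = tp_E t) \<and>
     (\<forall>t. (C has_real_derivative C1 t) (at t)) \<and> (\<forall>t. (C1 has_real_derivative C2 t) (at t)) \<and>
     (\<forall>t. 0 \<le> t \<longrightarrow> t \<le> z \<longrightarrow> C2 t \<le> 0)"
  by (intro exI conjI allI impI, rule tp_E_concave_aux(1), rule tp_E_concave_aux(2),
      rule tp_E_concave_aux(3), rule tp_E_concave_aux(4))

text \<open>A concave function that has fallen from a positive to a negative value cannot climb back
  to its zero at \<open>z\<close>.\<close>

lemma tp_E_no_drop:
  assumes "0 < x" "x < y" "y < z" "0 < tp_E x" 
  shows "0 \<le> tp_E y"
proof (rule ccontr)
  assume neg: "\<not> 0 \<le> tp_E y"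
  obtain C C1 C2 :: "real \<Rightarrow> real" where C: "\<And>t. exp t * C t = tp_E t"
    "\<And>t. (C has_real_derivative C1 t) (at t)" "\<And>t. (C1 has_real_derivative C2 t) (at t)"
    "\<And>t. 0 \<le> t \<Longrightarrow> t \<le> z \<Longrightarrow> C2 t \<le> 0"
    using tp_E_concave by blast
  have cont: "continuous_on S C" "continuous_on S C1" for S
    using C(2,3) by (meson DERIV_isCont continuous_at_imp_continuous_on)+
  have "C x > 0" "C y < 0"
    using assms neg C(1)[of x] C(1)[of y] by (metis exp_gt_zero zero_less_mult_pos, metis exp_ge_zero linorder_not_le mult_nonneg_nonneg)
  moreover have "C z = 0"
  proof -
    have "tp_M z = z * (exp z - 1)" using tp_LG by (simp add: tp_M_def tp_G_def)
    then have "tp_E z = 0" by (simp add: tp_E_def power_mult_distrib)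
    then show ?thesis using C(1)[of z] by simp
  qed
  ultimately obtain u v where "x < u" "u < y" "C1 u < 0" "y < v" "v < z" "0 < C1 v"
    using deriv_neg_before_rise(1)[of x y C C1] deriv_neg_before_rise(2)[of y z C C1] assms cont C(2)
    by (metis order.strict_trans)
  then obtain w where "u < w" "w < v" "0 < C2 w"
    using deriv_neg_before_rise(2)[of u v C1 C2] cont C(3) by (metis order.strict_trans)
  then show False using C(4)[of w] assms \<open>x < u\<close> \<open>v < z\<close> by auto
qed


text \<open>\<open>1 + tp_s\<close> is the conjugate exponent of \<open>tp_L\<close>.\<close>

definition "tp_s = 1 / (tp_L - 1)"
text \<open>The logarithm of the quotient of the two competing products in \<open>tp_D'\<close>.
  Taking logarithms removes the real powers from the next derivative, which is rational in
  \<open>t\<close> and \<open>exp t\<close>.\<close>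

definition "tp_W t = tp_s * (ln (z + t) - ln (z - t))
   - (ln (tp_M t + z * (exp t - 1)) - ln (tp_M t - z * (exp t - 1)))"
definition "tp_W' t = tp_s * (1 / (z + t) + 1 / (z - t))
   - (((tp_L - 1) * (exp t - 1) - t * exp t + z * exp t) / (tp_M t + z * (exp t - 1))
      - ((tp_L - 1) * (exp t - 1) - t * exp t - z * exp t) / (tp_M t - z * (exp t - 1)))"

lemma tp_s: "tp_s * (tp_L - 1) = 1" "tp_s > 0" "tp_s < 1"
  using tp_L_bounds by (auto simp: tp_s_def)

lemma tp_W_deriv:
  assumes "0 \<le> t" "t < z"
  shows "(tp_W has_real_derivative tp_W' t) (at t)"
proof -
  have M: "(tp_M has_real_derivative ((tp_L - 1) * (exp t - 1) - t * exp t)) (at t)"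
    unfolding tp_M_def by (auto intro!: derivative_eq_intros simp: algebra_simps)
  show ?thesis
    unfolding tp_W_def tp_W'_def using assms tp_Q_pos[OF assms] tp_P_pos[OF assms]
    by (auto intro!: derivative_eq_intros M simp: divide_simps mult.commute)
qed

lemma tp_W'_sign:
  assumes "0 \<le> t" "t < z"
  shows "tp_W' t * ((z^2 - t^2) * ((tp_M t)^2 - z^2 * (exp t - 1)^2) * (tp_L - 1)) = - 2 * z * tp_E t"
proof -
  define N M l P Q where "N = exp t - 1" and "M = tp_M t" and "l = tp_L - 1"
    and "P = M + z * N" and "Q = M - z * N"
  have e: "exp t = N + 1" by (simp add: N_def)
  have clear_denominators: "(1 / l * (1 / X + 1 / Y) - (a / P - b / Q)) * ((X * Y) * (P * Q) * l)
      = (X + Y) * P * Q - l * X * Y * (a * Q - b * P)"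
    if "l \<noteq> 0" "X \<noteq> 0" "Y \<noteq> 0" "P \<noteq> 0" "Q \<noteq> 0" for l X Y P Q a b :: real
    using that by (simp add: field_simps)
  have nz: "P \<noteq> 0" "Q \<noteq> 0" "z + t \<noteq> 0" "z - t \<noteq> 0" "l \<noteq> 0"
    using tp_Q_pos[OF assms] tp_P_pos[OF assms] assms tp_L_bounds
    by (auto simp: P_def Q_def M_def N_def l_def)
  have Meq: "M = tp_L * tp_G + tp_L * (N - t) - t * N"
    unfolding M_def tp_M_def tp_LG exp_tail_def N_def by simp
  have "tp_W' t = (1 / l) * (1 / (z + t) + 1 / (z - t))
      - ((l * N - t * (N + 1) + z * (N + 1)) / P - (l * N - t * (N + 1) - z * (N + 1)) / Q)"
    unfolding tp_W'_def tp_s_def P_def Q_def M_def l_def N_def by simp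
  also have "\<dots> * (((z + t) * (z - t)) * (P * Q) * l)
     = ((z + t) + (z - t)) * P * Q - l * (z + t) * (z - t) * ((l * N - t * (N + 1) + z * (N + 1)) * Q - (l * N - t * (N + 1) - z * (N + 1)) * P)"
    using nz by (intro clear_denominators)
  also have "\<dots> = 2 * z * P * Q - l * (z + t) * (z - t) * ((l * N - t * (N + 1) + z * (N + 1)) * Q - (l * N - t * (N + 1) - z * (N + 1)) * P)"
    by simp
  also have "\<dots> = - 2 * z * (l * (M * (N + 1) - N * (l * N - t * (N + 1))) * ((z + t) * (z - t)) - P * Q)"
    unfolding P_def Q_def by (simp add: algebra_simps)
  also have "M * (N + 1) - N * (l * N - t * (N + 1)) = tp_V t"
    unfolding tp_V_def tp_LG e Meq l_def by (simp add: algebra_simps power2_eq_square)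
  also have "(z + t) * (z - t) = z^2 - t^2" by (simp add: algebra_simps power2_eq_square)
  also have "P * Q = (tp_M t)^2 - z^2 * (exp t - 1)^2"
    by (simp add: P_def Q_def M_def N_def algebra_simps power2_eq_square)
  finally show ?thesis by (simp add: tp_E_def l_def)
qed

lemma tp_W'_sign_iff:
  assumes "0 \<le> t" "t < z"
  shows "tp_W' t < 0 \<longleftrightarrow> 0 < tp_E t" "0 < tp_W' t \<longleftrightarrow> tp_E t < 0"
proof -
  define c where "c = (z^2 - t^2) * ((tp_M t)^2 - z^2 * (exp t - 1)^2) * (tp_L - 1)"
  have "z^2 - t^2 > 0" using assms by (simp add: power_strict_mono)
  moreover have "(tp_M t)^2 - z^2 * (exp t - 1)^2 = (tp_M t - z * (exp t - 1)) * (tp_M t + z * (exp t - 1))"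
    by (simp add: algebra_simps power2_eq_square)
  ultimately have c: "c > 0"
    using tp_Q_pos[OF assms] tp_P_pos[OF assms] tp_L_bounds by (simp add: c_def)
  have eq: "tp_W' t * c = - (2 * z * tp_E t)" using tp_W'_sign[OF assms] by (simp add: c_def)
  have "tp_W' t < 0 \<longleftrightarrow> tp_W' t * c < 0" "0 < tp_W' t \<longleftrightarrow> 0 < tp_W' t * c"
    using c by (simp_all add: mult_less_0_iff zero_less_mult_iff)
  then show "tp_W' t < 0 \<longleftrightarrow> 0 < tp_E t" "0 < tp_W' t \<longleftrightarrow> tp_E t < 0"
    unfolding eq using z_pos by (auto simp: mult_less_0_iff zero_less_mult_iff)
qed

lemma tp_W_0: "tp_W 0 = 0"
  by (simp add: tp_W_def)

lemma tp_W_cont: "continuous_on {a..b} tp_W" if "0 \<le> a" "b < z"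
  using tp_W_deriv that by (intro continuous_at_imp_continuous_on ballI) (meson DERIV_isCont atLeastAtMost_iff order.trans order.strict_trans1)

text \<open>As \<open>tp_W\<close> starts at 0, a negative value needs \<open>tp_W' < 0\<close>
  before it and a later positive value needs \<open>tp_W' > 0\<close> after it;
  \<open>tp_E_no_drop\<close> forbids this order.\<close>

lemma tp_W_no_rise:
  assumes "0 < x" "x < y" "y < z" "tp_W x < 0"
  shows "tp_W y \<le> 0"
proof (rule ccontr)
  assume "\<not> tp_W y \<le> 0"
  then have *: "tp_W x < tp_W 0" "tp_W x < tp_W y" using assms tp_W_0 by auto
  obtain u where u: "0 < u" "u < x" "tp_W' u < 0"
    using deriv_neg_before_rise(1)[of 0 x tp_W tp_W'] assms * tp_W_cont[of 0 x] tp_W_deriv by force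
  obtain v where v: "x < v" "v < y" "0 < tp_W' v"
    using deriv_neg_before_rise(2)[of x y tp_W tp_W'] assms * tp_W_cont[of x y] tp_W_deriv by force
  have "0 < tp_E u" "tp_E v < 0" using tp_W'_sign_iff[of u] tp_W'_sign_iff[of v] u v assms by auto
  then show False using tp_E_no_drop[of u v] u v assms by auto
qed

definition "tp_D t = ln (((1 + t / z) powr (1 + tp_s) + (1 - t / z) powr (1 + tp_s)) / 2)
   - tp_s * ln (1 + exp_tail t / tp_G)"
definition "tp_D' t = (1 + tp_s) / z * ((1 + t / z) powr tp_s - (1 - t / z) powr tp_s)
     / ((1 + t / z) powr (1 + tp_s) + (1 - t / z) powr (1 + tp_s))
   - tp_s * (exp t - 1) / (tp_G + exp_tail t)"

lemma tp_D_deriv: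
  assumes "0 < t" "t < z"
  shows "(tp_D has_real_derivative tp_D' t) (at t)"
proof -
  have 1: "1 + t / z > 0" "1 - t / z > 0" using assms by (auto simp: field_simps)
  then have "1 + t / z \<noteq> 0" "1 - t / z \<noteq> 0" by linarith+
  then have 2: "(1 + t / z) powr (1 + tp_s) + (1 - t / z) powr (1 + tp_s) > 0"
    by (intro add_pos_pos) (auto simp only: powr_gt_zero)
  have 3: "1 + exp_tail t / tp_G > 0"
    using tp_G_pos exp_tail_nonneg[of t] by (simp add: add_pos_nonneg)
  have a: "((\<lambda>x. (1 + x / z) powr (1 + tp_s)) has_real_derivative (1 + tp_s) * (1 + t / z) powr tp_s * (1 / z)) (at t)"
  proof -
    have "((\<lambda>x. 1 + x / z) has_real_derivative 1 / z) (at t)"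
      using z_pos by (auto intro!: derivative_eq_intros)
    from DERIV_chain2[OF has_real_derivative_powr[OF 1(1), of "1 + tp_s"] this] show ?thesis by simp
  qed
  have b: "((\<lambda>x. (1 - x / z) powr (1 + tp_s)) has_real_derivative (1 + tp_s) * (1 - t / z) powr tp_s * (- 1 / z)) (at t)"
  proof -
    have "((\<lambda>x. 1 - x / z) has_real_derivative - 1 / z) (at t)"
      using z_pos by (auto intro!: derivative_eq_intros)
    from DERIV_chain2[OF has_real_derivative_powr[OF 1(2), of "1 + tp_s"] this] show ?thesis by simp
  qed
  have c: "((\<lambda>x. ln (((1 + x / z) powr (1 + tp_s) + (1 - x / z) powr (1 + tp_s)) / 2)) has_real_derivative
       ((1 + tp_s) * (1 + t / z) powr tp_s * (1 / z) + (1 + tp_s) * (1 - t / z) powr tp_s * (- 1 / z)) / 2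
       / (((1 + t / z) powr (1 + tp_s) + (1 - t / z) powr (1 + tp_s)) / 2)) (at t)"
    using DERIV_chain2[OF DERIV_ln_divide DERIV_cdivide[OF DERIV_add[OF a b], of 2]] 2
    by (simp add: mult.commute)
  have d: "((\<lambda>x. ln (1 + exp_tail x / tp_G)) has_real_derivative
       ((exp t - 1) / tp_G) / (1 + exp_tail t / tp_G)) (at t)"
    using 3 tp_G_pos by (auto intro!: derivative_eq_intros)
  have "1 + exp_tail t / tp_G = (tp_G + exp_tail t) / tp_G"
    using tp_G_pos by (simp add: add_divide_distrib)
  then have e: "((exp t - 1) / tp_G) / (1 + exp_tail t / tp_G) = (exp t - 1) / (tp_G + exp_tail t)"
    using tp_G_pos by simp
  have f: "((1 + tp_s) * (1 + t / z) powr tp_s * (1 / z) + (1 + tp_s) * (1 - t / z) powr tp_s * (- 1 / z)) / 2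
       / (((1 + t / z) powr (1 + tp_s) + (1 - t / z) powr (1 + tp_s)) / 2)
     = (1 + tp_s) / z * ((1 + t / z) powr tp_s - (1 - t / z) powr tp_s)
     / ((1 + t / z) powr (1 + tp_s) + (1 - t / z) powr (1 + tp_s))"
  proof -
    have "(u * v * (1 / w) + u * v' * (- 1 / w)) / 2 / (S / 2) = u / w * (v - v') / S" for u v v' w S :: real
    proof -
      have "u * v * (1 / w) + u * v' * (- 1 / w) = u / w * (v - v')"
        by (simp add: right_diff_distrib)
      then show ?thesis by simp
    qed
    then show ?thesis .
  qed
  show ?thesis
    unfolding tp_D_def tp_D'_def
    using DERIV_diff[OF c DERIV_cmult[OF d, of tp_s]] unfolding e f by (simp add: algebra_simps)
qed

lemma tp_D'_sign:
  assumes "0 < t" "t < z"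
  shows "tp_D' t < 0 \<longleftrightarrow> tp_W t < 0" "0 < tp_D' t \<longleftrightarrow> 0 < tp_W t"
proof -
  define A B N P Q H where "A = (1 + t / z) powr tp_s" and "B = (1 - t / z) powr tp_s"
    and "N = exp t - 1" and "P = tp_M t + z * N" and "Q = tp_M t - z * N" and "H = tp_G + exp_tail t"
  have 1: "1 + t / z > 0" "1 - t / z > 0" using assms by (auto simp: field_simps)
  have AB: "A > 0" "B > 0" using 1 assms by (auto simp: A_def B_def)
  have PQ: "P > 0" "Q > 0" using tp_Q_pos[of t] tp_P_pos[of t] assms by (auto simp: P_def Q_def N_def)
  have H: "H > 0" using tp_G_pos exp_tail_nonneg[of t] by (simp add: H_def add_pos_nonneg)
  define R where "R = (1 + t / z) * A + (1 - t / z) * B"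
  have R: "R > 0" using 1 AB by (simp add: R_def add_pos_pos)
  have zR: "z * R = (z + t) * A + (z - t) * B" using z_pos by (simp add: R_def field_simps)
  have p: "(1 + t / z) powr (1 + tp_s) = (1 + t / z) * A" "(1 - t / z) powr (1 + tp_s) = (1 - t / z) * B"
    using 1 by (simp_all add: powr_add A_def B_def)
  have ps: "1 + tp_s = tp_s * tp_L" using tp_s(1) by (simp add: algebra_simps)
  have LH: "tp_L * H = tp_M t + t * N"
    unfolding H_def tp_M_def tp_LG N_def by (simp add: algebra_simps)
  have "tp_D' t = tp_s * tp_L / z * (A - B) / R - tp_s * N / H"
    unfolding tp_D'_def p ps[symmetric] A_def[symmetric] B_def[symmetric] R_def N_def H_def by simp
  also have "\<dots> = tp_s / (z * R * H) * (tp_L * H * (A - B) - z * R * N)"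
    using R H z_pos by (simp add: field_simps)
  also have "tp_L * H * (A - B) - z * R * N = A * Q - B * P"
    unfolding zR LH P_def Q_def by (simp add: algebra_simps)
  finally have D: "tp_D' t = tp_s / (z * R * H) * (A * Q - B * P)" .
  obtain c where c: "c > 0" "tp_D' t = c * (A * Q - B * P)"
    using D R H z_pos tp_s by (metis divide_pos_pos mult_pos_pos)
  have "tp_W t = tp_s * (ln ((z + t) / z) - ln ((z - t) / z)) - (ln P - ln Q)"
    using assms by (simp add: tp_W_def P_def Q_def N_def ln_div)
  also have "\<dots> = (ln A + ln Q) - (ln B + ln P)"
    using 1 z_pos assms by (simp add: A_def B_def ln_powr algebra_simps add_divide_distrib diff_divide_distrib)
  also have "\<dots> = ln (A * Q) - ln (B * P)" using AB PQ by (simp add: ln_mult)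
  finally have W: "tp_W t = ln (A * Q) - ln (B * P)" .
  have "tp_W t < 0 \<longleftrightarrow> A * Q < B * P" "0 < tp_W t \<longleftrightarrow> B * P < A * Q"
    using AB PQ unfolding W by simp_all
  then show "tp_D' t < 0 \<longleftrightarrow> tp_W t < 0" "0 < tp_D' t \<longleftrightarrow> 0 < tp_W t"
    unfolding c(2) using c(1) by (auto simp: mult_less_0_iff zero_less_mult_iff)
qed

lemma tp_D_nonneg:
  assumes "0 \<le> t" "t \<le> z"
  shows "0 \<le> tp_D t"
proof (rule ccontr)
  assume neg: "\<not> 0 \<le> tp_D t"
  have D0: "tp_D 0 = 0" by (simp add: tp_D_def)
  have Dz: "tp_D z = 0"
    using z_pos tp_G_pos tp_s by (simp add: tp_D_def tp_G_def powr_add ln_powr)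
  have tt: "0 < t" "t < z" using neg D0 Dz assms by (metis order.order_iff_strict order.refl)+
  have cont: "continuous_on {0..z} tp_D"
  proof -
    have pos: "(1 + x / z) powr (1 + tp_s) + (1 - x / z) powr (1 + tp_s) > 0" if "0 \<le> x" for x
    proof -
      have "1 + x / z \<noteq> 0" using z_pos that divide_nonneg_pos[of x z] by linarith
      then show ?thesis by (intro add_pos_nonneg) (auto simp only: powr_gt_zero powr_ge_zero)
    qed
    have pos2: "1 + exp_tail x / tp_G > 0" for x
      using tp_G_pos exp_tail_nonneg[of x] by (simp add: add_pos_nonneg)
    have c1: "continuous_on {0..z} (\<lambda>x. (1 + x / z) powr (1 + tp_s))"
      using z_pos tp_s by (intro continuous_on_powr' continuous_intros) (auto simp: field_simps)
    have c2: "continuous_on {0..z} (\<lambda>x. (1 - x / z) powr (1 + tp_s))"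
      using z_pos tp_s by (intro continuous_on_powr' continuous_intros) (auto simp: field_simps)
    show ?thesis unfolding tp_D_def
      using pos pos2 tp_G_pos by (intro continuous_intros c1 c2) (auto simp: less_imp_neq[THEN not_sym] order.strict_implies_not_eq)
  qed
  have *: "tp_D t < tp_D 0" "tp_D t < tp_D z" using neg D0 Dz by auto
  obtain u where u: "0 < u" "u < t" "tp_D' u < 0"
    using deriv_neg_before_rise(1)[of 0 t tp_D tp_D'] tt * tp_D_deriv continuous_on_subset[OF cont, of "{0..t}"] by force
  obtain v where v: "t < v" "v < z" "0 < tp_D' v"
    using deriv_neg_before_rise(2)[of t z tp_D tp_D'] tt * tp_D_deriv continuous_on_subset[OF cont, of "{t..z}"] by force
  have "tp_W u < 0" "0 < tp_W v" using tp_D'_sign[of u] tp_D'_sign[of v] u v by auto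
  then show False using tp_W_no_rise[of u v] u v by auto
qed

end

text \<open>Serves to reflect \<theta> > 1/2 to \<open>1 - \<theta>\<close>: the right-hand side of
  the two-point inequality is symmetric, while the left-hand side can only grow.\<close>

lemma exp_tail_neg_le:
  assumes "t \<ge> 0" shows "exp_tail (- t) \<le> exp_tail t"
proof -
  let ?f = "\<lambda>x::real. exp x - exp (- x) - 2 * x"
  have "?f 0 \<le> ?f t"
  proof (rule DERIV_nonneg_imp_nondecreasing[OF assms])
    fix x :: real
    have "(?f has_real_derivative exp x + exp (- x) - 2) (at x)"
      by (auto intro!: derivative_eq_intros)
    moreover have "exp x + exp (- x) - 2 \<ge> 0"
      using exp_ge_add_one_self[of x] exp_ge_add_one_self[of "-x"] by linarith
    ultimately show "\<exists>y. (?f has_real_derivative y) (at x) \<and> 0 \<le> y" by blast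
  qed
  then show ?thesis by (simp add: exp_tail_def)
qed

text \<open>\<open>p\<close> is the conjugate exponent of \<open>L\<close>. Equality holds at
  \<theta> = 0 and \<theta> = 1/2, the zeros \<open>t = z\<close> and \<open>t = 0\<close> of
  \<open>tp_D\<close>. The base on the left is the growth rate in
  \<open>fibre_prob_upper\<close>.\<close>

theorem two_point_inequality:
  fixes z \<theta> :: real
  assumes z: "0 < z" and \<theta>: "0 \<le> \<theta>" "\<theta> \<le> 1"
  defines "L \<equiv> tail_mean z"
  defines "p \<equiv> 1 + 1 / (L - 1)"
  shows "(1 + exp_tail ((1 - 2 * \<theta>) * z) / exp_tail z) / 2
           \<le> (\<theta> powr p + (1 - \<theta>) powr p) powr (L - 1)"
proof -
  have L2: "L > 2" using tp_L_bounds[OF z] tp_L_def[OF z] by (simp add: L_def)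
  have main: "(1 + exp_tail ((1 - 2 * u) * z) / exp_tail z) / 2
           \<le> (u powr p + (1 - u) powr p) powr (L - 1)" if u: "0 \<le> u" "u \<le> 1/2" for u
  proof -
    define t where "t = (1 - 2 * u) * z"
    have t: "0 \<le> t" "t \<le> z" using u z by (auto simp: t_def mult_le_cancel_right1)
    have tz: "1 + t / z = 2 * (1 - u)" "1 - t / z = 2 * u" using z by (simp_all add: t_def)
    define S where "S = u powr p + (1 - u) powr p"
    have S: "S > 0" using u by (simp add: S_def add_nonneg_pos)
    have p': "1 + tp_s z = p" by (simp add: tp_s_def[OF z] tp_L_def[OF z] p_def L_def)
    have "((2 * (1 - u)) powr p + (2 * u) powr p) / 2 = 2 powr (p - 1) * S"
      using powr_mult[of 2 "1 - u" p] powr_mult[of 2 u p] u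
      by (simp only: S_def) (simp add: powr_diff field_simps)
    then have D: "tp_D z t = ln (2 powr (p - 1) * S) - (p - 1) * ln (1 + exp_tail t / exp_tail z)"
      using p' by (simp add: tp_D_def[OF z] tz tp_G_def[OF z])
    have r: "1 + exp_tail t / exp_tail z > 0"
      using exp_tail_pos[OF z] exp_tail_nonneg[of t] by (simp add: add_pos_nonneg)
    have "(p - 1) * ln (1 + exp_tail t / exp_tail z) \<le> (p - 1) * ln 2 + ln S"
      using tp_D_nonneg[OF z t] S unfolding D by (simp add: ln_mult ln_powr)
    then have "(L - 1) * ((p - 1) * ln (1 + exp_tail t / exp_tail z)) \<le> (L - 1) * ((p - 1) * ln 2 + ln S)"
      using L2 by (intro mult_left_mono) auto
    moreover have Lp: "(L - 1) * (p - 1) = 1" using L2 by (simp add: p_def)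
    ultimately have "ln (1 + exp_tail t / exp_tail z) \<le> ln 2 + (L - 1) * ln S"
      by (simp add: distrib_left mult.assoc[symmetric])
    also have "\<dots> = ln (2 * S powr (L - 1))" using S by (simp add: ln_mult ln_powr)
    finally have "1 + exp_tail t / exp_tail z \<le> 2 * S powr (L - 1)" using r S by simp
    then show ?thesis by (simp add: t_def S_def)
  qed
  show ?thesis
  proof (cases "\<theta> \<le> 1/2")
    case True
    then show ?thesis using main[of \<theta>] \<theta> by simp
  next
    case False
    have half_mono: "(1 + x) / 2 \<le> (1 + y) / 2" if "x \<le> y" for x y :: real using that by simp
    have eq: "(1 - 2 * (1 - \<theta>)) * z = - ((1 - 2 * \<theta>) * z)" by (simp add: algebra_simps)
    have "- ((1 - 2 * \<theta>) * z) \<ge> 0" using False z by (simp add: mult_nonpos_nonneg)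
    from exp_tail_neg_le[OF this]
    have "exp_tail ((1 - 2 * \<theta>) * z) / exp_tail z \<le> exp_tail ((1 - 2 * (1 - \<theta>)) * z) / exp_tail z"
      using exp_tail_pos[OF z] unfolding eq by (intro divide_right_mono) auto
    then have "(1 + exp_tail ((1 - 2 * \<theta>) * z) / exp_tail z) / 2
      \<le> (1 + exp_tail ((1 - 2 * (1 - \<theta>)) * z) / exp_tail z) / 2"
      by (rule half_mono)
    also have "\<dots> \<le> ((1 - \<theta>) powr p + \<theta> powr p) powr (L - 1)"
      using main[of "1 - \<theta>"] False \<theta> by simp
    finally show ?thesis by (simp add: add.commute)
  qed
qed

section \<open>Counting maps with even fibres\<close>

text \<open>For \<open>T = {}\<close> the parity condition is void and these maps are the blocks of
  2-core matrices. For general \<open>T\<close> they are the blocks annihilated from the left by the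
  indicator vector of \<open>T\<close>.\<close>

definition even_fibre_maps :: "'b set \<Rightarrow> 'a set \<Rightarrow> 'a set \<Rightarrow> ('a \<Rightarrow> 'b) set" where
  "even_fibre_maps C S T =
     {f \<in> S \<rightarrow>\<^sub>E C. \<forall>c\<in>C. 2 \<le> card {i \<in> S. f i = c} \<and> even (card {i \<in> T. f i = c})}"

text \<open>\<open>w\<close> and \<open>v\<close> are the numbers of elements inside and outside
  \<open>T\<close>. One fibre is split off at a time, with \<open>a\<close> elements inside and
  \<open>b\<close> outside.\<close>

fun fibre_count :: "nat \<Rightarrow> nat \<Rightarrow> nat \<Rightarrow> nat" where
  "fibre_count 0 w v = (if w = 0 \<and> v = 0 then 1 else 0)"
| "fibre_count (Suc n) w v = (\<Sum>a\<le>w. \<Sum>b\<le>v.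
     if even a \<and> 2 \<le> a + b then (w choose a) * (v choose b) * fibre_count n (w - a) (v - b) else 0)"

lemma finite_even_fibre_maps: "finite C \<Longrightarrow> finite S \<Longrightarrow> finite (even_fibre_maps C S T)"
  unfolding even_fibre_maps_def by (rule finite_subset[of _ "S \<rightarrow>\<^sub>E C"]) (auto intro: finite_PiE)

text \<open>A map is determined by its fibre \<open>A\<close> over \<open>c\<close> and its
  restriction to the rest; the conditions on the other fibres do not see \<open>A\<close>. This is
  the recursion of \<open>fibre_count\<close>.\<close>

lemma even_fibre_maps_insert_bij:
  assumes "c \<notin> C" "T \<subseteq> S"
  shows "bij_betw (\<lambda>f. ({i \<in> S. f i = c}, restrict f (S - {i \<in> S. f i = c})))
     (even_fibre_maps (insert c C) S T)
     (SIGMA A : {A \<in> Pow S. even (card (A \<inter> T)) \<and> 2 \<le> card A}. even_fibre_maps C (S - A) (T - A))"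
proof (rule bij_betwI[where g = "\<lambda>(A, h). \<lambda>i\<in>S. if i \<in> A then c else h i"], goal_cases)
  case 1
  show ?case
  proof
    fix f assume f: "f \<in> even_fibre_maps (insert c C) S T"
    let ?A = "{i \<in> S. f i = c}"
    have "?A \<inter> T = {i \<in> T. f i = c}" using assms by auto
    moreover have "{i \<in> S - ?A. restrict f (S - ?A) i = c'} = {i \<in> S. f i = c'}"
      "{i \<in> T - ?A. restrict f (S - ?A) i = c'} = {i \<in> T. f i = c'}" if "c' \<in> C" for c'
      using that assms by auto
    ultimately show "(?A, restrict f (S - ?A)) \<in> (SIGMA A : {A \<in> Pow S. even (card (A \<inter> T)) \<and> 2 \<le> card A}.
        even_fibre_maps C (S - A) (T - A))"
      using f by (auto simp: even_fibre_maps_def)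
  qed
next
  case 2
  show ?case
  proof (clarsimp)
    fix A h assume A: "A \<subseteq> S" "even (card (A \<inter> T))" "2 \<le> card A"
      and h: "h \<in> even_fibre_maps C (S - A) (T - A)"
    let ?f = "\<lambda>i\<in>S. if i \<in> A then c else h i"
    have hC: "h i \<in> C" if "i \<in> S - A" for i using h that by (auto simp: even_fibre_maps_def)
    have c: "{i \<in> S. ?f i = c} = A" "{i \<in> T. ?f i = c} = A \<inter> T"
      using A hC assms by auto
    have c': "{i \<in> S. ?f i = c'} = {i \<in> S - A. h i = c'}" "{i \<in> T. ?f i = c'} = {i \<in> T - A. h i = c'}"
      if "c' \<in> C" for c' using that A assms by auto
    show "?f \<in> even_fibre_maps (insert c C) S T"
      unfolding even_fibre_maps_def mem_Collect_eq ball_simps c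
      using A h c' hC by (auto simp: even_fibre_maps_def)
  qed
next
  case (3 f)
  then show ?case by (auto simp: even_fibre_maps_def PiE_def extensional_def fun_eq_iff)
next
  case (4 y)
  obtain A h where y: "y = (A, h)" and A: "A \<subseteq> S" and h: "h \<in> even_fibre_maps C (S - A) (T - A)"
    using 4 by auto
  have "h i \<in> C" if "i \<in> S - A" for i using h that by (auto simp: even_fibre_maps_def)
  moreover define f where "f = (\<lambda>i\<in>S. if i \<in> A then c else h i)"
  ultimately have eq: "{i \<in> S. f i = c} = A" using A assms by auto
  have "h i = undefined" if "i \<notin> S - A" for i
    using h that by (auto simp: even_fibre_maps_def PiE_def extensional_def)
  then have "restrict f (S - A) = h" by (auto simp: f_def fun_eq_iff)
  then show ?case unfolding y prod.case f_def[symmetric] eq by simp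
qed

lemma sum_Pow_card:
  fixes h :: "nat \<Rightarrow> nat"
  assumes "finite T"
  shows "(\<Sum>A\<in>Pow T. h (card A)) = (\<Sum>a\<le>card T. (card T choose a) * h a)"
proof -
  have "(\<Sum>A\<in>Pow T. h (card A)) = (\<Sum>a\<le>card T. \<Sum>A\<in>{A \<in> Pow T. card A = a}. h (card A))"
    using assms by (intro sum.group[symmetric]) (auto intro: card_mono)
  also have "\<dots> = (\<Sum>a\<le>card T. (card T choose a) * h a)"
    using n_subsets[OF assms] by (intro sum.cong) (auto simp: Pow_def)
  finally show ?thesis .
qed

text \<open>Since only cardinalities matter, later counting arguments may take initial segments of
  the naturals for all sets.\<close>

lemma card_even_fibre_maps:
  assumes "finite C" "finite S" "T \<subseteq> S"
  shows "card (even_fibre_maps C S T) = fibre_count (card C) (card T) (card (S - T))"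
  using assms
proof (induction C arbitrary: S T rule: finite_induct)
  case empty
  have "card (even_fibre_maps {} S T) = (if S = {} then 1 else 0)"
    by (auto simp: even_fibre_maps_def)
  moreover have "card T = 0 \<and> card (S - T) = 0 \<longleftrightarrow> S = {}"
    using empty finite_subset by (auto dest: finite_subset)
  ultimately show ?case by (simp only: card.empty fibre_count.simps)
next
  case (insert c C)
  have fT: "finite T" using insert finite_subset by blast
  let ?P = "{A \<in> Pow S. even (card (A \<inter> T)) \<and> 2 \<le> card A}"
  let ?h = "\<lambda>a b. if even a \<and> 2 \<le> a + b then fibre_count (card C) (card T - a) (card (S - T) - b) else 0"
  have split: "card A = card (A \<inter> T) + card (A - T)" if "A \<subseteq> S" for A
    using card_Int_Diff[of A T] that insert.prems finite_subset by blast
  have "card (even_fibre_maps (insert c C) S T)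
      = card (SIGMA A : ?P. even_fibre_maps C (S - A) (T - A))"
    by (rule bij_betw_same_card[OF even_fibre_maps_insert_bij]) (use insert in auto)
  also have "\<dots> = (\<Sum>A\<in>?P. card (even_fibre_maps C (S - A) (T - A)))"
    using insert.prems insert.hyps by (intro card_SigmaI) (auto intro!: finite_even_fibre_maps)
  also have "\<dots> = (\<Sum>A\<in>?P. ?h (card (A \<inter> T)) (card (A - T)))"
  proof (rule sum.cong[OF refl])
    fix A assume A: "A \<in> ?P"
    have "card (T - A) = card T - card (A \<inter> T)"
      using card_Diff_subset_Int[of T A] fT by (simp add: Int_commute)
    moreover have "card (S - A - (T - A)) = card (S - T) - card (A - T)"
    proof -
      have "S - A - (T - A) = (S - T) - (A - T)" by auto
      then show ?thesis using A insert.prems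
        by (metis (no_types, lifting) CollectD Diff_mono PowD card_Diff_subset finite_Diff finite_subset order_refl)
    qed
    moreover have "card (even_fibre_maps C (S - A) (T - A))
        = fibre_count (card C) (card (T - A)) (card (S - A - (T - A)))"
      using insert.prems by (intro insert.IH) auto
    ultimately show "card (even_fibre_maps C (S - A) (T - A)) = ?h (card (A \<inter> T)) (card (A - T))"
      using A split[of A] by auto
  qed
  also have "\<dots> = (\<Sum>A\<in>Pow S. ?h (card (A \<inter> T)) (card (A - T)))"
    using insert.prems by (intro sum.mono_neutral_left) (auto simp flip: split)
  also have "\<dots> = (\<Sum>(X, Y)\<in>Pow T \<times> Pow (S - T). ?h (card X) (card Y))"
    by (rule sum.reindex_bij_witness[where i = "\<lambda>(X, Y). X \<union> Y" and j = "\<lambda>A. (A \<inter> T, A - T)"])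
      (use insert.prems in \<open>auto simp: Int_Un_distrib2 Un_Diff\<close>)
  also have "\<dots> = (\<Sum>X\<in>Pow T. \<Sum>Y\<in>Pow (S - T). ?h (card X) (card Y))"
    by (simp add: sum.cartesian_product)
  also have "\<dots> = (\<Sum>X\<in>Pow T. (\<lambda>a. \<Sum>b\<le>card (S - T). (card (S - T) choose b) * ?h a b) (card X))"
    using sum_Pow_card[of "S - T"] insert.prems by (intro sum.cong) auto
  also have "\<dots> = (\<Sum>a\<le>card T. (card T choose a) * (\<Sum>b\<le>card (S - T). (card (S - T) choose b) * ?h a b))"
    by (rule sum_Pow_card[OF fT, where h = "\<lambda>a. \<Sum>b\<le>card (S - T). (card (S - T) choose b) * ?h a b"])
  also have "\<dots> = fibre_count (card (insert c C)) (card T) (card (S - T))"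
    using insert.hyps by (auto simp: sum_distrib_left intro!: sum.cong)
  finally show ?case .
qed

section \<open>Comparing counts by adding and removing rows\<close>

text \<open>A new element outside \<open>T\<close> may take any value: it changes no parity and only
  enlarges a fibre.\<close>

lemma card_even_fibre_maps_extend:
  assumes "finite C" "finite S" "T \<subseteq> S" "e \<notin> S"
  shows "card C * card (even_fibre_maps C S T) \<le> card (even_fibre_maps C (insert e S) T)"
proof -
  let ?\<phi> = "\<lambda>(c, f). f(e := c)"
  have "inj_on ?\<phi> (C \<times> even_fibre_maps C S T)"
  proof (intro inj_onI, clarify)
    fix c f c' f' assume f: "f \<in> even_fibre_maps C S T" "f' \<in> even_fibre_maps C S T"
      and eq: "f(e := c) = f'(e := c')"
    have "f e = undefined" "f' e = undefined"
      using f assms by (auto simp: even_fibre_maps_def PiE_def extensional_def)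
    then show "c = c' \<and> f = f'" using eq by (metis fun_upd_same fun_upd_triv fun_upd_upd)
  qed
  moreover have "?\<phi> ` (C \<times> even_fibre_maps C S T) \<subseteq> even_fibre_maps C (insert e S) T"
  proof (clarify)
    fix c f assume c: "c \<in> C" and f: "f \<in> even_fibre_maps C S T"
    have "2 \<le> card {i \<in> insert e S. (f(e := c)) i = c'}" if "c' \<in> C" for c'
    proof -
      have "2 \<le> card {i \<in> S. f i = c'}" using f that by (auto simp: even_fibre_maps_def)
      also have "\<dots> \<le> card {i \<in> insert e S. (f(e := c)) i = c'}"
        using assms by (intro card_mono) auto
      finally show ?thesis .
    qed
    moreover have "{i \<in> T. (f(e := c)) i = c'} = {i \<in> T. f i = c'}" for c' using assms by auto
    moreover have "f(e := c) \<in> insert e S \<rightarrow>\<^sub>E C"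
      using c f by (auto simp: even_fibre_maps_def PiE_def extensional_def)
    ultimately show "f(e := c) \<in> even_fibre_maps C (insert e S) T"
      using f by (simp add: even_fibre_maps_def)
  qed
  ultimately have "card (C \<times> even_fibre_maps C S T) \<le> card (even_fibre_maps C (insert e S) T)"
    using assms by (intro card_inj_on_le) (auto intro: finite_even_fibre_maps)
  then show ?thesis by (simp add: card_cartesian_product)
qed

text \<open>A new value \<open>c\<close> gets the fibre \<open>{e, d}\<close> outside
  \<open>T\<close>. The choice is recovered from the result: \<open>c\<close> is the value at
  \<open>e\<close>, and \<open>d\<close> is the only other element of that fibre.\<close>

lemma card_even_fibre_maps_new_pair:
  assumes "finite C" "finite S" "T \<subseteq> S" "e \<notin> S"
  shows "(\<Sum>c\<in>C. \<Sum>d\<in>S - T. card (even_fibre_maps (C - {c}) (S - {d}) T))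
     \<le> card (even_fibre_maps C (insert e S) T)"
proof -
  let ?D = "SIGMA c : C. SIGMA d : S - T. even_fibre_maps (C - {c}) (S - {d}) T"
  let ?\<phi> = "\<lambda>(c, d, f). f(e := c, d := c)"
  have fib: "{i \<in> insert e S. (f(e := c, d := c)) i = c} = {e, d}"
    if "d \<in> S - T" "f \<in> even_fibre_maps (C - {c}) (S - {d}) T" for c d f
    using that assms by (auto simp: even_fibre_maps_def)
  have "inj_on ?\<phi> ?D"
  proof (rule inj_onI, clarsimp simp del: fun_upd_apply)
    fix c d f c' d' f'
    assume d: "d \<in> S" "d \<notin> T" "f \<in> even_fibre_maps (C - {c}) (S - {d}) T"
      "d' \<in> S" "d' \<notin> T" "f' \<in> even_fibre_maps (C - {c'}) (S - {d'}) T"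
      and eq: "f(e := c, d := c) = f'(e := c', d' := c')"
    have ed: "e \<noteq> d" "e \<noteq> d'" using d assms by auto
    have c: "c = c'" using fun_cong[OF eq, of e] ed by simp
    define h where "h = f(e := c, d := c)"
    have h': "h = f'(e := c, d' := c)" using eq c by (simp only: h_def)
    have "{i \<in> insert e S. h i = c} = {e, d}"
      unfolding h_def by (intro fib) (use d in auto)
    moreover have "{i \<in> insert e S. h i = c} = {e, d'}"
      unfolding h' by (intro fib) (use d c in auto)
    ultimately have "{e, d} = {e, d'}" by (simp only:)
    then have dd: "d = d'" using ed by auto
    have un: "f e = undefined" "f' e = undefined" "f d = undefined" "f' d = undefined"
      using d dd assms by (auto simp: even_fibre_maps_def PiE_def extensional_def)
    have "f x = f' x" for x
      using fun_cong[OF eq, of x] un dd by (cases "x = e"; cases "x = d") auto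
    then show "c = c' \<and> d = d' \<and> f = f'" using c dd by auto
  qed
  moreover have "?\<phi> ` ?D \<subseteq> even_fibre_maps C (insert e S) T"
  proof (clarify)
    fix c d f assume d: "c \<in> C" "d \<in> S" "d \<notin> T" "f \<in> even_fibre_maps (C - {c}) (S - {d}) T"
    let ?h = "f(e := c, d := c)"
    have 1: "{i \<in> insert e S. ?h i = c'} = {i \<in> S - {d}. f i = c'}" if "c' \<noteq> c" for c'
      using that assms by auto
    have 2: "{i \<in> T. ?h i = c'} = {i \<in> T. f i = c'}" for c' using d assms by auto
    have fC: "f i \<in> C - {c}" if "i \<in> S - {d}" for i using d that by (auto simp: even_fibre_maps_def)
    have 3: "{i \<in> T. f i = c} = {}" using d fC assms by blast
    have "e \<noteq> d" using d assms by blast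
    then have "card {e, d} = 2" by simp
    moreover have "?h \<in> insert e S \<rightarrow>\<^sub>E C"
      using d fC by (auto simp: even_fibre_maps_def PiE_def extensional_def)
    moreover have "2 \<le> card {i \<in> insert e S. ?h i = c'}" "even (card {i \<in> T. ?h i = c'})"
      if "c' \<in> C" for c'
    proof -
      have "2 \<le> card {i \<in> insert e S. ?h i = c'} \<and> even (card {i \<in> T. ?h i = c'})"
      proof (cases "c' = c")
        case True
        have "{i \<in> insert e S. ?h i = c} = {e, d}" by (intro fib) (use d in auto)
        then show ?thesis unfolding True 2 3 using \<open>card {e, d} = 2\<close> by (simp only:) simp
      next
        case False
        then show ?thesis unfolding 1[OF False] 2 using d that by (simp add: even_fibre_maps_def)
      qed
      then show "2 \<le> card {i \<in> insert e S. ?h i = c'}" "even (card {i \<in> T. ?h i = c'})" by blast+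
    qed
    ultimately show "?h \<in> even_fibre_maps C (insert e S) T"
      unfolding even_fibre_maps_def by blast
  qed
  ultimately have "card ?D \<le> card (even_fibre_maps C (insert e S) T)"
    using assms by (intro card_inj_on_le) (auto intro: finite_even_fibre_maps)
  moreover have "card ?D = (\<Sum>c\<in>C. \<Sum>d\<in>S - T. card (even_fibre_maps (C - {c}) (S - {d}) T))"
    using assms by (subst card_SigmaI) (auto intro!: finite_even_fibre_maps finite_SigmaI sum.cong card_SigmaI)
  ultimately show ?thesis by simp
qed

text \<open>
  A distinguished element \<open>a\<close> of \<open>T\<close> shares its fibre with another element \<open>b\<close> of \<open>T\<close>.
  Once both are removed, the fibre is large enough, empty, or a single element outside \<open>T\<close>.
\<close>

lemma even_fibre_maps_remove_pair:
  assumes "finite S" "T \<subseteq> S" "a \<in> T" and f: "f \<in> even_fibre_maps C S T"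
  obtains b c where "b \<in> T - {a}" "c \<in> C"
    "f \<in> (\<lambda>h. h(a := c, b := c)) ` even_fibre_maps C (S - {a, b}) (T - {a, b})
       \<or> f \<in> (\<lambda>h. h(a := c, b := c)) ` even_fibre_maps (C - {c}) (S - {a, b}) (T - {a, b})
       \<or> (\<exists>d\<in>S - T. f \<in> (\<lambda>h. h(a := c, b := c, d := c)) ` even_fibre_maps (C - {c}) (S - {a, b} - {d}) (T - {a, b}))"
proof -
  have fT: "finite T" using assms finite_subset by blast
  define c where "c = f a"
  have fC: "f i \<in> C" if "i \<in> S" for i using f that by (auto simp: even_fibre_maps_def)
  have cC: "c \<in> C" using fC assms by (auto simp: c_def)
  have out: "f i = undefined" if "i \<notin> S" for i
    using f that by (auto simp: even_fibre_maps_def PiE_def extensional_def)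
  have ev: "even (card {i \<in> T. f i = c'})" "2 \<le> card {i \<in> S. f i = c'}" if "c' \<in> C" for c'
    using f that by (auto simp: even_fibre_maps_def)
  have "{i \<in> T. f i = c} \<noteq> {a}" using ev(1)[OF cC] by auto
  then obtain b where b: "b \<in> T" "b \<noteq> a" "f b = c" using assms c_def by blast
  define S' T' F where "S' = S - {a, b}" and "T' = T - {a, b}" and "F = {i \<in> S'. f i = c}"
  have sub: "T' \<subseteq> S'" "finite S'" using assms by (auto simp: S'_def T'_def)
  have other: "{i \<in> S'. f i = c'} = {i \<in> S. f i = c'}" "{i \<in> T'. f i = c'} = {i \<in> T. f i = c'}"
    if "c' \<noteq> c" for c' using that b by (auto simp: S'_def T'_def c_def)
  have "{i \<in> T. f i = c} = insert a (insert b {i \<in> T'. f i = c})"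
    using assms b by (auto simp: T'_def c_def)
  moreover have "card (insert a (insert b {i \<in> T'. f i = c})) = card {i \<in> T'. f i = c} + 2"
    using b fT by (subst card_insert_disjoint; auto simp: T'_def)
  ultimately have evT': "even (card {i \<in> T'. f i = c})" using ev(1)[OF cC] by simp
  have fin: "finite F" using sub by (simp add: F_def)
  consider "2 \<le> card F" | "card F = 0" | "card F = 1" by linarith
  then have "f \<in> (\<lambda>h. h(a := c, b := c)) ` even_fibre_maps C S' T'
       \<or> f \<in> (\<lambda>h. h(a := c, b := c)) ` even_fibre_maps (C - {c}) S' T'
       \<or> (\<exists>d\<in>S - T. f \<in> (\<lambda>h. h(a := c, b := c, d := c)) ` even_fibre_maps (C - {c}) (S' - {d}) T')"
  proof cases
    case 1
    let ?h = "restrict f S'"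
    have "f = ?h(a := c, b := c)" using b out by (auto simp: S'_def c_def fun_eq_iff)
    moreover have "?h \<in> even_fibre_maps C S' T'"
    proof -
      have e: "{i \<in> S'. ?h i = c'} = {i \<in> S'. f i = c'}" "{i \<in> T'. ?h i = c'} = {i \<in> T'. f i = c'}" for c'
        using sub by auto
      show ?thesis unfolding even_fibre_maps_def mem_Collect_eq e
      proof (intro conjI ballI)
        show "?h \<in> S' \<rightarrow>\<^sub>E C" using fC by (auto simp: S'_def)
        fix c' assume "c' \<in> C"
        then show "2 \<le> card {i \<in> S'. f i = c'}" "even (card {i \<in> T'. f i = c'})"
          using 1 evT' other[of c'] ev[of c'] by (cases "c' = c"; simp add: F_def)+
      qed
    qed
    ultimately show ?thesis by blast
  next
    case 2
    let ?h = "restrict f S'"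
    have none: "f i \<noteq> c" if "i \<in> S'" for i using 2 fin that by (auto simp: F_def)
    have "f = ?h(a := c, b := c)" using b out by (auto simp: S'_def c_def fun_eq_iff)
    moreover have "?h \<in> even_fibre_maps (C - {c}) S' T'"
    proof -
      have e: "{i \<in> S'. ?h i = c'} = {i \<in> S. f i = c'}" "{i \<in> T'. ?h i = c'} = {i \<in> T. f i = c'}"
        if "c' \<in> C - {c}" for c'
        using sub other[of c'] that by auto
      have "?h \<in> S' \<rightarrow>\<^sub>E C - {c}" using none fC by (auto simp: S'_def)
      then show ?thesis using e ev by (simp add: even_fibre_maps_def)
    qed
    ultimately show ?thesis by blast
  next
    case 3
    then obtain d where d: "F = {d}" by (auto simp: card_1_singleton_iff)
    have dS: "d \<in> S'" "f d = c" using d by (auto simp: F_def)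
    have "d \<notin> T"
    proof
      assume "d \<in> T"
      then have "{i \<in> T'. f i = c} = {d}" using d dS sub by (auto simp: F_def S'_def T'_def)
      then show False using evT' by simp
    qed
    let ?h = "restrict f (S' - {d})"
    have none: "f i \<noteq> c" if "i \<in> S' - {d}" for i using d that by (auto simp: F_def)
    have "f x = (?h(a := c, b := c, d := c)) x" for x
      using b(3) dS(2) out[of x] c_def
      by (cases "x = a"; cases "x = b"; cases "x = d"; cases "x \<in> S") (simp_all add: S'_def)
    then have "f = ?h(a := c, b := c, d := c)" by (rule ext)
    moreover have "?h \<in> even_fibre_maps (C - {c}) (S' - {d}) T'"
    proof -
      have e: "{i \<in> S' - {d}. ?h i = c'} = {i \<in> S. f i = c'}" "{i \<in> T'. ?h i = c'} = {i \<in> T. f i = c'}"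
        if "c' \<in> C - {c}" for c'
        using sub other[of c'] that dS \<open>d \<notin> T\<close> by (auto simp: T'_def)
      have "?h \<in> (S' - {d}) \<rightarrow>\<^sub>E C - {c}" using none fC by (auto simp: S'_def)
      then show ?thesis using e ev by (simp add: even_fibre_maps_def)
    qed
    moreover have "d \<in> S - T" using dS \<open>d \<notin> T\<close> by (simp add: S'_def)
    ultimately show ?thesis by (intro disjI2 bexI[of _ d] image_eqI)
  qed
  then show ?thesis using that[of b c] b cC by (simp add: S'_def T'_def)
qed

lemma fibre_count_extend: "n * fibre_count n w v \<le> fibre_count n w (Suc v)"
proof -
  have "card {..<n} * card (even_fibre_maps {..<n} {..<w + v} {..<w})
      \<le> card (even_fibre_maps {..<n} (insert (w + v) {..<w + v}) {..<w})"
    by (rule card_even_fibre_maps_extend) auto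
  moreover have "{..<w + v} - {..<w} = {w..<w + v}" "insert (w + v) {..<w + v} - {..<w} = {w..<w + Suc v}"
    by auto
  moreover have "{..<w} \<subseteq> insert (w + v) {..<w + v}" by auto
  ultimately show ?thesis by (simp add: card_even_fibre_maps)
qed

lemma fibre_count_new_pair:
  "Suc n * (Suc v * fibre_count n w v) \<le> fibre_count (Suc n) w (Suc (Suc v))"
proof -
  let ?S = "{..<w + Suc v}" and ?C = "{..<Suc n}" and ?T = "{..<w}"
  have S: "?S - ?T = {w..<w + Suc v}" "insert (w + Suc v) ?S - ?T = {w..<w + Suc (Suc v)}" by auto
  have "card (even_fibre_maps (?C - {c}) (?S - {d}) ?T) = fibre_count n w v"
    if "c \<in> ?C" "d \<in> ?S - ?T" for c d
  proof -
    have "?S - {d} - ?T = {w..<w + Suc v} - {d}" by auto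
    then have "card (?S - {d} - ?T) = v" using that by simp
    moreover have "?T \<subseteq> ?S - {d}" using that by auto
    ultimately show ?thesis using that by (simp add: card_even_fibre_maps)
  qed
  then have "(\<Sum>c\<in>?C. \<Sum>d\<in>?S - ?T. card (even_fibre_maps (?C - {c}) (?S - {d}) ?T))
      = (\<Sum>c\<in>?C. \<Sum>d\<in>?S - ?T. fibre_count n w v)"
    by (intro sum.cong refl)
  also have "\<dots> = Suc n * (Suc v * fibre_count n w v)" unfolding S by simp
  finally have "Suc n * (Suc v * fibre_count n w v) \<le> card (even_fibre_maps ?C (insert (w + Suc v) ?S) ?T)"
    using card_even_fibre_maps_new_pair[of ?C ?S ?T "w + Suc v"] by auto
  also have "\<dots> = fibre_count (Suc n) w (Suc (Suc v))"
    by (subst card_even_fibre_maps) (auto simp only: S finite_lessThan finite_insert card_lessThan card_atLeastLessThan diff_add_inverse)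
  finally show ?thesis .
qed

text \<open>A union bound with row \<open>0\<close> as the distinguished element:
  \<open>w + 1\<close> partners \<open>b\<close>, \<open>Suc n\<close> common values
  \<open>c\<close>, and \<open>v\<close> choices of the leftover row \<open>d\<close> when there is
  one.\<close>

lemma fibre_count_remove_pair:
  "fibre_count (Suc n) (w + 2) v
     \<le> (w + 1) * (Suc n * (fibre_count (Suc n) w v + fibre_count n w v + v * fibre_count n w (v - 1)))"
proof -
  let ?S = "{..<w + 2 + v}" and ?C = "{..<Suc n}" and ?T = "{..<w + 2}"
  let ?X = "\<lambda>b c. (\<lambda>h. h(0 := c, b := c)) ` even_fibre_maps ?C (?S - {0, b}) (?T - {0, b})"
  let ?Y = "\<lambda>b c. (\<lambda>h. h(0 := c, b := c)) ` even_fibre_maps (?C - {c}) (?S - {0, b}) (?T - {0, b})"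
  let ?Z = "\<lambda>b c d. (\<lambda>h. h(0 := c, b := c, d := c)) ` even_fibre_maps (?C - {c}) (?S - {0, b} - {d}) (?T - {0, b})"
  let ?U = "\<lambda>b c. ?X b c \<union> ?Y b c \<union> (\<Union>d\<in>?S - ?T. ?Z b c d)"
  have ST: "?S - ?T = {w + 2..<w + 2 + v}" by auto
  have fin: "finite (even_fibre_maps C S T)" if "finite C" "finite S" for C :: "nat set" and S T :: "nat set"
    using that by (rule finite_even_fibre_maps)
  have sub: "even_fibre_maps ?C ?S ?T \<subseteq> (\<Union>b\<in>?T - {0}. \<Union>c\<in>?C. ?U b c)"
  proof
    fix f assume f: "f \<in> even_fibre_maps ?C ?S ?T"
    have "finite ?S" "?T \<subseteq> ?S" "0 \<in> ?T" by auto
    then show "f \<in> (\<Union>b\<in>?T - {0}. \<Union>c\<in>?C. ?U b c)"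
    proof (rule even_fibre_maps_remove_pair[OF _ _ _ f])
      fix b c
      assume "b \<in> ?T - {0}" "c \<in> ?C" "f \<in> ?X b c \<or> f \<in> ?Y b c \<or> (\<exists>d\<in>?S - ?T. f \<in> ?Z b c d)"
      then show "f \<in> (\<Union>b\<in>?T - {0}. \<Union>c\<in>?C. ?U b c)"
        by (intro UN_I[of b] UN_I[of c]) (simp_all only: Un_iff UN_iff disj_assoc)
    qed
  qed
  have U: "card (?U b c) \<le> fibre_count (Suc n) w v + fibre_count n w v + v * fibre_count n w (v - 1)"
    if b: "b \<in> ?T - {0}" and c: "c \<in> ?C" for b c
  proof -
    have cT: "card (?T - {0, b}) = w"
      using b by (subst card_Diff_subset) auto
    have sT: "?T - {0, b} \<subseteq> ?S - {0, b}" by auto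
    have "?S - {0, b} - (?T - {0, b}) = {w + 2..<w + 2 + v}" using b by auto
    then have cS: "card (?S - {0, b} - (?T - {0, b})) = v" by simp
    have eq: "card (even_fibre_maps C (?S - {0, b}) (?T - {0, b})) = fibre_count (card C) w v"
      if "finite C" for C :: "nat set"
      using card_even_fibre_maps[OF that _ sT] unfolding cS cT by blast
    have cc: "finite (?C - {c})" "card (?C - {c}) = n" "finite ?C" "card ?C = Suc n" using c by auto
    have X: "card (?X b c) \<le> fibre_count (Suc n) w v"
      using card_image_le[OF fin[of ?C "?S - {0, b}"], of "\<lambda>h. h(0 := c, b := c)" "?T - {0, b}"]
      unfolding eq[OF cc(3)] cc by blast
    have Y: "card (?Y b c) \<le> fibre_count n w v"
      using card_image_le[OF fin[of "?C - {c}" "?S - {0, b}"], of "\<lambda>h. h(0 := c, b := c)" "?T - {0, b}"]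
      unfolding eq[OF cc(1)] cc by blast
    have Z: "card (?Z b c d) \<le> fibre_count n w (v - 1)" if d: "d \<in> ?S - ?T" for d
    proof -
      have "?S - {0, b} - {d} - (?T - {0, b}) = {w + 2..<w + 2 + v} - {d}" using b by auto
      then have "card (?S - {0, b} - {d} - (?T - {0, b})) = v - 1" using d by (auto simp: ST)
      moreover have "?T - {0, b} \<subseteq> ?S - {0, b} - {d}" using d by auto
      ultimately have "card (even_fibre_maps (?C - {c}) (?S - {0, b} - {d}) (?T - {0, b})) = fibre_count n w (v - 1)"
        using card_even_fibre_maps[OF cc(1), of "?S - {0, b} - {d}" "?T - {0, b}"] unfolding cT cc by simp
      then show ?thesis
        using card_image_le[OF fin[of "?C - {c}" "?S - {0, b} - {d}"], of "\<lambda>h. h(0 := c, b := c, d := c)" "?T - {0, b}"]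
          cc(1) by simp
    qed
    have "card (\<Union>d\<in>?S - ?T. ?Z b c d) \<le> (\<Sum>d\<in>?S - ?T. card (?Z b c d))"
      by (rule card_UN_le) simp
    also have "\<dots> \<le> (\<Sum>d\<in>?S - ?T. fibre_count n w (v - 1))" using Z by (rule sum_mono)
    also have "\<dots> = v * fibre_count n w (v - 1)" unfolding ST by simp
    finally have "card (\<Union>d\<in>?S - ?T. ?Z b c d) \<le> v * fibre_count n w (v - 1)" .
    then show ?thesis
      using X Y card_Un_le[of "?X b c \<union> ?Y b c" "\<Union>d\<in>?S - ?T. ?Z b c d"] card_Un_le[of "?X b c" "?Y b c"]
      by linarith
  qed
  have "fibre_count (Suc n) (w + 2) v = card (even_fibre_maps ?C ?S ?T)"
    by (subst card_even_fibre_maps) (auto simp only: ST finite_lessThan card_lessThan card_atLeastLessThan diff_add_inverse)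
  also have "\<dots> \<le> card (\<Union>b\<in>?T - {0}. \<Union>c\<in>?C. ?U b c)"
    by (rule card_mono[OF _ sub]) (intro finite_UN_I finite_UnI finite_imageI fin; simp)
  also have "\<dots> \<le> (\<Sum>b\<in>?T - {0}. card (\<Union>c\<in>?C. ?U b c))" by (rule card_UN_le) simp
  also have "\<dots> \<le> (\<Sum>b\<in>?T - {0}. \<Sum>c\<in>?C. card (?U b c))" by (intro sum_mono card_UN_le) simp
  also have "\<dots> \<le> (\<Sum>b\<in>?T - {0}. \<Sum>c\<in>?C. fibre_count (Suc n) w v + fibre_count n w v + v * fibre_count n w (v - 1))"
    using U by (intro sum_mono)
  also have "\<dots> = card (?T - {0}) * (Suc n * (fibre_count (Suc n) w v + fibre_count n w v + v * fibre_count n w (v - 1)))"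
    by (simp only: sum_constant card_lessThan of_nat_id)
  also have "card (?T - {0}) = w + 1" by simp
  finally show ?thesis .
qed

text \<open>Each term of the previous bound is brought back to \<open>n\<close> columns and
  \<open>v + 2\<close> rows outside \<open>T\<close>, which preserves the number of rows. Two free
  rows gain \<open>n^2\<close>, a new column with a fibre of two rows gains
  \<open>n * (v + 1)\<close>, and such a column together with a free row gains
  \<open>n^2 * v\<close>.\<close>

lemma fibre_count_even_step:
  assumes "n > 0"
  shows "real (fibre_count n (w + 2) v)
     \<le> (real w + 1) * (2 / real n + 1 / (real v + 1)) * real (fibre_count n w (v + 2))"
proof -
  obtain k where n: "n = Suc k" using assms gr0_implies_Suc by blast
  define X N V where "X = real (fibre_count n w (v + 2))" and "N = real n" and "V = real v"
  have N: "N > 0" using assms by (simp add: N_def)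
  have V: "V \<ge> 0" by (simp add: V_def)
  have "n * (n * fibre_count n w v) \<le> n * fibre_count n w (Suc v)"
    using fibre_count_extend by (intro mult_le_mono2)
  also have "\<dots> \<le> fibre_count n w (v + 2)" using fibre_count_extend[of n w "Suc v"] by simp
  finally have a: "N * (N * real (fibre_count n w v)) \<le> X"
    unfolding X_def N_def of_nat_mult[symmetric] of_nat_le_iff .
  have "Suc k * (Suc v * fibre_count k w v) \<le> fibre_count n w (v + 2)"
    using fibre_count_new_pair[of k v w] n by simp
  then have b: "N * ((V + 1) * real (fibre_count k w v)) \<le> X"
    unfolding X_def N_def V_def n of_nat_le_iff[symmetric, where 'a = real] of_nat_mult of_nat_Suc
    by (simp only: add.commute)
  have "n * (n * (v * fibre_count k w (v - 1))) \<le> fibre_count n w (v + 2)"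
  proof (cases v)
    case (Suc u)
    have "n * (n * (Suc u * fibre_count k w u)) \<le> n * fibre_count n w (Suc (Suc u))"
      using fibre_count_new_pair[of k u w] n by (intro mult_le_mono2) simp
    also have "\<dots> \<le> fibre_count n w (v + 2)" using fibre_count_extend[of n w "Suc (Suc u)"] Suc by simp
    finally show ?thesis using Suc by simp
  qed simp
  then have c: "N * (N * (V * real (fibre_count k w (v - 1)))) \<le> X"
    unfolding X_def N_def V_def of_nat_mult[symmetric] of_nat_le_iff .
  have "real (fibre_count n (w + 2) v)
      \<le> real ((w + 1) * (n * (fibre_count n w v + fibre_count k w v + v * fibre_count k w (v - 1))))"
    unfolding of_nat_le_iff n by (rule fibre_count_remove_pair)
  also have "\<dots> = (real w + 1) * (N * real (fibre_count n w v) + N * real (fibre_count k w v)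
      + N * (V * real (fibre_count k w (v - 1))))"
    by (simp add: N_def V_def algebra_simps)
  also have "\<dots> \<le> (real w + 1) * (X / N + X / (V + 1) + X / N)"
    using a b c N V by (intro mult_left_mono add_mono) (auto simp: pos_le_divide_eq mult_ac)
  also have "\<dots> = (real w + 1) * (2 / N + 1 / (V + 1)) * X"
    by (simp add: distrib_left distrib_right)
  finally show ?thesis by (simp add: X_def N_def V_def)
qed

section \<open>Generating function bounds\<close>

lemma fibre_weight_sum_le:
  fixes x y :: real
  assumes "0 \<le> x" "0 \<le> y"
  shows "(\<Sum>a\<le>w. \<Sum>b\<le>v. if even a \<and> 2 \<le> a + b then x^a / fact a * (y^b / fact b) else 0)
     \<le> (exp_tail (x + y) + exp_tail (y - x)) / 2"
proof -
  define c where "c a = (if even a then x^a / fact a else 0)" for a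
  define e where "e b = y^b / fact b" for b
  let ?\<phi> = "\<lambda>a b. if even a \<and> 2 \<le> a + b then x^a / fact a * (y^b / fact b) else 0"
  have nn: "0 \<le> ?\<phi> a b" for a b using assms by simp
  have cn: "0 \<le> c a" and en: "0 \<le> e b" for a b using assms by (simp_all add: c_def e_def)
  have cs: "c sums cosh x"
    using cosh_converges[of x] by (simp add: c_def[abs_def] divide_inverse mult.commute cong: if_cong)
  have es: "e sums exp y"
    using exp_converges[of y] by (simp add: e_def[abs_def] divide_inverse mult.commute)
  \<comment> \<open>For \<open>v = 0\<close> the monomial \<open>y\<close> would be missing from the
    range. One more index guarantees that the excluded part is exactly \<open>1 + y\<close>.\<close>
  have "(\<Sum>a\<le>w. \<Sum>b\<le>v. ?\<phi> a b) \<le> (\<Sum>a\<le>w. \<Sum>b\<le>v + 1. ?\<phi> a b)"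
    using nn by (intro sum_mono sum_mono2) auto
  also have "\<dots> = (\<Sum>a\<le>w. \<Sum>b\<le>v + 1. c a * e b - (if a = 0 then if b = 0 then 1 else if b = 1 then y else 0 else 0))"
    by (intro sum.cong refl) (auto simp: c_def e_def not_le less_2_cases_iff)
  also have "\<dots> = (\<Sum>a\<le>w. c a) * (\<Sum>b\<le>v + 1. e b)
      - (\<Sum>a\<le>w. if a = 0 then (\<Sum>b\<le>v + 1. if b = 0 then 1 else if b = 1 then y else 0) else 0)"
    unfolding sum_subtractf sum_product by (intro arg_cong2[where f = "(-)"] sum.cong refl) auto
  also have "(\<Sum>a\<le>w. if a = 0 then (\<Sum>b\<le>v + 1. if b = 0 then 1 else if b = 1 then y else 0) else 0)
      = (\<Sum>b\<le>v + 1. if b = 0 then 1 else if b = 1 then y else 0)"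
    by simp
  also have "\<dots> = (\<Sum>b\<in>{0, 1 :: nat}. if b = 0 then 1 else if b = 1 then y else 0)"
    by (rule sum.mono_neutral_right) auto
  also have "\<dots> = 1 + y" by simp
  also have "(\<Sum>a\<le>w. c a) * (\<Sum>b\<le>v + 1. e b) \<le> cosh x * exp y"
    using sum_le_suminf[OF sums_summable[OF cs], of "{..w}"] sum_le_suminf[OF sums_summable[OF es], of "{..v + 1}"]
      cn en sums_unique[OF cs] sums_unique[OF es]
    suminf_nonneg[OF sums_summable[OF cs]]
    by (intro mult_mono sum_nonneg) auto
  finally have "(\<Sum>a\<le>w. \<Sum>b\<le>v. ?\<phi> a b) \<le> cosh x * exp y - (1 + y)" by simp
  also have "\<dots> = (exp_tail (x + y) + exp_tail (y - x)) / 2"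
    by (simp add: exp_tail_def cosh_def exp_add exp_diff exp_minus field_simps)
  finally show ?thesis .
qed

text \<open>\<open>fibre_count n w v / (fact w * fact v)\<close> is the coefficient of
  \<open>x^w * y^v\<close> in the \<open>n\<close>-th power of the weight series, and a series with
  nonnegative coefficients dominates each of its terms. Induction on \<open>n\<close> gives this
  with finite sums only.\<close>

lemma fibre_count_upper:
  fixes x y :: real
  assumes "0 \<le> x" "0 \<le> y"
  shows "real (fibre_count n w v) * x^w * y^v
     \<le> fact w * fact v * ((exp_tail (x + y) + exp_tail (y - x)) / 2)^n"
proof (induction n arbitrary: w v)
  case 0
  then show ?case by simp
next
  case (Suc n)
  define F where "F = (exp_tail (x + y) + exp_tail (y - x)) / 2"
  have F: "F \<ge> 0" using exp_tail_nonneg[of "x + y"] exp_tail_nonneg[of "y - x"] by (simp add: F_def)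
  let ?\<phi> = "\<lambda>a b. if even a \<and> 2 \<le> a + b then x^a / fact a * (y^b / fact b) else 0"
  have term_le: "(if even a \<and> 2 \<le> a + b then real ((w choose a) * (v choose b) * fibre_count n (w - a) (v - b)) * x^w * y^v else 0)
     \<le> fact w * fact v * F^n * ?\<phi> a b" if a: "a \<le> w" and b: "b \<le> v" for a b
  proof (cases "even a \<and> 2 \<le> a + b")
    case True
    have "real ((w choose a) * (v choose b) * fibre_count n (w - a) (v - b)) * x^w * y^v
        = real (w choose a) * real (v choose b) * (x^a * y^b) * (real (fibre_count n (w - a) (v - b)) * x^(w - a) * y^(v - b))"
      using power_add[of x a "w - a"] power_add[of y b "v - b"] a b by (simp add: mult_ac)
    also have "\<dots> \<le> real (w choose a) * real (v choose b) * (x^a * y^b) * (fact (w - a) * fact (v - b) * F^n)"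
      using Suc.IH[of "w - a" "v - b"] assms unfolding F_def by (intro mult_left_mono) auto
    also have "\<dots> = (real (w choose a) * fact (w - a)) * (real (v choose b) * fact (v - b)) * (x^a * y^b) * F^n"
      by (simp only: mult_ac)
    also have "real (w choose a) * fact (w - a) = fact w / fact a"
      by (simp add: binomial_fact[OF a])
    also have "real (v choose b) * fact (v - b) = fact v / fact b"
      by (simp add: binomial_fact[OF b])
    also have "fact w / fact a * (fact v / fact b) * (x^a * y^b) * F^n = fact w * fact v * F^n * ?\<phi> a b"
      using True by simp
    finally show ?thesis using True by simp
  next
    case False
    then show ?thesis by auto
  qed
  have "real (fibre_count (Suc n) w v) * x^w * y^v
      = (\<Sum>a\<le>w. \<Sum>b\<le>v. if even a \<and> 2 \<le> a + b then real ((w choose a) * (v choose b) * fibre_count n (w - a) (v - b)) * x^w * y^v else 0)"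
    by (simp add: sum_distrib_right if_distrib[of real] if_distrib[of "\<lambda>t. t * _"] cong: if_cong)
  also have "\<dots> \<le> (\<Sum>a\<le>w. \<Sum>b\<le>v. fact w * fact v * F^n * ?\<phi> a b)"
    using term_le by (intro sum_mono) auto
  also have "\<dots> = fact w * fact v * F^n * (\<Sum>a\<le>w. \<Sum>b\<le>v. ?\<phi> a b)"
    by (simp only: sum_distrib_left)
  also have "\<dots> \<le> fact w * fact v * F^n * F"
    using fibre_weight_sum_le[OF assms, where w = w and v = v] F by (intro mult_left_mono) (auto simp: F_def)
  finally show ?case by (simp add: F_def mult_ac)
qed

section \<open>Lower bound from log-concave coefficients\<close>

text \<open>
  Total positivity of order two of the Toeplitz matrix of \<open>a\<close>: log-concavity without internal zeros.
\<close>

definition totally_positive2 :: "(nat \<Rightarrow> real) \<Rightarrow> bool" where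
  "totally_positive2 a \<longleftrightarrow> (\<forall>i j d. i \<le> j \<longrightarrow> a i * a (j + d) \<le> a (i + d) * a j)"

text \<open>
  By the Cauchy--Binet formula, twice the minor of the convolution is the sum of \<open>x k l * y k l\<close> for
  the minors \<open>x\<close> and \<open>y\<close> of the factors, which are antisymmetric in \<open>k\<close> and \<open>l\<close>.
\<close>

lemma totally_positive2_convolution:
  assumes a: "totally_positive2 a" "\<And>k. 0 \<le> a k" and b: "totally_positive2 b" "\<And>k. 0 \<le> b k"
  shows "totally_positive2 (\<lambda>n. \<Sum>k\<le>n. a k * b (n - k))"
  unfolding totally_positive2_def
proof (intro allI impI)
  fix i j d :: nat assume ij: "i \<le> j"
  define c where "c n = (\<Sum>k\<le>n. a k * b (n - k))" for n
  define B where "B k s = (if k \<le> s then b (s - k) else 0)" for k s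
  \<comment> \<open>\<open>R\<close> is \<open>a\<close> shifted by \<open>d\<close>. It writes
    \<open>c i\<close> and \<open>c j\<close> with the same columns \<open>i + d\<close> and
    \<open>j + d\<close> of \<open>B\<close> that \<open>c (i + d)\<close> and
    \<open>c (j + d)\<close> use, so the minor becomes a product of two matrices.\<close>
  define R where "R k = (if d \<le> k then a (k - d) else 0)" for k
  let ?I = "{..j + d}"
  have c0: "c s = (\<Sum>k\<in>?I. a k * B k s)" if "s \<le> j + d" for s
    unfolding c_def using that by (intro sum.mono_neutral_cong_left) (auto simp: B_def)
  have c1: "c s = (\<Sum>k\<in>?I. R k * B k (s + d))" if "s \<le> j" for s
  proof -
    have "(\<Sum>k\<in>?I. R k * B k (s + d)) = (\<Sum>k\<in>{d..s + d}. a (k - d) * b (s + d - k))"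
      using that by (intro sum.mono_neutral_cong_right) (auto simp: B_def R_def)
    also have "\<dots> = c s" unfolding c_def
      by (rule sum.reindex_bij_witness[where i = "\<lambda>k. k + d" and j = "\<lambda>k. k - d"]) auto
    finally show ?thesis by simp
  qed
  define x where "x k l = a k * R l - a l * R k" for k l
  define y where "y k l = B k (i + d) * B l (j + d) - B k (j + d) * B l (i + d)" for k l
  have x: "0 \<le> x k l" if "k \<le> l" for k l
  proof (cases "d \<le> k")
    case True
    then have "a (k - d) * a (l - d + d) \<le> a (k - d + d) * a (l - d)"
      using a(1) that diff_le_mono unfolding totally_positive2_def by blast
    then show ?thesis using True that by (simp add: x_def R_def mult_ac)
  next
    case False
    then show ?thesis using a(2) by (simp add: x_def R_def)
  qed
  have y: "0 \<le> y k l" if "k \<le> l" for k l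
  proof (cases "l \<le> i + d")
    case True
    have e: "i + d - k = (i + d - l) + (l - k)" "j + d - k = (j + d - l) + (l - k)"
      using that True ij by auto
    have "i + d - l \<le> j + d - l" using ij by simp
    then have "b (i + d - l) * b (j + d - k) \<le> b (i + d - k) * b (j + d - l)"
      unfolding e using b(1) unfolding totally_positive2_def by blast
    moreover have "y k l = b (i + d - k) * b (j + d - l) - b (j + d - k) * b (i + d - l)"
      using True that ij by (simp add: y_def B_def)
    ultimately show ?thesis by (simp only: mult.commute diff_ge_0_iff_ge)
  next
    case False
    then show ?thesis using b(2) by (simp add: y_def B_def)
  qed
  have xy: "0 \<le> x k l * y k l" for k l
  proof (cases "k \<le> l")
    case False
    then have "0 \<le> x l k * y l k" using x y by simp
    moreover have "x l k * y l k = x k l * y k l" unfolding x_def y_def by (simp add: algebra_simps)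
    ultimately show ?thesis by simp
  qed (use x y in simp)
  have "0 \<le> (\<Sum>k\<in>?I. \<Sum>l\<in>?I. x k l * y k l)" using xy by (intro sum_nonneg) auto
  also have "\<dots> = (\<Sum>k\<in>?I. \<Sum>l\<in>?I. (a k * B k (i + d)) * (R l * B l (j + d)))
      - (\<Sum>k\<in>?I. \<Sum>l\<in>?I. (a k * B k (j + d)) * (R l * B l (i + d)))
      - (\<Sum>k\<in>?I. \<Sum>l\<in>?I. (R k * B k (i + d)) * (a l * B l (j + d)))
      + (\<Sum>k\<in>?I. \<Sum>l\<in>?I. (R k * B k (j + d)) * (a l * B l (i + d)))"
    unfolding sum_subtractf[symmetric] sum.distrib[symmetric] x_def y_def
    by (intro sum.cong refl) (simp add: algebra_simps)
  also have "\<dots> = 2 * (c (i + d) * c j - c (j + d) * c i)"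
    unfolding sum_product[symmetric] using c0[of "i + d"] c0[of "j + d"] c1[of i] c1[of j] ij by simp
  finally have "0 \<le> 2 * (c (i + d) * c j - c (j + d) * c i)" .
  then show "c i * c (j + d) \<le> c (i + d) * c j" by (simp add: mult.commute)
qed

definition tail_coeff :: "nat \<Rightarrow> real" where
  "tail_coeff k = (if 2 \<le> k then 1 / fact k else 0)"

lemma tail_coeff_nonneg: "0 \<le> tail_coeff k"
  by (simp add: tail_coeff_def)

text \<open>Cutting off the indices 0 and 1 keeps the support an up-closed interval, so only the
  log-concavity of \<open>1 / fact k\<close> is at stake.\<close>

lemma totally_positive2_tail_coeff: "totally_positive2 tail_coeff"
  unfolding totally_positive2_def
proof (intro allI impI)
  fix i j d :: nat assume ij: "i \<le> j"
  have "(fact (i + d) :: real) * fact j \<le> fact i * fact (j + d)"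
  proof (induction d)
    case (Suc d)
    have "(real (i + d) + 1) * (fact (i + d) * fact j) \<le> (real (j + d) + 1) * (fact i * fact (j + d))"
      using Suc.IH ij by (intro mult_mono[where a = "real (i + d) + 1"]) auto
    then show ?case by (simp add: algebra_simps)
  qed simp
  then show "tail_coeff i * tail_coeff (j + d) \<le> tail_coeff (i + d) * tail_coeff j"
    using ij by (auto simp: tail_coeff_def field_simps)
qed

text \<open>The coefficient of \<open>z^k\<close> in \<open>exp_tail z ^ n\<close>, as
  \<open>surj_coeff_sums\<close> confirms.\<close>

definition surj_coeff :: "nat \<Rightarrow> nat \<Rightarrow> real" where
  "surj_coeff n k = real (fibre_count n 0 k) / fact k"

lemma surj_coeff_nonneg: "0 \<le> surj_coeff n k"
  by (simp add: surj_coeff_def)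

lemma fibre_count_Suc_0:
  "fibre_count (Suc n) 0 m = (\<Sum>b\<le>m. if 2 \<le> b then (m choose b) * fibre_count n 0 (m - b) else 0)"
  unfolding fibre_count.simps unfolding atMost_0 by (simp cong: if_cong)

lemma surj_coeff_Suc: "surj_coeff (Suc n) k = (\<Sum>b\<le>k. tail_coeff b * surj_coeff n (k - b))"
proof -
  have "surj_coeff (Suc n) k = (\<Sum>b\<le>k. (if 2 \<le> b then real ((k choose b) * fibre_count n 0 (k - b)) else 0) / fact k)"
    unfolding surj_coeff_def fibre_count_Suc_0 of_nat_sum sum_divide_distrib
    by (intro sum.cong refl) simp
  also have "\<dots> = (\<Sum>b\<le>k. tail_coeff b * surj_coeff n (k - b))"
    by (intro sum.cong refl) (auto simp: tail_coeff_def surj_coeff_def binomial_fact field_simps)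
  finally show ?thesis .
qed

lemma totally_positive2_surj_coeff: "totally_positive2 (surj_coeff n)"
proof (induction n)
  case 0
  show ?case by (auto simp: totally_positive2_def surj_coeff_def)
next
  case (Suc n)
  have "totally_positive2 (\<lambda>k. \<Sum>b\<le>k. tail_coeff b * surj_coeff n (k - b))"
    by (intro totally_positive2_convolution totally_positive2_tail_coeff tail_coeff_nonneg Suc surj_coeff_nonneg)
  then show ?case by (simp add: surj_coeff_Suc[abs_def])
qed

lemma surj_coeff_sums:
  fixes s :: real
  assumes "0 \<le> s"
  shows "(\<lambda>k. surj_coeff n k * s^k) sums exp_tail s ^ n"
proof (induction n)
  case 0
  have "(\<lambda>k. surj_coeff 0 k * s^k) = (\<lambda>k. if k = 0 then 1 else 0)"
    by (auto simp: surj_coeff_def fun_eq_iff)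
  then show ?case using sums_single[of 0 "\<lambda>_. 1 :: real"] by simp
next
  case (Suc n)
  have e: "(\<lambda>k. s^k / fact k) sums exp s"
    using exp_converges[of s] by (simp add: divide_inverse mult.commute)
  have t: "(\<lambda>k. tail_coeff k * s^k) sums exp_tail s"
  proof -
    have "(\<lambda>k. (if k \<in> {0, 1} then s^k / fact k else 0)) sums (\<Sum>k\<in>{0, 1}. s^k / fact k)"
      by (rule sums_If_finite_set) simp
    from sums_diff[OF e this]
    have "(\<lambda>k. s^k / fact k - (if k \<in> {0, 1} then s^k / fact k else 0)) sums exp_tail s"
      by (simp add: exp_tail_def algebra_simps)
    moreover have "(\<lambda>k. s^k / fact k - (if k \<in> {0, 1} then s^k / fact k else 0)) = (\<lambda>k. tail_coeff k * s^k)"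
      by (auto simp: fun_eq_iff tail_coeff_def not_le less_2_cases_iff)
    ultimately show ?thesis by (simp only:)
  qed
  have n1: "summable (\<lambda>k. norm (tail_coeff k * s^k))" "summable (\<lambda>k. norm (surj_coeff n k * s^k))"
    using t Suc.IH assms by (simp_all add: sums_iff tail_coeff_nonneg surj_coeff_nonneg)
  have "(\<lambda>k. \<Sum>i\<le>k. (tail_coeff i * s^i) * (surj_coeff n (k - i) * s^(k - i)))
      sums ((\<Sum>k. tail_coeff k * s^k) * (\<Sum>k. surj_coeff n k * s^k))"
    by (rule Cauchy_product_sums[OF n1])
  moreover have "(\<Sum>i\<le>k. (tail_coeff i * s^i) * (surj_coeff n (k - i) * s^(k - i))) = surj_coeff (Suc n) k * s^k" for k
    unfolding surj_coeff_Suc sum_distrib_right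
  proof (intro sum.cong refl)
    fix i assume "i \<in> {..k}"
    then have e: "s^i * s^(k - i) = s^k" by (simp flip: power_add)
    have "(tail_coeff i * s^i) * (surj_coeff n (k - i) * s^(k - i))
        = tail_coeff i * surj_coeff n (k - i) * (s^i * s^(k - i))" by (simp only: mult_ac)
    then show "(tail_coeff i * s^i) * (surj_coeff n (k - i) * s^(k - i)) = tail_coeff i * surj_coeff n (k - i) * s^k"
      by (simp only: e)
  qed
  ultimately show ?case
    using sums_unique[OF t] sums_unique[OF Suc.IH] by simp
qed

text \<open>Every fibre but the last takes two elements, and the last takes all that remain.\<close>

lemma fibre_count_pos:
  assumes "n > 0" "2 * n \<le> m"
  shows "fibre_count n 0 m > 0"
  using assms
proof (induction n arbitrary: m)
  case (Suc n)
  show ?case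
  proof (cases "n = 0")
    case True
    have "0 < (if 2 \<le> m then (m choose m) * fibre_count n 0 (m - m) else 0)" using Suc True by simp
    also have "\<dots> \<le> (\<Sum>b\<le>m. if 2 \<le> b then (m choose b) * fibre_count n 0 (m - b) else 0)"
      by (rule member_le_sum[of m "{..m}" "\<lambda>b. if 2 \<le> b then (m choose b) * fibre_count n 0 (m - b) else 0"]) auto
    finally show ?thesis by (simp only: fibre_count_Suc_0)
  next
    case False
    have "0 < (m choose 2) * fibre_count n 0 (m - 2)" using Suc False by (simp add: zero_less_binomial_iff)
    also have "\<dots> = (if 2 \<le> (2::nat) then (m choose 2) * fibre_count n 0 (m - 2) else 0)" by simp
    also have "\<dots> \<le> (\<Sum>b\<le>m. if 2 \<le> b then (m choose b) * fibre_count n 0 (m - b) else 0)"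
      using Suc.prems by (intro member_le_sum[of 2 "{..m}" "\<lambda>b. if 2 \<le> b then (m choose b) * fibre_count n 0 (m - b) else 0"]) auto
    finally show ?thesis by (simp only: fibre_count_Suc_0)
  qed
qed simp

text \<open>
  Log-concavity makes the \<open>m\<close>-th term of \<open>\<Sum>k. surj_coeff n k * t^k\<close> maximal for a suitable \<open>t\<close>;
  decreasing \<open>t\<close> slightly turns the other terms into a geometric series.
\<close>

lemma surj_coeff_lower:
  assumes n: "n > 0" and m: "2 * n < m"
  shows "\<exists>s>0. exp_tail s ^ n \<le> 4 * real m * surj_coeff n m * s^m"
proof -
  let ?A = "surj_coeff n"
  have pos: "?A k > 0" if "2 * n \<le> k" for k
    using fibre_count_pos[OF n that] by (simp add: surj_coeff_def)
  have Am: "?A m > 0" "?A (m - 1) > 0" using pos m by auto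
  \<comment> \<open>At this \<open>t\<close> the terms with indices \<open>m - 1\<close> and
    \<open>m\<close> are equal, so log-concavity puts the maximum there. The strict
    \<open>2 * n < m\<close> makes the coefficient at \<open>m - 1\<close> positive.\<close>
  define t where "t = ?A (m - 1) / ?A m"
  have t: "t > 0" using Am by (simp add: t_def)
  have up: "?A (k + 1) * t \<le> ?A k" if "m \<le> k" for k
  proof -
    have "?A (m - 1) * ?A (k + 1) \<le> ?A (m - 1 + 1) * ?A k"
      using totally_positive2_surj_coeff[of n] that m unfolding totally_positive2_def by (metis diff_le_self order.trans)
    then show ?thesis using Am m by (simp add: t_def field_simps)
  qed
  have down: "?A k \<le> ?A (k + 1) * t" if "k < m" for k
  proof -
    have "?A k * ?A (m - 1 + 1) \<le> ?A (k + 1) * ?A (m - 1)"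
      using totally_positive2_surj_coeff[of n] that unfolding totally_positive2_def by (metis Suc_diff_1 Suc_leI diff_le_mono diff_Suc_1 bot_nat_0.not_eq_extremum less_zeroE)
    then show ?thesis using Am m by (simp add: t_def field_simps)
  qed
  have up': "?A (m + i) * t^(m + i) \<le> ?A m * t^m" for i
  proof (induction i)
    case (Suc i)
    have "?A (m + i + 1) * t * t^(m + i) \<le> ?A (m + i) * t^(m + i)"
      using up[of "m + i"] t by (intro mult_right_mono) auto
    then show ?case using Suc.IH by (simp add: mult_ac)
  qed simp
  have down': "i \<le> m \<Longrightarrow> ?A (m - i) * t^(m - i) \<le> ?A m * t^m" for i
  proof (induction i)
    case (Suc i)
    have e: "m - i = Suc (m - Suc i)" using Suc.prems by simp
    have "?A (m - Suc i) * t^(m - Suc i) \<le> ?A (m - Suc i + 1) * t * t^(m - Suc i)"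
      using down[of "m - Suc i"] t Suc.prems by (intro mult_right_mono) auto
    also have "\<dots> = ?A (m - i) * t^(m - i)" unfolding e by simp
    finally show ?case using Suc.IH Suc.prems by simp
  qed simp
  have max: "?A k * t^k \<le> ?A m * t^m" for k
    using up'[of "k - m"] down'[of "m - k"] by (cases "m \<le> k") auto
  \<comment> \<open>Chosen such that \<open>q^m \<ge> 1 / 2\<close> by Bernoulli while the geometric
    series sums to \<open>2 * m\<close>; together they give the factor \<open>4 * m\<close>.\<close>
  define q where "q = 1 - 1 / (2 * real m)"
  have m0: "real m \<ge> 1" using m by simp
  have q: "0 < q" "q < 1" "1 - q = 1 / (2 * real m)" using m0 by (auto simp: q_def field_simps)
  have qm: "1 / 2 \<le> q^m"
  proof -
    have "1 + real m * (- (1 / (2 * real m))) \<le> (1 + (- (1 / (2 * real m))))^m"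
      using m0 by (intro Bernoulli_inequality) (auto simp: field_simps)
    then show ?thesis using m0 by (simp add: q_def)
  qed
  define s where "s = t * q"
  have s: "s > 0" using t q by (simp add: s_def)
  have "(\<lambda>k. ?A m * t^m * q^k) sums (?A m * t^m * (1 / (1 - q)))"
    using q by (intro sums_mult geometric_sums) auto
  moreover have "?A k * s^k \<le> ?A m * t^m * q^k" for k
    using mult_right_mono[OF max[of k], of "q^k"] q by (simp add: s_def power_mult_distrib mult_ac)
  ultimately have "exp_tail s ^ n \<le> ?A m * t^m * (2 * real m)"
    using sums_le[OF _ surj_coeff_sums[of s n]] s q by fastforce
  also have "\<dots> \<le> ?A m * (2 * s^m) * (2 * real m)"
  proof -
    have "t^m * (1 / 2) \<le> t^m * q^m" using qm t by (intro mult_left_mono) auto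
    then have "t^m \<le> 2 * s^m" by (simp add: s_def power_mult_distrib)
    then show ?thesis using Am by (intro mult_right_mono mult_left_mono) auto
  qed
  finally show ?thesis using s by (intro exI[of _ s]) (simp add: mult_ac)
qed

section \<open>The saddle point\<close>

text \<open>The numerator of the derivative is \<open>G * (G + 2*z - z^2) - z^3\<close>. It suffices
  to insert the cubic lower bound \<open>G0\<close> for \<open>G\<close>, where the value is
  \<open>z^4 / 12 + z^6 / 36\<close>; this also forces the bracket to be positive, which justifies
  the monotonicity in \<open>G\<close>.\<close>

lemma tail_mean_mono:
  assumes "0 < x" "x \<le> y"
  shows "tail_mean x \<le> tail_mean y"
proof (rule DERIV_nonneg_imp_nondecreasing[OF assms(2)])
  fix z assume z: "x \<le> z" "z \<le> y"
  then have z0: "z > 0" using assms by simp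
  define G where "G = exp_tail z"
  have G: "G > 0" using exp_tail_pos[OF z0] by (simp add: G_def)
  have eG: "exp z = G + z + 1" by (simp add: G_def exp_tail_def)
  have der: "(tail_mean has_real_derivative
      ((exp z - 1 + z * exp z) * G - z * (exp z - 1) * (exp z - 1)) / (G * G)) (at z)"
    unfolding tail_mean_def[abs_def] G_def using exp_tail_pos[OF z0]
    by (auto intro!: derivative_eq_intros simp: algebra_simps)
  define G0 where "G0 = z^2 / 2 + z^3 / 6"
  have G0: "G0 \<le> G" "G0 > 0" using exp_tail_lower[of z] z0 by (auto simp: G_def G0_def add_pos_pos)
  have "0 \<le> z^4 / 12 + z^6 / 36" by simp
  also have "\<dots> = G0 * G0 + (2 * z - z^2) * G0 - z^3"
    unfolding G0_def by (simp add: field_simps power2_eq_square power3_eq_cube eval_nat_numeral)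
  finally have f0: "z^3 \<le> G0 * (G0 + (2 * z - z^2))" by (simp add: algebra_simps)
  then have pos: "0 < G0 + (2 * z - z^2)"
    using G0(2) z0 by (metis less_le_trans zero_less_mult_pos zero_less_power)
  have "G0 * (G0 + (2 * z - z^2)) \<le> G * (G + (2 * z - z^2))"
    using G0 pos by (intro mult_mono) auto
  then have "0 \<le> G * (G + (2 * z - z^2)) - z^3" using f0 by simp
  also have "\<dots> = (exp z - 1 + z * exp z) * G - z * (exp z - 1) * (exp z - 1)"
    unfolding eG by (simp add: algebra_simps power2_eq_square power3_eq_cube)
  finally show "\<exists>d. (tail_mean has_real_derivative d) (at z) \<and> 0 \<le> d"
    using der G by (intro exI conjI) auto
qed

text \<open>The linear bounds on \<open>tail_mean\<close> enclose the root between
  \<open>\<mu> - 2\<close> and \<open>3 * (\<mu> - 2)\<close>. The lower end keeps \<open>z\<close>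
  away from 0 uniformly when \<open>m / n\<close> stays away from 2.\<close>

lemma saddle_exists:
  assumes "2 < \<mu>"
  shows "\<exists>z\<ge>\<mu> - 2. tail_mean z = \<mu>"
proof -
  have "continuous_on {\<mu> - 2..3 * (\<mu> - 2)} tail_mean"
    unfolding tail_mean_def using assms exp_tail_pos
    by (intro continuous_intros) (auto simp: less_imp_neq[THEN not_sym])
  moreover have "tail_mean (\<mu> - 2) \<le> \<mu>"
    using tail_mean_upper[of "\<mu> - 2"] assms by simp
  moreover have "\<mu> \<le> tail_mean (3 * (\<mu> - 2))"
  proof -
    have "\<mu> = 2 + 3 * (\<mu> - 2) / 3" by (simp add: field_simps)
    also have "\<dots> \<le> tail_mean (3 * (\<mu> - 2))" using assms by (intro tail_mean_lower) simp
    finally show ?thesis .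
  qed
  ultimately show ?thesis
    using IVT'[of tail_mean "\<mu> - 2" \<mu> "3 * (\<mu> - 2)"] assms by auto
qed

text \<open>\<open>z\<close> minimises \<open>exp_tail s / s powr L\<close>, whose logarithm has
  derivative \<open>(tail_mean s - L) / s\<close>. Hence the unspecified \<open>s\<close> of
  \<open>surj_coeff_lower\<close> can be traded for the saddle point.\<close>

lemma saddle_min:
  assumes "0 < z" "0 < s"
  shows "exp_tail z * s powr tail_mean z \<le> exp_tail s * z powr tail_mean z"
proof -
  define L where "L = tail_mean z"
  let ?h = "\<lambda>x. ln (exp_tail x) - L * ln x"
  have der: "(?h has_real_derivative (tail_mean x - L) / x) (at x)" if "x > 0" for x
    using that exp_tail_pos[OF that]
    by (auto intro!: derivative_eq_intros simp: tail_mean_def field_simps)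
  have "?h z \<le> ?h s"
  proof (cases "z \<le> s")
    case True
    show ?thesis
    proof (rule DERIV_nonneg_imp_nondecreasing[OF True])
      fix x assume "z \<le> x" "x \<le> s"
      then show "\<exists>y. (?h has_real_derivative y) (at x) \<and> 0 \<le> y"
        using der[of x] tail_mean_mono[of z x] assms by (intro exI conjI) (auto simp: L_def)
    qed
  next
    case False
    then have "s \<le> z" by simp
    then show ?thesis
    proof (rule DERIV_nonpos_imp_nonincreasing)
      fix x assume "s \<le> x" "x \<le> z"
      then show "\<exists>y. (?h has_real_derivative y) (at x) \<and> y \<le> 0"
        using der[of x] tail_mean_mono[of x z] assms
        by (intro exI conjI) (auto simp: L_def divide_nonpos_pos)
    qed
  qed
  then have "ln (exp_tail z * s powr L) \<le> ln (exp_tail s * z powr L)"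
    using assms exp_tail_pos[OF assms(1)] exp_tail_pos[OF assms(2)] by (simp add: ln_mult ln_powr)
  then show ?thesis
    using assms exp_tail_pos[OF assms(1)] exp_tail_pos[OF assms(2)] by (simp add: L_def)
qed

lemma saddle_min_power:
  assumes "0 < z" "0 < s" "real m = tail_mean z * real n"
  shows "exp_tail z ^ n * s^m \<le> exp_tail s ^ n * z^m"
proof -
  have p: "(x powr tail_mean z)^n = x^m" if "x > 0" for x :: real
    using that assms(3) by (simp add: powr_realpow[symmetric] powr_powr)
  have "(exp_tail z * s powr tail_mean z)^n \<le> (exp_tail s * z powr tail_mean z)^n"
    using saddle_min[OF assms(1,2)] assms exp_tail_nonneg by (intro power_mono) auto
  then show ?thesis using p assms by (simp add: power_mult_distrib)
qed

section \<open>The probability that one block is even on a fixed set of rows\<close>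

definition fibre_prob :: "nat \<Rightarrow> nat \<Rightarrow> nat \<Rightarrow> real" where
  "fibre_prob m n w = real (fibre_count n w (m - w)) / real (fibre_count n 0 m)"

lemma fibre_prob_nonneg: "0 \<le> fibre_prob m n w"
  by (simp add: fibre_prob_def)

text \<open>The upper bound is taken at \<open>x = \<theta> * z\<close> and
  \<open>y = (1 - \<theta>) * z\<close>. As \<open>x + y = z\<close>, the powers of \<open>z\<close>
  and of \<open>exp_tail z\<close> cancel against the lower bound for all maps, and \<theta> remains
  free.\<close>

lemma fibre_prob_upper:
  fixes \<theta> z :: real
  assumes n: "n > 0" and m: "2 * n < m" and w: "w \<le> m" and z: "0 < z"
    and mean: "real m = tail_mean z * real n" and \<theta>: "0 \<le> \<theta>" "\<theta> \<le> 1"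
  shows "fibre_prob m n w * real (m choose w) * \<theta>^w * (1 - \<theta>)^(m - w)
    \<le> 4 * real m * ((1 + exp_tail ((1 - 2 * \<theta>) * z) / exp_tail z) / 2)^n"
proof -
  define g H N F v where "g = exp_tail z" and "H = (1 + exp_tail ((1 - 2 * \<theta>) * z) / exp_tail z) / 2"
    and "N = real (fibre_count n 0 m)" and "F = real (fibre_count n w (m - w))" and "v = m - w"
  have g: "g > 0" using exp_tail_pos[OF z] by (simp add: g_def)
  have H: "H \<ge> 0" using g exp_tail_nonneg by (simp add: H_def g_def)
  have N: "N > 0" using fibre_count_pos[OF n] m by (simp add: N_def)
  have up: "F * (\<theta> * z)^w * ((1 - \<theta>) * z)^v \<le> fact w * fact v * (g * H)^n"
  proof -
    have "\<theta> * z + (1 - \<theta>) * z = z" "(1 - \<theta>) * z - \<theta> * z = (1 - 2 * \<theta>) * z"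
      by (simp_all add: algebra_simps)
    moreover have "g * H = (exp_tail z + exp_tail ((1 - 2 * \<theta>) * z)) / 2"
      using g by (simp add: H_def g_def field_simps)
    ultimately have gH: "g * H = (exp_tail (\<theta> * z + (1 - \<theta>) * z) + exp_tail ((1 - \<theta>) * z - \<theta> * z)) / 2"
      by (simp only:)
    show ?thesis unfolding gH F_def v_def using \<theta> z by (intro fibre_count_upper) auto
  qed
  obtain s where s: "s > 0" "exp_tail s ^ n \<le> 4 * real m * surj_coeff n m * s^m"
    using surj_coeff_lower[OF n m] by blast
  have "g^n * s^m \<le> exp_tail s ^ n * z^m"
    using saddle_min_power[OF z s(1) mean] by (simp add: g_def)
  also have "\<dots> \<le> 4 * real m * surj_coeff n m * s^m * z^m"
    using s(2) z by (intro mult_right_mono) auto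
  finally have "g^n * s^m \<le> (4 * real m * surj_coeff n m * z^m) * s^m" by (simp add: mult_ac)
  then have "g^n \<le> 4 * real m * surj_coeff n m * z^m" using s(1) by simp
  then have low: "fact m * g^n \<le> 4 * real m * N * z^m"
    by (simp add: surj_coeff_def N_def field_simps)
  have zz: "z^w * z^v = z^m" using w by (simp add: v_def flip: power_add)
  have "(F * \<theta>^w * (1 - \<theta>)^v * fact m) * (z^m * g^n) = (F * (\<theta> * z)^w * ((1 - \<theta>) * z)^v) * (fact m * g^n)"
    by (simp add: power_mult_distrib zz[symmetric] mult_ac)
  also have "\<dots> \<le> (fact w * fact v * (g * H)^n) * (4 * real m * N * z^m)"
    by (rule mult_mono[OF up low]) (use z g H in auto)
  also have "\<dots> = (fact w * fact v * H^n * (4 * real m * N)) * (z^m * g^n)"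
    by (simp add: power_mult_distrib mult_ac)
  finally have "F * \<theta>^w * (1 - \<theta>)^v * fact m \<le> fact w * fact v * H^n * (4 * real m * N)"
    using z g by simp
  then have "F / N * (fact m / (fact w * fact v)) * \<theta>^w * (1 - \<theta>)^v \<le> 4 * real m * H^n"
    using N by (simp add: field_simps)
  moreover have "real (m choose w) = fact m / (fact w * fact v)"
    using binomial_fact[OF w] by (simp add: v_def)
  ultimately show ?thesis
    by (simp add: fibre_prob_def F_def N_def H_def v_def)
qed

text \<open>The binomial distribution with parameters \<open>m\<close> and \<open>w / m\<close> has
  its mode at \<open>w\<close>, and the largest of \<open>m + 1\<close> probabilities is at least
  their average. \<open>t k\<close> is the probability of \<open>k\<close> times \<open>m^m\<close>,
  so the comparison takes place in the naturals.\<close>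

lemma binomial_mode:
  assumes w: "w \<le> m" and m: "m > 0"
  shows "1 \<le> (real m + 1) * (real (m choose w) * (real w / real m)^w * (real (m - w) / real m)^(m - w))"
proof -
  define t where "t k = (m choose k) * w^k * (m - w)^(m - k)" for k
  have step: "Suc k * (m - w) * t (Suc k) = (m - k) * w * t k" if "k < m" for k
  proof -
    have "m - k = Suc (m - Suc k)" using that by simp
    then have "(m - w)^(m - k) = (m - w) * (m - w)^(m - Suc k)" by simp
    moreover have "Suc k * (m choose Suc k) = (m - k) * (m choose k)"
      by (simp only: binomial_absorption binomial_absorb_comp)
    moreover have "Suc k * (m - w) * t (Suc k)
        = (Suc k * (m choose Suc k)) * (w * w^k) * ((m - w) * (m - w)^(m - Suc k))"
      by (simp only: t_def power_Suc mult_ac)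
    ultimately show ?thesis by (simp only: t_def mult_ac)
  qed
  have max: "t k \<le> t w" if "k \<le> m" for k
  \<comment> \<open>In the degenerate cases only \<open>t w\<close> is nonzero, by
    \<open>0^0 = 1\<close>; the ratio argument would cancel a factor 0.\<close>
  proof (cases "w = m \<or> w = 0")
    case True
    then show ?thesis using that by (cases "k = w") (auto simp: t_def power_0_left)
  next
    case False
    then have w0: "0 < w" "w < m" using w by auto
    have up: "t k \<le> t (Suc k)" if "k < w" for k
    proof -
      have "Suc k * (m - w) \<le> (m - k) * w"
        using that w mult_le_mono[of "Suc k" w "m - w" "m - k"] by (simp add: mult.commute)
      then have "Suc k * (m - w) * t k \<le> Suc k * (m - w) * t (Suc k)"
        using step[of k] that w by (simp add: mult_le_mono1)
      then show ?thesis using w0 by simp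
    qed
    have down: "t (Suc k) \<le> t k" if "w \<le> k" "k < m" for k
    proof -
      have "(m - k) * w \<le> Suc k * (m - w)"
        using that mult_le_mono[of "m - k" "m - w" w "Suc k"] by (simp add: mult.commute)
      then have "(m - k) * w * t (Suc k) \<le> (m - k) * w * t k"
        using step[of k] that by (metis mult_le_mono1)
      then show ?thesis using w0 that by simp
    qed
    have "i \<le> w \<Longrightarrow> t (w - i) \<le> t w" for i
    proof (induction i)
      case (Suc i)
      then have "t (w - Suc i) \<le> t (Suc (w - Suc i))" by (intro up) simp
      also have "Suc (w - Suc i) = w - i" using Suc.prems by simp
      finally show ?case using Suc by simp
    qed simp
    moreover have "w + i \<le> m \<Longrightarrow> t (w + i) \<le> t w" for i
    proof (induction i)
      case (Suc i)
      then show ?case using down[of "w + i"] by simp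
    qed simp
    ultimately show ?thesis
      using that by (cases "k \<le> w") (metis diff_diff_cancel diff_le_self, metis le_add_diff_inverse nat_le_linear)
  qed
  have "m^m = (w + (m - w))^m" using w by simp
  also have "\<dots> = (\<Sum>k\<le>m. t k)" unfolding binomial_ring t_def by simp
  also have "\<dots> \<le> (\<Sum>k\<le>m. t w)" using max by (intro sum_mono) auto
  also have "\<dots> = (m + 1) * t w" by simp
  finally have "real (m^m) \<le> real ((m + 1) * t w)" by (simp only: of_nat_le_iff)
  then have "real m^m \<le> (real m + 1) * (real (m choose w) * real w^w * real (m - w)^(m - w))"
    by (simp add: t_def algebra_simps)
  moreover have "real m^m = real m^w * real m^(m - w)" using w by (simp flip: power_add)
  ultimately show ?thesis using m by (simp add: power_divide field_simps)
qed

text \<open>For \<open>\<alpha> \<le> 1 / 2\<close> convexity of \<open>exp\<close> gives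
  \<open>1 - \<alpha>\<close>. Otherwise the argument is negative, where \<open>exp_tail\<close> is
  at most quadratic, while the cubic term of \<open>exp_tail z\<close> supplies the gain. That gain
  needs \<open>z \<ge> \<delta>\<close>: for \<open>m = 2 * n\<close> all fibres have two elements
  and the set of all rows is always even.\<close>

lemma exp_tail_ratio_bound:
  fixes z \<alpha> \<delta> \<epsilon> :: real
  assumes "0 < \<delta>" "\<delta> \<le> z" "\<epsilon> \<le> \<alpha>" "\<alpha> \<le> 1" "0 \<le> \<alpha>"
  shows "(1 + exp_tail ((1 - 2 * \<alpha>) * z) / exp_tail z) / 2 \<le> max (1 - \<epsilon>) ((1 + 1 / (1 + \<delta> / 3)) / 2)"
proof -
  have z: "z > 0" using assms by simp
  have G: "exp_tail z > 0" using exp_tail_pos[OF z] .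
  define \<rho> where "\<rho> = 1 - 2 * \<alpha>"
  show ?thesis
  proof (cases "\<rho> \<ge> 0")
    case True
    have r1: "\<rho> \<le> 1" using assms by (simp add: \<rho>_def)
    have "exp (\<rho> * z) \<le> \<rho> * exp z + (1 - \<rho>)"
      using convex_onD[OF exp_convex, of \<rho> 0 z] True r1 by (simp add: algebra_simps)
    then have "exp_tail (\<rho> * z) \<le> \<rho> * exp_tail z" by (simp add: exp_tail_def algebra_simps)
    then have "exp_tail (\<rho> * z) / exp_tail z \<le> \<rho>" using G by (simp add: field_simps)
    then have "(1 + exp_tail (\<rho> * z) / exp_tail z) / 2 \<le> 1 - \<alpha>" by (simp add: \<rho>_def)
    then have "(1 + exp_tail (\<rho> * z) / exp_tail z) / 2 \<le> 1 - \<epsilon>" using assms by linarith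
    then show ?thesis unfolding \<rho>_def by (rule max.coboundedI1)
  next
    case False
    define t where "t = - \<rho> * z"
    have "(- \<rho>) * z \<le> 1 * z" using assms z by (intro mult_right_mono) (auto simp: \<rho>_def)
    then have t: "0 \<le> t" "t \<le> z" using False z by (auto simp: t_def mult_nonpos_nonneg)
    have "exp_tail (- t) \<le> t^2 / 2"
    proof -
      let ?f = "\<lambda>x::real. x^2 / 2 - exp_tail (- x)"
      have "?f 0 \<le> ?f t"
      proof (rule DERIV_nonneg_imp_nondecreasing[OF t(1)])
        fix x :: real
        have "(?f has_real_derivative x + (exp (- x) - 1)) (at x)"
          by (auto intro!: derivative_eq_intros)
        then show "\<exists>y. (?f has_real_derivative y) (at x) \<and> 0 \<le> y"
          using exp_ge_add_one_self[of "- x"] by (intro exI conjI) auto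
      qed
      then show ?thesis by simp
    qed
    also have "\<dots> \<le> z^2 / 2" using t by (simp add: power_mono)
    finally have a: "exp_tail (\<rho> * z) \<le> z^2 / 2" by (simp add: t_def)
    have b: "z^2 / 2 * (1 + \<delta> / 3) \<le> exp_tail z"
    proof -
      have "z^2 / 2 * (1 + \<delta> / 3) \<le> z^2 / 2 * (1 + z / 3)"
        using assms by (intro mult_left_mono) auto
      also have "\<dots> = z^2 / 2 + z^3 / 6" by (simp add: algebra_simps power2_eq_square power3_eq_cube)
      also have "\<dots> \<le> exp_tail z" using exp_tail_lower[of z] z by simp
      finally show ?thesis .
    qed
    have "exp_tail (\<rho> * z) * (1 + \<delta> / 3) \<le> z^2 / 2 * (1 + \<delta> / 3)"
      using a assms by (intro mult_right_mono) auto
    then have "exp_tail (\<rho> * z) / exp_tail z \<le> 1 / (1 + \<delta> / 3)"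
      using b G assms by (simp add: field_simps)
    then have "(1 + exp_tail (\<rho> * z) / exp_tail z) / 2 \<le> (1 + 1 / (1 + \<delta> / 3)) / 2"
      by (intro divide_right_mono add_left_mono) auto
    then show ?thesis unfolding \<rho>_def by (rule max.coboundedI2)
  qed
qed

lemma fibre_prob_exp_small:
  fixes z :: real
  assumes "n > 0" "2 * n < m" "w \<le> m" "0 < z" "real m = tail_mean z * real n"
  shows "fibre_prob m n w \<le> 4 * real m * (real m + 1)
    * ((1 + exp_tail ((1 - 2 * (real w / real m)) * z) / exp_tail z) / 2)^n"
proof -
  define X where "X = real (m choose w) * (real w / real m)^w * (real (m - w) / real m)^(m - w)"
  define H where "H = (1 + exp_tail ((1 - 2 * (real w / real m)) * z) / exp_tail z) / 2"
  have m: "m > 0" using assms by simp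
  have "1 - real w / real m = real (m - w) / real m"
    using assms(3) m by (simp add: of_nat_diff diff_divide_distrib)
  then have up: "fibre_prob m n w * X \<le> 4 * real m * H^n"
    using fibre_prob_upper[OF assms, of "real w / real m"] assms m by (simp add: X_def H_def mult_ac)
  have "fibre_prob m n w * 1 \<le> fibre_prob m n w * ((real m + 1) * X)"
    using binomial_mode[OF assms(3) m] fibre_prob_nonneg
    by (intro mult_left_mono) (auto simp: X_def mult_ac)
  also have "\<dots> = (real m + 1) * (fibre_prob m n w * X)" by (simp only: mult_ac)
  also have "\<dots> \<le> (real m + 1) * (4 * real m * H^n)" using up by (intro mult_left_mono) auto
  also have "\<dots> = 4 * real m * (real m + 1) * H^n" by (simp only: mult_ac)
  finally show ?thesis by (simp only: H_def mult_1_right)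
qed

text \<open>
  The parameter \<open>\<theta>\<close> is chosen with \<open>\<theta> powr p\<close> proportional to \<open>w / m\<close>, where \<open>p\<close> is the conjugate
  exponent of \<open>tail_mean z\<close>; then all powers of the normalising factor \<open>\<sigma>\<close> cancel.
\<close>

lemma fibre_prob_root_bound:
  fixes z :: real
  assumes n: "n > 0" and m2: "2 * n < m" and w: "w \<le> m" and z: "0 < z"
    and mean: "real m = tail_mean z * real n"
  shows "real (m choose w) powr (1 / tail_mean z) * fibre_prob m n w \<le> 4 * real m * (real m + 1)"
proof -
  define L q p \<alpha> \<beta> where "L = tail_mean z" and "q = 1 - 1 / L" and "p = 1 + 1 / (L - 1)"
    and "\<alpha> = real w / real m" and "\<beta> = real (m - w) / real m"
  define a b \<sigma> \<theta> where "a = \<alpha> powr q" and "b = \<beta> powr q" and "\<sigma> = a + b" and "\<theta> = a / \<sigma>"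
  define C P B where "C = real (m choose w)" and "P = fibre_prob m n w" and "B = \<alpha>^w * \<beta>^(m - w)"
  define H where "H = (1 + exp_tail ((1 - 2 * \<theta>) * z) / exp_tail z) / 2"
  have L: "L > 2" using tail_mean_lower[OF z] z by (simp add: L_def)
  have m: "m > 0" using m2 by simp
  have \<alpha>\<beta>: "0 \<le> \<alpha>" "0 \<le> \<beta>" "\<alpha> + \<beta> = 1"
    using w m by (auto simp: \<alpha>_def \<beta>_def of_nat_diff field_simps)
  have q: "0 < q" "q < 1" and qp: "q * p = 1" and pL: "p * (L - 1) = L"
    using L by (auto simp: q_def p_def field_simps)
  have ab: "0 \<le> a" "0 \<le> b" by (simp_all add: a_def b_def)
  have "a > 0 \<or> b > 0" using \<alpha>\<beta> by (auto simp: a_def b_def)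
  then have \<sigma>: "\<sigma> > 0" using ab by (auto simp: \<sigma>_def)
  have \<theta>: "0 \<le> \<theta>" "\<theta> \<le> 1" "1 - \<theta> = b / \<sigma>"
    using ab \<sigma> by (auto simp: \<theta>_def \<sigma>_def field_simps)
  have "\<theta> powr p + (1 - \<theta>) powr p = \<alpha> / \<sigma> powr p + \<beta> / \<sigma> powr p"
    unfolding \<theta>(3) unfolding \<theta>_def using ab \<sigma> \<alpha>\<beta> by (simp add: powr_divide a_def b_def powr_powr qp)
  also have "\<dots> = \<sigma> powr (- p)"
    by (simp only: add_divide_distrib[symmetric] \<alpha>\<beta>(3) powr_minus_divide)
  finally have "(\<theta> powr p + (1 - \<theta>) powr p) powr (L - 1) = \<sigma> powr (- L)"
    by (simp add: powr_powr pL)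
  then have H: "H \<le> \<sigma> powr (- L)"
    using two_point_inequality[OF z \<theta>(1,2)] by (simp add: H_def p_def L_def)
  have H0: "0 \<le> H" using exp_tail_nonneg by (simp add: H_def)
  have "H^n \<le> (\<sigma> powr (- L))^n" using H H0 by (rule power_mono)
  also have "\<dots> = \<sigma> powr (- real m)" using \<sigma> mean by (simp add: powr_powr L_def flip: powr_realpow)
  also have "\<dots> = 1 / \<sigma>^m" using \<sigma> by (simp add: powr_minus powr_realpow divide_inverse)
  finally have Hn: "H^n \<le> 1 / \<sigma>^m" .
  have pw: "(x powr q)^k = (x^k) powr q" if "0 \<le> x" for x k
    using that by (induction k) (auto simp: powr_mult)
  have "C * P * (\<theta>^w * (1 - \<theta>)^(m - w)) \<le> 4 * real m * H^n"
    using fibre_prob_upper[OF n m2 w z mean \<theta>(1,2)] by (simp add: C_def P_def H_def mult_ac)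
  also have "\<dots> \<le> 4 * real m * (1 / \<sigma>^m)" using Hn by (intro mult_left_mono) auto
  finally have "C * P * (\<theta>^w * (1 - \<theta>)^(m - w)) \<le> 4 * real m / \<sigma>^m" by simp
  moreover have "\<theta>^w * (1 - \<theta>)^(m - w) = B powr q / \<sigma>^m"
  proof -
    have "\<sigma>^m = \<sigma>^w * \<sigma>^(m - w)" using w by (simp flip: power_add)
    then show ?thesis unfolding \<theta>(3) unfolding \<theta>_def using \<alpha>\<beta>
      by (simp add: power_divide a_def b_def pw B_def powr_mult)
  qed
  ultimately have main: "C * P * B powr q \<le> 4 * real m" using \<sigma> by (simp add: field_simps)
  have C: "C \<ge> 1" using w by (simp add: C_def Suc_le_eq)
  have CB: "1 / (real m + 1) \<le> C * B"
    using binomial_mode[OF w m] by (simp add: C_def B_def \<alpha>_def \<beta>_def field_simps)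
  \<comment> \<open>A number in the unit interval grows when raised to a power \<open>q < 1\<close>.
    Thus \<open>C * B\<close> may be raised to \<open>q = 1 - 1 / L\<close> at the cost of one
    factor \<open>m + 1\<close>, and \<open>C powr (1 / L) * C powr q = C\<close> meets
    \<open>main\<close>.\<close>
  have "1 / (real m + 1) \<le> (1 / (real m + 1)) powr q"
    using powr_mono'[of q 1 "1 / (real m + 1)"] q m by (simp add: field_simps)
  also have "\<dots> \<le> (C * B) powr q" using CB q by (intro powr_mono2) auto
  finally have CBq: "1 / (real m + 1) \<le> (C * B) powr q" .
  have B0: "B \<ge> 0" using \<alpha>\<beta> by (simp add: B_def)
  have P0: "P \<ge> 0" using fibre_prob_nonneg by (simp add: P_def)
  have "C powr (1 / L) * P * (1 / (real m + 1)) \<le> C powr (1 / L) * P * (C * B) powr q"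
    using CBq P0 by (intro mult_left_mono) auto
  also have "\<dots> = (C powr (1 / L) * C powr q) * P * B powr q"
    using B0 C by (simp add: powr_mult)
  also have "C powr (1 / L) * C powr q = C" using C by (simp add: powr_add[symmetric] q_def)
  finally have "C powr (1 / L) * P * (1 / (real m + 1)) \<le> 4 * real m" using main by linarith
  then have "C powr (1 / L) * P \<le> 4 * real m * (real m + 1)"
    by (simp add: field_simps)
  then show ?thesis by (simp add: C_def P_def L_def)
qed

text \<open>Interpolation: \<open>C powr (1 / K) * P = (C powr (1 / L) * P) powr (L / K) * P powr (1
  - L / K)\<close>. The root bound controls the first factor and the exponential bound the second,
  whose exponent is positive because \<open>L < K\<close>.\<close>

lemma fibre_prob_large_weight:
  fixes z K \<eta> :: real
  assumes n: "n > 0" and m2: "2 * n < m" and w: "w \<le> m" and z: "0 < z"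
    and mean: "real m = tail_mean z * real n" and K: "tail_mean z < K"
    and H: "(1 + exp_tail ((1 - 2 * (real w / real m)) * z) / exp_tail z) / 2 \<le> \<eta>"
  shows "real (m choose w) powr (1 / K) * fibre_prob m n w
    \<le> 4 * real m * (real m + 1) * \<eta> powr (real n * (1 - tail_mean z / K))"
proof -
  define L P C M where "L = tail_mean z" and "P = fibre_prob m n w" and "C = real (m choose w)"
    and "M = 4 * real m * (real m + 1)"
  have L: "L > 2" using tail_mean_lower[OF z] z by (simp add: L_def)
  have K0: "K > 0" "L / K < 1" "0 < L / K" using K L by (auto simp: L_def field_simps)
  have P0: "P \<ge> 0" using fibre_prob_nonneg by (simp add: P_def)
  have C: "C \<ge> 1" using w by (simp add: C_def Suc_le_eq)
  have M: "M > 0" using m2 by (simp add: M_def)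
  define h where "h = (1 + exp_tail ((1 - 2 * (real w / real m)) * z) / exp_tail z) / 2"
  have h: "0 < h" using exp_tail_nonneg exp_tail_pos[OF z] by (simp add: h_def add_pos_nonneg)
  then have \<eta>: "\<eta> > 0" using H by (simp add: h_def)
  have "P \<le> M * h^n" using fibre_prob_exp_small[OF n m2 w z mean] by (simp add: P_def M_def h_def)
  also have "\<dots> \<le> M * \<eta>^n" using H h M by (intro mult_left_mono power_mono) (auto simp: h_def)
  finally have P1: "P \<le> M * \<eta>^n" .
  have P2: "C powr (1 / L) * P \<le> M"
    using fibre_prob_root_bound[OF n m2 w z mean] by (simp add: C_def P_def M_def L_def)
  have "C powr (1 / K) * P = (C powr (1 / L) * P) powr (L / K) * P powr (1 - L / K)"
  proof (cases "P = 0")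
    case False
    have "(C powr (1 / L) * P) powr (L / K) = C powr (1 / K) * P powr (L / K)"
      using L P0 C by (simp add: powr_mult powr_powr)
    moreover have "P powr (L / K) * P powr (1 - L / K) = P"
      using False P0 by (simp add: powr_add[symmetric])
    ultimately show ?thesis by (simp add: mult.assoc)
  qed simp
  also have "\<dots> \<le> M powr (L / K) * (M * \<eta>^n) powr (1 - L / K)"
    using P1 P2 P0 C K0 by (intro mult_mono powr_mono2) auto
  also have "\<dots> = (M powr (L / K) * M powr (1 - L / K)) * (\<eta>^n) powr (1 - L / K)"
    using M \<eta> by (simp add: powr_mult)
  also have "M powr (L / K) * M powr (1 - L / K) = M" using M by (simp add: powr_add[symmetric])
  also have "(\<eta>^n) powr (1 - L / K) = \<eta> powr (real n * (1 - L / K))"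
    using \<eta> by (simp add: powr_realpow[symmetric] powr_powr)
  finally show ?thesis by (simp add: M_def C_def P_def L_def)
qed

section \<open>Random matrices over the field of two elements\<close>

lemma UNIV_bit: "(UNIV :: bit set) = {0, 1}"
  by (auto intro: bit_not_zero_iff[THEN iffD1])

lemma finite_carrier_vec_bit: "finite (carrier_vec n :: bit vec set)"
  and card_carrier_vec_bit: "card (carrier_vec n :: bit vec set) = 2 ^ n"
proof -
  have bij: "bij_betw (\<lambda>f. vec n f) (PiE {..<n} (\<lambda>_. UNIV :: bit set)) (carrier_vec n)"
    by (rule bij_betwI[where g = "\<lambda>v. \<lambda>i\<in>{..<n}. v $ i"]) (auto simp: PiE_def extensional_def fun_eq_iff)
  have fin: "finite (PiE {..<n} (\<lambda>_. UNIV :: bit set))"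
    by (intro finite_PiE) (simp_all add: UNIV_bit)
  show "finite (carrier_vec n :: bit vec set)"
    using bij_betw_finite[OF bij] fin by simp
  have "card (carrier_vec n :: bit vec set) = card (PiE {..<n} (\<lambda>_. UNIV :: bit set))"
    using bij_betw_same_card[OF bij] by simp
  also have "\<dots> = 2 ^ n" by (simp add: card_PiE UNIV_bit numeral_2_eq_2)
  finally show "card (carrier_vec n :: bit vec set) = 2 ^ n" .
qed

text \<open>The nontrivial additive character of the field with two elements.\<close>

definition bit_sign :: "bit \<Rightarrow> int" where
  "bit_sign b = (if b = 0 then 1 else -1)"

lemma bit_sign_add: "bit_sign (a + b) = bit_sign a * bit_sign b"
  by (cases a; cases b) (auto simp: bit_sign_def)

text \<open>Translation by a unit vector at a coordinate where \<open>v\<close> is 1 permutes the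
  vectors and flips every sign.\<close>

lemma sum_bit_sign_scalar_prod:
  assumes v: "v \<in> carrier_vec n" "v \<noteq> 0\<^sub>v n"
  shows "(\<Sum>x\<in>carrier_vec n. bit_sign (v \<bullet> x)) = 0"
proof -
  obtain i where i: "i < n" "v $ i = 1" using v by (metis bit_not_zero_iff carrier_vecD eq_vecI index_zero_vec)
  let ?f = "\<lambda>x. x + unit_vec n i"
  have twice: "unit_vec n i + unit_vec n i = (0\<^sub>v n :: bit vec)"
    by (intro eq_vecI) auto
  have "(\<Sum>x\<in>carrier_vec n. bit_sign (v \<bullet> x)) = (\<Sum>x\<in>carrier_vec n. bit_sign (v \<bullet> ?f x))"
    by (rule sum.reindex_bij_witness[where i = ?f and j = ?f]) (auto simp: twice)
  also have "\<dots> = (\<Sum>x\<in>carrier_vec n. - bit_sign (v \<bullet> x))"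
  proof (rule sum.cong[OF refl])
    fix x :: "bit vec" assume x: "x \<in> carrier_vec n"
    have "v \<bullet> ?f x = v \<bullet> x + 1"
      using scalar_prod_add_distrib[OF v(1) x, of "unit_vec n i"] i by simp
    then show "bit_sign (v \<bullet> ?f x) = - bit_sign (v \<bullet> x)" by (simp only: bit_sign_add) (simp add: bit_sign_def)
  qed
  finally show ?thesis by (simp add: sum_negf)
qed

text \<open>
  Orthogonality of characters: if \<open>s\<close> is not in the image, the sum of \<open>bit_sign (y \<bullet> (A x + s))\<close> over
  all \<open>x\<close> and \<open>y\<close> vanishes, while only \<open>y = 0\<close> contributes when the left kernel is trivial.
\<close>

lemma full_row_rank_solvable:
  fixes A :: "bit mat"
  assumes A: "A \<in> carrier_mat m n"
    and ker: "\<And>y. y \<in> carrier_vec m \<Longrightarrow> transpose_mat A *\<^sub>v y = 0\<^sub>v n \<Longrightarrow> y = 0\<^sub>v m"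
    and s: "s \<in> carrier_vec m"
  shows "\<exists>x\<in>carrier_vec n. A *\<^sub>v x = s"
proof (rule ccontr)
  assume no: "\<not> ?thesis"
  let ?X = "carrier_vec n :: bit vec set" and ?Y = "carrier_vec m :: bit vec set"
  let ?t = "\<lambda>x y. bit_sign ((A *\<^sub>v x + s) \<bullet> y)"
  have "(\<Sum>y\<in>?Y. ?t x y) = 0" if x: "x \<in> ?X" for x
  proof (rule sum_bit_sign_scalar_prod)
    show "A *\<^sub>v x + s \<in> carrier_vec m" using A s x by auto
    show "A *\<^sub>v x + s \<noteq> 0\<^sub>v m"
    proof
      assume 0: "A *\<^sub>v x + s = 0\<^sub>v m"
      have "A *\<^sub>v x = s"
      proof (rule eq_vecI)
        fix i assume i: "i < dim_vec s"
        then have "(A *\<^sub>v x) $ i + s $ i = 0"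
          using arg_cong[OF 0, of "\<lambda>v. v $ i"] s by simp
        moreover have "a + b = 0 \<Longrightarrow> a = b" for a b :: bit by (cases a; cases b) auto
        ultimately show "(A *\<^sub>v x) $ i = s $ i" by blast
      qed (use A s in auto)
      then show False using no x by blast
    qed
  qed
  then have "0 = (\<Sum>x\<in>?X. \<Sum>y\<in>?Y. ?t x y)" by simp
  also have "\<dots> = (\<Sum>y\<in>?Y. \<Sum>x\<in>?X. ?t x y)" by (rule sum.swap)
  also have "\<dots> = (\<Sum>y\<in>?Y. if y = 0\<^sub>v m then 2 ^ n else 0)"
  proof (rule sum.cong[OF refl])
    fix y assume y: "y \<in> ?Y"
    have "?t x y = bit_sign ((transpose_mat A *\<^sub>v y) \<bullet> x) * bit_sign (s \<bullet> y)" if x: "x \<in> ?X" for x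
    proof -
      have "(A *\<^sub>v x + s) \<bullet> y = (A *\<^sub>v x) \<bullet> y + s \<bullet> y"
        using A s x y by (intro add_scalar_prod_distrib) auto
      also have "(A *\<^sub>v x) \<bullet> y = (transpose_mat A *\<^sub>v y) \<bullet> x"
        using transpose_vec_mult_scalar[OF A x y] comm_scalar_prod[of "A *\<^sub>v x" m y] A x y by auto
      finally show ?thesis by (simp only: bit_sign_add)
    qed
    then have eq: "(\<Sum>x\<in>?X. ?t x y) = (\<Sum>x\<in>?X. bit_sign ((transpose_mat A *\<^sub>v y) \<bullet> x)) * bit_sign (s \<bullet> y)"
      by (simp add: sum_distrib_right)
    show "(\<Sum>x\<in>?X. ?t x y) = (if y = 0\<^sub>v m then 2 ^ n else 0)"
    proof (cases "y = 0\<^sub>v m")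
      case True
      have "(A *\<^sub>v x + s) \<bullet> y = 0" if "x \<in> ?X" for x using True A s that by simp
      then show ?thesis using True by (simp add: bit_sign_def card_carrier_vec_bit)
    next
      case False
      then have "transpose_mat A *\<^sub>v y \<noteq> 0\<^sub>v n" using ker y by blast
      moreover have "transpose_mat A *\<^sub>v y \<in> carrier_vec n" using A y by auto
      ultimately show ?thesis using False eq sum_bit_sign_scalar_prod by simp
    qed
  qed
  also have "\<dots> = 2 ^ n" by (simp add: finite_carrier_vec_bit)
  finally show False by simp
qed

lemma sum_bit_eq_0_iff:
  assumes "finite I"
  shows "(\<Sum>i\<in>I. f i :: bit) = 0 \<longleftrightarrow> even (card {i \<in> I. f i = 1})"
  using assms
proof (induction I rule: finite_induct)
  case (insert x I)
  show ?case
  proof (cases "f x = 1")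
    case True
    have "{i \<in> insert x I. f i = 1} = insert x {i \<in> I. f i = 1}" using True by auto
    then have "card {i \<in> insert x I. f i = 1} = Suc (card {i \<in> I. f i = 1})"
      using insert by simp
    moreover have "(\<Sum>i\<in>insert x I. f i) = 1 + (\<Sum>i\<in>I. f i)" using insert True by simp
    moreover have "1 + b = 0 \<longleftrightarrow> b \<noteq> 0" for b :: bit by (cases b) auto
    ultimately show ?thesis using insert.IH by simp
  next
    case False
    then have "{i \<in> insert x I. f i = 1} = {i \<in> I. f i = 1}" by auto
    moreover have "f x = 0" using False by (simp add: bit_not_one_iff)
    ultimately show ?thesis using insert by simp
  qed
qed simp

text \<open>For a set of rows \<open>T\<close>: its indicator vector lies in the left kernel of
  \<open>A\<close>. Over two elements vectors are their supports, so kernel vectors can be counted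
  by size.\<close>

definition left_kernel_set :: "bit mat \<Rightarrow> nat set \<Rightarrow> bool" where
  "left_kernel_set A T \<longleftrightarrow> (\<forall>c<dim_col A. even (card {i \<in> T. A $$ (i, c) = 1}))"

lemma unsolvable_left_kernel_set:
  fixes A :: "bit mat"
  assumes A: "A \<in> carrier_mat m n" and s: "s \<in> carrier_vec m"
    and no: "\<not> (\<exists>x\<in>carrier_vec n. A *\<^sub>v x = s)"
  shows "\<exists>T. T \<subseteq> {..<m} \<and> T \<noteq> {} \<and> left_kernel_set A T"
proof -
  obtain y where y: "y \<in> carrier_vec m" "transpose_mat A *\<^sub>v y = 0\<^sub>v n" "y \<noteq> 0\<^sub>v m"
    using full_row_rank_solvable[OF A _ s] no by blast
  define T where "T = {i. i < m \<and> y $ i = 1}"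
  have "left_kernel_set A T"
    unfolding left_kernel_set_def
  proof (intro allI impI)
    fix c assume "c < dim_col A"
    then have c: "c < n" using A by simp
    have "0 = (transpose_mat A *\<^sub>v y) $ c" using y c by simp
    also have "\<dots> = col A c \<bullet> y" using A c by simp
    also have "\<dots> = (\<Sum>i\<in>{0..<m}. A $$ (i, c) * y $ i)"
      unfolding scalar_prod_def using A y c by (intro sum.cong) auto
    finally have "(\<Sum>i\<in>{0..<m}. A $$ (i, c) * y $ i) = 0" by (rule sym)
    then have "even (card {i \<in> {0..<m}. A $$ (i, c) * y $ i = 1})"
      by (rule sum_bit_eq_0_iff[THEN iffD1, rotated]) simp
    moreover have "a * b = 1 \<longleftrightarrow> b = 1 \<and> a = 1" for a b :: bit by (cases a; cases b) auto
    ultimately show "even (card {i \<in> T. A $$ (i, c) = 1})" by (simp add: T_def conj_assoc)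
  qed
  moreover have "T \<noteq> {}"
  proof
    assume "T = {}"
    then have "y $ i = 0" if "i < m" for i using that by (auto simp: T_def bit_not_one_iff)
    then have "y = 0\<^sub>v m" using y(1) by (intro eq_vecI) auto
    then show False using y(3) by blast
  qed
  ultimately show ?thesis by (intro exI[of _ T]) (auto simp: T_def)
qed

section \<open>Matrices as tuples of maps\<close>

context
  fixes K m :: nat and n :: "nat \<Rightarrow> nat"
begin

definition "col_offset j = (\<Sum>l = 1..<j. n l)"

lemma col_offset_mono: "1 \<le> j \<Longrightarrow> j < j' \<Longrightarrow> col_offset j + n j \<le> col_offset j'"
proof -
  assume j: "1 \<le> j" "j < j'"
  have "col_offset j + n j = (\<Sum>l = 1..<Suc j. n l)" using j by (simp add: col_offset_def)
  also have "\<dots> \<le> col_offset j'" unfolding col_offset_def using j by (intro sum_mono2) auto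
  finally show ?thesis .
qed

lemma col_offset_total: "1 \<le> j \<Longrightarrow> j \<le> K \<Longrightarrow> col_offset j + n j \<le> total_width K n"
  using col_offset_mono[of j "Suc K"]
  by (simp add: total_width_def col_offset_def atLeastLessThanSuc_atLeastAtMost)

lemma column_unique:
  assumes "j \<in> {1..K}" "c < n j" "j' \<in> {1..K}" "c' < n j'" "col_offset j + c = col_offset j' + c'"
  shows "j = j' \<and> c = c'"
proof -
  have "j = j'"
  proof (rule ccontr)
    assume "j \<noteq> j'"
    then consider "j < j'" | "j' < j" by linarith
    then show False using col_offset_mono[of j j'] col_offset_mono[of j' j] assms by cases auto
  qed
  then show ?thesis using assms by simp
qed

lemma column_exists:
  assumes "C < total_width K n"
  obtains j c where "j \<in> {1..K}" "c < n j" "C = col_offset j + c"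
proof -
  have "\<exists>j\<in>{1..k}. \<exists>c<n j. C = col_offset j + c" if "C < (\<Sum>l = 1..k. n l)" for k
    using that
  proof (induction k)
    case (Suc k)
    show ?case
    proof (cases "C < (\<Sum>l = 1..k. n l)")
      case True
      then obtain j c where "j \<in> {1..k}" "c < n j" "C = col_offset j + c" using Suc.IH by blast
      then show ?thesis by (intro bexI[of _ j] exI[of _ c]) auto
    next
      case False
      have "col_offset (Suc k) = (\<Sum>l = 1..k. n l)"
        by (simp add: col_offset_def atLeastLessThanSuc_atLeastAtMost)
      then show ?thesis using False Suc.prems
        by (intro bexI[of _ "Suc k"] exI[of _ "C - (\<Sum>l = 1..k. n l)"]) auto
    qed
  qed simp
  then show ?thesis using assms that unfolding total_width_def by blast
qed

lemma block_index: "i < m \<Longrightarrow> c < n j \<Longrightarrow> block m n A j $$ (i, c) = A $$ (i, col_offset j + c)"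
  by (simp add: block_def col_offset_def)

text \<open>Unique description is justified by the single 1 in each row of a block. Both levels are
  restricted, so the tuples lie in dependent products whose cardinality is a product.\<close>

definition "row_maps A = (\<lambda>j\<in>{1..K}. \<lambda>i\<in>{..<m}. THE c. c < n j \<and> block m n A j $$ (i, c) = 1)"

lemma row_maps:
  assumes A: "A \<in> xorgame_matrices K m n" and j: "j \<in> {1..K}" and i: "i < m"
  shows "row_maps A j i < n j" and "c < n j \<Longrightarrow> A $$ (i, col_offset j + c) = 1 \<longleftrightarrow> row_maps A j i = c"
proof -
  have "card {c. c < n j \<and> block m n A j $$ (i, c) = 1} = 1"
    using A j i by (auto simp: xorgame_matrices_def)
  then obtain d where d: "{c. c < n j \<and> block m n A j $$ (i, c) = 1} = {d}"
    by (auto simp: card_1_singleton_iff)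
  then have d': "d < n j" "c < n j \<Longrightarrow> block m n A j $$ (i, c) = 1 \<longleftrightarrow> c = d" for c by blast+
  have "row_maps A j i = d"
    using i j d' unfolding row_maps_def by (auto intro!: the_equality)
  then show "row_maps A j i < n j" using d' by blast
  show "A $$ (i, col_offset j + c) = 1 \<longleftrightarrow> row_maps A j i = c" if "c < n j"
    using d'(2)[OF that] \<open>row_maps A j i = d\<close> unfolding block_index[OF i that] by blast
qed

lemma row_maps_in:
  assumes A: "A \<in> xorgame_matrices K m n" and T: "T \<subseteq> {..<m}" "left_kernel_set A T"
  shows "row_maps A \<in> PiE {1..K} (\<lambda>j. even_fibre_maps {..<n j} {..<m} T)"
proof (rule PiE_I)
  fix j assume j: "j \<in> {1..K}"
  have dim: "A \<in> carrier_mat m (total_width K n)" using A by (simp add: xorgame_matrices_def)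
  have "2 \<le> card {i \<in> {..<m}. row_maps A j i = c} \<and> even (card {i \<in> T. row_maps A j i = c})"
    if c: "c < n j" for c
  proof
    have "{i. i < m \<and> block m n A j $$ (i, c) = 1} = {i \<in> {..<m}. row_maps A j i = c}"
      using row_maps[OF A j] block_index c by auto
    moreover have "2 \<le> card {i. i < m \<and> block m n A j $$ (i, c) = 1}"
      using A j c by (auto simp: xorgame_matrices_def)
    ultimately show "2 \<le> card {i \<in> {..<m}. row_maps A j i = c}" by simp
    have "col_offset j + c < dim_col A" using dim col_offset_total[of j] j c by auto
    then have "even (card {i \<in> T. A $$ (i, col_offset j + c) = 1})"
      using T by (simp add: left_kernel_set_def)
    moreover have "{i \<in> T. A $$ (i, col_offset j + c) = 1} = {i \<in> T. row_maps A j i = c}"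
      using row_maps[OF A j] c T by auto
    ultimately show "even (card {i \<in> T. row_maps A j i = c})" by simp
  qed
  moreover have "row_maps A j \<in> {..<m} \<rightarrow>\<^sub>E {..<n j}"
    using row_maps(1)[OF A j] j by (auto simp: row_maps_def)
  ultimately show "row_maps A j \<in> even_fibre_maps {..<n j} {..<m} T"
    by (simp add: even_fibre_maps_def)
next
  fix j assume "j \<notin> {1..K}"
  then show "row_maps A j = undefined" unfolding row_maps_def restrict_apply by (simp only: if_False)
qed

lemma inj_on_row_maps: "inj_on row_maps (xorgame_matrices K m n)"
proof (rule inj_onI)
  fix A B assume A: "A \<in> xorgame_matrices K m n" and B: "B \<in> xorgame_matrices K m n"
    and eq: "row_maps A = row_maps B"
  have dim: "A \<in> carrier_mat m (total_width K n)" "B \<in> carrier_mat m (total_width K n)"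
    using A B by (simp_all add: xorgame_matrices_def)
  show "A = B"
  proof (rule eq_matI)
    fix i C assume "i < dim_row B" "C < dim_col B"
    then have i: "i < m" and C: "C < total_width K n" using dim by auto
    obtain j c where j: "j \<in> {1..K}" "c < n j" "C = col_offset j + c" by (rule column_exists[OF C])
    have "A $$ (i, C) = 1 \<longleftrightarrow> B $$ (i, C) = 1"
      using row_maps(2)[OF A j(1) i j(2)] row_maps(2)[OF B j(1) i j(2)] eq j(3) by simp
    then show "A $$ (i, C) = B $$ (i, C)" by (metis bit_not_one_iff)
  qed (use dim in auto)
qed

text \<open>The matrix has its ones in the columns \<open>col_offset j + F j i\<close>. By
  \<open>column_unique\<close> a one placed for one block never shows up in another.\<close>

lemma row_maps_surj:
  assumes F: "F \<in> PiE {1..K} (\<lambda>j. even_fibre_maps {..<n j} {..<m} {})"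
  shows "F \<in> row_maps ` xorgame_matrices K m n"
proof
  define A :: "bit mat" where "A = mat m (total_width K n)
    (\<lambda>(i, C). if \<exists>j\<in>{1..K}. C = col_offset j + F j i then 1 else 0)"
  have Fj: "F j \<in> even_fibre_maps {..<n j} {..<m} {}" if "j \<in> {1..K}" for j using F that by auto
  have Fn: "F j i < n j" if "j \<in> {1..K}" "i < m" for j i
    using Fj[OF that(1)] that(2) by (auto simp: even_fibre_maps_def)
  have entry: "block m n A j $$ (i, c) = 1 \<longleftrightarrow> F j i = c" if "j \<in> {1..K}" "i < m" "c < n j" for j i c
  proof -
    have "col_offset j + c < total_width K n" using col_offset_total[of j] that by auto
    then have "block m n A j $$ (i, c) = 1 \<longleftrightarrow> (\<exists>j'\<in>{1..K}. col_offset j + c = col_offset j' + F j' i)"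
      using that by (simp add: block_index A_def)
    also have "\<dots> \<longleftrightarrow> F j i = c" using column_unique[OF that(1,3)] Fn that by metis
    finally show ?thesis .
  qed
  show A: "A \<in> xorgame_matrices K m n"
    unfolding xorgame_matrices_def
  proof (intro CollectI conjI ballI allI impI)
    show "A \<in> carrier_mat m (total_width K n)" by (simp add: A_def)
    fix j assume j: "j \<in> {1..K}"
    show "card {c. c < n j \<and> block m n A j $$ (i, c) = 1} = 1" if "i < m" for i
    proof -
      have "{c. c < n j \<and> block m n A j $$ (i, c) = 1} = {F j i}"
        using entry[OF j that] Fn[OF j that] by auto
      then show ?thesis by simp
    qed
    show "2 \<le> card {i. i < m \<and> block m n A j $$ (i, c) = 1}" if "c < n j" for c
    proof -
      have "{i. i < m \<and> block m n A j $$ (i, c) = 1} = {i \<in> {..<m}. F j i = c}"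
        using entry[OF j _ that] by auto
      then show ?thesis using Fj[OF j] that by (auto simp: even_fibre_maps_def)
    qed
  qed
  show "F = row_maps A"
  proof (rule PiE_ext[OF F])
    show "row_maps A \<in> PiE {1..K} (\<lambda>j. even_fibre_maps {..<n j} {..<m} {})"
      using row_maps_in[OF A, of "{}"] by (simp add: left_kernel_set_def)
    fix j assume j: "j \<in> {1..K}"
    show "F j = row_maps A j"
    proof (rule extensionalityI)
      show "F j \<in> extensional {..<m}" using Fj[OF j] by (auto simp: even_fibre_maps_def PiE_def)
      show "row_maps A j \<in> extensional {..<m}" using j by (simp add: row_maps_def)
      fix i assume "i \<in> {..<m}"
      then show "F j i = row_maps A j i"
        using row_maps[OF A j, of i] entry[OF j, of i] block_index[of i _ j A] Fn[OF j, of i] by auto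
    qed
  qed
qed

lemma card_PiE_even_fibre_maps:
  assumes "T \<subseteq> {..<m}"
  shows "card (PiE {1..K} (\<lambda>j. even_fibre_maps {..<n j} {..<m} T))
      = (\<Prod>j = 1..K. fibre_count (n j) (card T) (m - card T))"
proof -
  have "card ({..<m} - T) = m - card T" using assms finite_subset by (subst card_Diff_subset) auto
  then show ?thesis using assms by (simp add: card_PiE card_even_fibre_maps)
qed

lemma finite_xorgame_matrices: "finite (xorgame_matrices K m n)"
proof -
  have "finite (PiE {1..K} (\<lambda>j. even_fibre_maps {..<n j} {..<m} {}))"
    by (intro finite_PiE finite_even_fibre_maps) auto
  moreover have "row_maps ` xorgame_matrices K m n \<subseteq> PiE {1..K} (\<lambda>j. even_fibre_maps {..<n j} {..<m} {})"
    using row_maps_in[of _ "{}"] by (auto simp: left_kernel_set_def)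
  ultimately show ?thesis using inj_on_row_maps by (metis finite_imageD finite_subset)
qed

lemma card_xorgame_matrices:
  "card (xorgame_matrices K m n) = (\<Prod>j = 1..K. fibre_count (n j) 0 m)"
proof -
  have "row_maps ` xorgame_matrices K m n = PiE {1..K} (\<lambda>j. even_fibre_maps {..<n j} {..<m} {})"
    using row_maps_in[of _ "{}"] row_maps_surj by (auto simp: left_kernel_set_def)
  then show ?thesis
    using card_image[OF inj_on_row_maps] card_PiE_even_fibre_maps[of "{}"] by simp
qed

lemma card_left_kernel_set_le:
  assumes "T \<subseteq> {..<m}"
  shows "card {A \<in> xorgame_matrices K m n. left_kernel_set A T}
      \<le> (\<Prod>j = 1..K. fibre_count (n j) (card T) (m - card T))"
proof -
  have "card {A \<in> xorgame_matrices K m n. left_kernel_set A T}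
      \<le> card (PiE {1..K} (\<lambda>j. even_fibre_maps {..<n j} {..<m} T))"
  proof (rule card_inj_on_le)
    show "inj_on row_maps {A \<in> xorgame_matrices K m n. left_kernel_set A T}"
      using inj_on_row_maps by (rule inj_on_subset) auto
    show "row_maps ` {A \<in> xorgame_matrices K m n. left_kernel_set A T}
        \<subseteq> PiE {1..K} (\<lambda>j. even_fibre_maps {..<n j} {..<m} T)"
      using row_maps_in[OF _ assms] by blast
    show "finite (PiE {1..K} (\<lambda>j. even_fibre_maps {..<n j} {..<m} T))"
      by (intro finite_PiE finite_even_fibre_maps) auto
  qed
  then show ?thesis by (simp only: card_PiE_even_fibre_maps[OF assms])
qed

section \<open>Bounds on the satisfiability probability\<close>

lemma sat_prob_eq:
  assumes "xorgame_matrices K m n \<noteq> {}"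
  shows "sat_prob K m n = real (card {(A, s). A \<in> xorgame_matrices K m n \<and> s \<in> carrier_vec m \<and>
      (\<exists>x\<in>carrier_vec (total_width K n). A *\<^sub>v x = s)}) / (real (card (xorgame_matrices K m n)) * 2 ^ m)"
proof -
  let ?S = "xorgame_matrices K m n \<times> (carrier_vec m :: bit vec set)"
  obtain A where "A \<in> xorgame_matrices K m n" using assms by blast
  then have "(A, 0\<^sub>v m) \<in> ?S" by simp
  then have "?S \<noteq> {}" by blast
  moreover have "finite ?S" using finite_xorgame_matrices finite_carrier_vec_bit by simp
  ultimately have "sat_prob K m n
      = real (card (?S \<inter> {(A, s). \<exists>x\<in>carrier_vec (total_width K n). A *\<^sub>v x = s})) / real (card ?S)"
    unfolding sat_prob_def by (rule measure_pmf_of_set)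
  also have "?S \<inter> {(A, s). \<exists>x\<in>carrier_vec (total_width K n). A *\<^sub>v x = s}
     = {(A, s). A \<in> xorgame_matrices K m n \<and> s \<in> carrier_vec m \<and> (\<exists>x\<in>carrier_vec (total_width K n). A *\<^sub>v x = s)}"
    by auto
  finally show ?thesis by (simp add: card_cartesian_product card_carrier_vec_bit)
qed

lemma sat_prob_upper:
  assumes "xorgame_matrices K m n \<noteq> {}"
  shows "sat_prob K m n \<le> 2 powr (- (real m - real (total_width K n)))"
proof -
  let ?X = "xorgame_matrices K m n" and ?N = "total_width K n"
  have X: "card ?X > 0" using assms finite_xorgame_matrices by (simp add: card_gt_0_iff)
  have "{(A, s). A \<in> ?X \<and> s \<in> carrier_vec m \<and> (\<exists>x\<in>carrier_vec ?N. A *\<^sub>v x = s)}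
      \<subseteq> (\<lambda>(A, x). (A, A *\<^sub>v x)) ` (?X \<times> carrier_vec ?N)"
    by force
  then have "card {(A, s). A \<in> ?X \<and> s \<in> carrier_vec m \<and> (\<exists>x\<in>carrier_vec ?N. A *\<^sub>v x = s)}
      \<le> card (?X \<times> (carrier_vec ?N :: bit vec set))"
    using finite_xorgame_matrices finite_carrier_vec_bit by (intro surj_card_le) auto
  also have "\<dots> = card ?X * 2 ^ ?N" by (simp add: card_cartesian_product card_carrier_vec_bit)
  finally have "sat_prob K m n \<le> real (card ?X * 2 ^ ?N) / (real (card ?X) * 2 ^ m)"
    unfolding sat_prob_eq[OF assms] by (intro divide_right_mono) (simp_all only: of_nat_le_iff, simp)
  also have "\<dots> = 2 ^ ?N / 2 ^ m" using X by simp
  also have "\<dots> = 2 powr (- (real m - real ?N))" by (simp add: powr_diff powr_realpow)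
  finally show ?thesis .
qed

text \<open>Failure for any \<open>s\<close> forces a nonempty kernel set, a condition on the matrix
  alone. The union bound therefore leaves \<open>s\<close> free, and the factor \<open>2 ^ m\<close>
  cancels.\<close>

lemma unsat_prob_upper:
  assumes "\<And>j. j \<in> {1..K} \<Longrightarrow> fibre_count (n j) 0 m > 0"
  shows "1 - sat_prob K m n \<le> (\<Sum>w = 1..m. real (m choose w) * (\<Prod>j = 1..K. fibre_prob m (n j) w))"
proof -
  let ?X = "xorgame_matrices K m n" and ?N = "total_width K n" and ?V = "carrier_vec m :: bit vec set"
  let ?sat = "\<lambda>A s. \<exists>x\<in>carrier_vec ?N. A *\<^sub>v x = s"
  let ?\<T> = "Pow {..<m} - {{}}"
  define q where "q w = (\<Prod>j = 1..K. fibre_count (n j) w (m - w))" for w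
  have X: "card ?X > 0" using assms by (simp add: card_xorgame_matrices)
  then have ne: "?X \<noteq> {}" by auto
  have fin: "finite (?X \<times> ?V)" using finite_xorgame_matrices finite_carrier_vec_bit by simp
  define Y Z where "Y = {(A, s). A \<in> ?X \<and> s \<in> ?V \<and> ?sat A s}" and "Z = {(A, s). A \<in> ?X \<and> s \<in> ?V \<and> \<not> ?sat A s}"
  have YZ: "Y \<union> Z = ?X \<times> ?V" "Y \<inter> Z = {}" by (auto simp: Y_def Z_def)
  then have "finite Y" "finite Z" using fin by (metis finite_Un)+
  then have "card Y + card Z = card ?X * 2 ^ m"
    using card_Un_disjoint[of Y Z] YZ by (simp add: card_cartesian_product card_carrier_vec_bit)
  then have cY: "real (card Y) = real (card ?X) * 2 ^ m - real (card Z)"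
    by (metis add_diff_cancel_right' of_nat_add of_nat_mult of_nat_numeral of_nat_power)
  have "Z \<subseteq> (\<Union>T\<in>?\<T>. {A \<in> ?X. left_kernel_set A T} \<times> ?V)"
  proof clarify
    fix A s assume "(A, s) \<in> Z"
    then have A: "A \<in> ?X" "A \<in> carrier_mat m ?N" "s \<in> ?V" "\<not> ?sat A s"
      by (auto simp: Z_def xorgame_matrices_def)
    from unsolvable_left_kernel_set[OF A(2-4)]
    show "(A, s) \<in> (\<Union>T\<in>?\<T>. {A \<in> ?X. left_kernel_set A T} \<times> ?V)" using A by blast
  qed
  then have "card Z \<le> card (\<Union>T\<in>?\<T>. {A \<in> ?X. left_kernel_set A T} \<times> ?V)"
    using finite_xorgame_matrices finite_carrier_vec_bit by (intro card_mono) auto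
  also have "\<dots> \<le> (\<Sum>T\<in>?\<T>. card ({A \<in> ?X. left_kernel_set A T} \<times> ?V))"
    by (rule card_UN_le) simp
  also have "\<dots> \<le> (\<Sum>T\<in>?\<T>. q (card T) * 2 ^ m)"
    using card_left_kernel_set_le
    by (intro sum_mono) (auto simp: card_cartesian_product card_carrier_vec_bit q_def)
  also have "\<dots> = (\<Sum>T\<in>?\<T>. q (card T)) * 2 ^ m" by (simp add: sum_distrib_right)
  also have "(\<Sum>T\<in>?\<T>. q (card T)) = (\<Sum>w = 1..m. (m choose w) * q w)"
  proof -
    have "(\<Sum>T\<in>?\<T>. q (card T)) = (\<Sum>w = 1..m. \<Sum>T\<in>{T \<in> ?\<T>. card T = w}. q (card T))"
    proof (rule sum.group[symmetric])
      show "card ` ?\<T> \<subseteq> {1..m}"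
        using card_mono[of "{..<m}"] by (auto simp: Suc_le_eq card_gt_0_iff dest: finite_subset[OF _ finite_lessThan])
    qed auto
    also have "\<dots> = (\<Sum>w = 1..m. card {T \<in> ?\<T>. card T = w} * q w)"
      by (intro sum.cong refl) simp
    also have "\<dots> = (\<Sum>w = 1..m. (m choose w) * q w)"
    proof (intro sum.cong refl)
      fix w assume "w \<in> {1..m}"
      then have "{T \<in> ?\<T>. card T = w} = {T. T \<subseteq> {..<m} \<and> card T = w}" by auto
      then show "card {T \<in> ?\<T>. card T = w} * q w = (m choose w) * q w"
        using n_subsets[of "{..<m}" w] by simp
    qed
    finally show ?thesis .
  qed
  finally have "real (card Z) \<le> real ((\<Sum>w = 1..m. (m choose w) * q w) * 2 ^ m)"
    by (simp only: of_nat_le_iff)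
  then have Z: "real (card Z) \<le> (\<Sum>w = 1..m. real (m choose w) * real (q w)) * 2 ^ m" by simp
  have "1 - sat_prob K m n = real (card Z) / (real (card ?X) * 2 ^ m)"
    unfolding sat_prob_eq[OF ne] Y_def[symmetric] cY using X by (simp add: field_simps)
  also have "\<dots> \<le> (\<Sum>w = 1..m. real (m choose w) * real (q w)) * 2 ^ m / (real (card ?X) * 2 ^ m)"
    using Z by (intro divide_right_mono) auto
  also have "\<dots> = (\<Sum>w = 1..m. real (m choose w) * (real (q w) / real (card ?X)))"
    by (simp add: sum_divide_distrib)
  also have "\<dots> = (\<Sum>w = 1..m. real (m choose w) * (\<Prod>j = 1..K. fibre_prob m (n j) w))"
    by (simp add: q_def card_xorgame_matrices fibre_prob_def prod_dividef)
  finally show ?thesis .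
qed

end

section \<open>Asymptotics\<close>

text \<open>The fibres cut a set of size \<open>w\<close> into even pieces. In particular weight 1
  contributes nothing and weight 2 leads.\<close>

lemma fibre_count_odd: "odd w \<Longrightarrow> fibre_count n w v = 0"
proof (induction n arbitrary: w v)
  case 0
  then show ?case by (cases "w = 0") auto
next
  case (Suc n)
  have "fibre_count n (w - a) b = 0" if "even a" "a \<le> w" for a b
    using that Suc by simp
  then show ?case by (auto intro!: sum.neutral)
qed

lemma fibre_prob_step:
  assumes "n > 0" "w + 2 \<le> m"
  shows "fibre_prob m n (w + 2) \<le> (real w + 1) * (2 / real n + 1 / (real m - real w - 1)) * fibre_prob m n w"
proof -
  have "real (m - (w + 2)) + 1 = real m - real w - 1" "m - (w + 2) + 2 = m - w"
    using assms by (simp_all add: of_nat_diff)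
  then have "real (fibre_count n (w + 2) (m - (w + 2)))
      \<le> (real w + 1) * (2 / real n + 1 / (real m - real w - 1)) * real (fibre_count n w (m - w))"
    using fibre_count_even_step[OF assms(1), of w "m - (w + 2)"] by (simp only:)
  then show ?thesis
    unfolding fibre_prob_def by (simp add: divide_right_mono del: fibre_count.simps)
qed

lemma binomial_step_le: "real (m choose Suc k) * (real k + 1) \<le> real m * real (m choose k)"
proof -
  have "Suc k * (m choose Suc k) = (m - k) * (m choose k)"
    by (simp only: binomial_absorption binomial_absorb_comp)
  also have "\<dots> \<le> m * (m choose k)" by simp
  finally have "real (Suc k * (m choose Suc k)) \<le> real (m * (m choose k))" by (simp only: of_nat_le_iff)
  then show ?thesis by (simp add: algebra_simps)
qed

section \<open>Summands of the expected number of kernel sets\<close>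

definition kernel_weight :: "nat \<Rightarrow> nat \<Rightarrow> (nat \<Rightarrow> nat) \<Rightarrow> nat \<Rightarrow> real" where
  "kernel_weight K m n w = real (m choose w) * (\<Prod>j = 1..K. fibre_prob m (n j) w)"

lemma kernel_weight_nonneg: "0 \<le> kernel_weight K m n w"
  by (simp add: kernel_weight_def prod_nonneg fibre_prob_nonneg)

text \<open>With \<open>W = w + 1\<close>, the binomial coefficient gains at most
  \<open>(m / W)^2\<close> and each probability at most the factor \<open>W * c / m\<close>. The
  constant \<open>c = 2 * K + 2\<close> collects \<open>2 / n j \<le> 2 * K / m\<close> and
  \<open>1 / (m - w - 1) \<le> 2 / m\<close>.\<close>

lemma kernel_weight_step:
  assumes K: "K \<ge> 2" and m: "m > 0" and n: "\<And>j. j \<in> {1..K} \<Longrightarrow> real m \<le> real K * real (n j)"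
    and w: "2 * (real w + 1) \<le> real m"
  shows "kernel_weight K m n (w + 2) \<le> (2 * real K + 2)^K * ((real w + 1) / real m)^(K - 2) * kernel_weight K m n w"
proof -
  define c W M where "c = 2 * real K + 2" and "W = real w + 1" and "M = real m"
  have pos: "c > 0" "W > 0" "M > 0" using m by (auto simp: c_def W_def M_def)
  have "real (w + 2) \<le> real m" using w by simp
  then have wm: "w + 2 \<le> m" by (simp only: of_nat_le_iff)
  have P: "fibre_prob m (n j) (w + 2) \<le> (W * c / M) * fibre_prob m (n j) w" if j: "j \<in> {1..K}" for j
  proof -
    have nj: "n j > 0" using n[OF j] m by (cases "n j = 0") auto
    have "2 / real (n j) \<le> 2 * real K / M" using n[OF j] nj m by (simp add: field_simps M_def)
    moreover have "1 / (real m - real w - 1) \<le> 2 / M" using w m by (simp add: field_simps M_def)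
    ultimately have "W * (2 / real (n j) + 1 / (real m - real w - 1)) \<le> W * (c / M)"
      using pos by (intro mult_left_mono) (auto simp: c_def add_divide_distrib)
    then have "W * (2 / real (n j) + 1 / (real m - real w - 1)) * fibre_prob m (n j) w \<le> W * (c / M) * fibre_prob m (n j) w"
      using fibre_prob_nonneg by (rule mult_right_mono)
    then show ?thesis using fibre_prob_step[OF nj wm] by (simp add: W_def)
  qed
  have "(\<Prod>j = 1..K. fibre_prob m (n j) (w + 2)) \<le> (\<Prod>j = 1..K. (W * c / M) * fibre_prob m (n j) w)"
    using P fibre_prob_nonneg by (intro prod_mono) auto
  also have "\<dots> = (W * c / M)^K * (\<Prod>j = 1..K. fibre_prob m (n j) w)"
    unfolding prod.distrib by simp
  finally have prod: "(\<Prod>j = 1..K. fibre_prob m (n j) (w + 2)) \<le> (W * c / M)^K * (\<Prod>j = 1..K. fibre_prob m (n j) w)" .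
  have "real (m choose (w + 2)) * W \<le> real (m choose Suc (Suc w)) * (real (Suc w) + 1)"
    by (intro mult_mono) (auto simp: W_def)
  also have "\<dots> \<le> M * real (m choose Suc w)" using binomial_step_le[of m "Suc w"] by (simp add: M_def)
  finally have b1: "real (m choose (w + 2)) \<le> M / W * real (m choose Suc w)" using pos by (simp add: field_simps)
  have b2: "real (m choose Suc w) \<le> M / W * real (m choose w)"
    using binomial_step_le[of m w] pos by (simp add: field_simps M_def W_def)
  have "real (m choose (w + 2)) \<le> M / W * (M / W * real (m choose w))"
    using b1 mult_left_mono[OF b2, of "M / W"] pos by simp
  then have bin: "real (m choose (w + 2)) \<le> (M / W)^2 * real (m choose w)" by (simp add: power2_eq_square)
  have "kernel_weight K m n (w + 2)
      \<le> ((M / W)^2 * real (m choose w)) * ((W * c / M)^K * (\<Prod>j = 1..K. fibre_prob m (n j) w))"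
    unfolding kernel_weight_def using pos fibre_prob_nonneg by (intro mult_mono[OF bin prod]) (auto intro!: prod_nonneg)
  also have "\<dots> = ((M / W)^2 * (W * c / M)^K) * kernel_weight K m n w"
    by (simp add: kernel_weight_def)
  also have "(M / W)^2 * (W * c / M)^K = c^K * (W / M)^(K - 2)"
  proof -
    have "(W * c / M)^K = c^K * (W / M)^K" by (simp add: power_mult_distrib power_divide)
    moreover have "(W / M)^K = (W / M)^2 * (W / M)^(K - 2)" using K by (metis le_add_diff_inverse power_add)
    moreover have "(M / W)^2 * (W / M)^2 = 1" using pos by (simp add: power_mult_distrib[symmetric])
    ultimately show ?thesis by (simp add: mult_ac)
  qed
  finally show ?thesis by (simp add: c_def W_def M_def)
qed

text \<open>The empty set, of weight 1, seeds the step from 0 to 2, which produces the power of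
  \<open>1 / m\<close>. Each later step gains a factor 1/2 because \<open>K - 2 \<ge> 1\<close>. The
  numbers fit since \<open>1 / 2 \<le> (3 / 4)^2\<close> and
  \<open>1 \<le> 2 * (3 / 4)^2\<close>.\<close>

lemma kernel_weight_small:
  fixes \<epsilon> :: real
  assumes K: "K \<ge> 3" and m: "m > 0" and n: "\<And>j. j \<in> {1..K} \<Longrightarrow> real m \<le> real K * real (n j)"
    and pos: "\<And>j. j \<in> {1..K} \<Longrightarrow> fibre_count (n j) 0 m > 0"
    and \<epsilon>: "0 < \<epsilon>" "\<epsilon> \<le> 1 / 2" "(2 * real K + 2)^K * \<epsilon> \<le> 1 / 2"
    and w: "1 \<le> w" "real w \<le> \<epsilon> * real m"
  shows "kernel_weight K m n w \<le> 2 * ((2 * real K + 2)^K * (1 / real m)^(K - 2)) * (3 / 4)^w"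
  using w
proof (induction w rule: less_induct)
  case (less w)
  define c A where "c = 2 * real K + 2" and "A = c^K * (1 / real m)^(K - 2)"
  have A: "A \<ge> 0" by (simp add: A_def c_def)
  have "w = 1 \<or> w = 2 \<or> (w = (w - 2) + 2 \<and> 1 \<le> w - 2)" using less.prems(1) by arith
  then consider "w = 1" | "w = 2" | u where "w = u + 2" "1 \<le> u" by blast
  then show ?case
  proof cases
    case 1
    have "fibre_prob m (n 1) 1 = 0" using fibre_count_odd[of 1] by (simp add: fibre_prob_def del: fibre_count.simps)
    then have "(\<Prod>j = 1..K. fibre_prob m (n j) 1) = 0" using K by (intro prod_zero) (auto intro!: bexI[of _ 1])
    then have "kernel_weight K m n 1 = 0" by (simp add: kernel_weight_def)
    then show ?thesis using 1 A by (simp add: A_def c_def)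
  next
    case 2
    have "\<epsilon> * real m \<le> 1 / 2 * real m" using \<epsilon> by (intro mult_right_mono) auto
    then have "2 * (real 0 + 1) \<le> real m" using less.prems(2) 2 by simp
    then have "kernel_weight K m n (0 + 2) \<le> A * kernel_weight K m n 0"
      using kernel_weight_step[of K m n 0] K m n by (simp add: A_def c_def)
    moreover have "(\<Prod>j = 1..K. fibre_prob m (n j) 0) = 1"
      using pos by (intro prod.neutral) (auto simp: fibre_prob_def simp del: fibre_count.simps)
    ultimately have "kernel_weight K m n 2 \<le> A" by (simp add: kernel_weight_def numeral_2_eq_2)
    also have "\<dots> \<le> 2 * A * (3 / 4)^2" using A by (simp add: power2_eq_square)
    finally show ?thesis using 2 by (simp add: A_def c_def)
  next
    case 3
    have um: "(real u + 1) \<le> \<epsilon> * real m" using less.prems(2) 3 by simp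
    also have "\<dots> \<le> 1 / 2 * real m" using \<epsilon> by (intro mult_right_mono) auto
    finally have um2: "2 * (real u + 1) \<le> real m" by simp
    have r: "(real u + 1) / real m \<le> \<epsilon>" "0 \<le> (real u + 1) / real m" using um m by (simp_all add: field_simps)
    have "((real u + 1) / real m)^(K - 2) \<le> \<epsilon>^(K - 2)" using r by (intro power_mono)
    also have "\<dots> \<le> \<epsilon>^1" using K \<epsilon> by (intro power_decreasing) auto
    finally have "c^K * ((real u + 1) / real m)^(K - 2) \<le> c^K * \<epsilon>"
      by (intro mult_left_mono) (auto simp: c_def)
    then have half: "c^K * ((real u + 1) / real m)^(K - 2) \<le> 1 / 2"
      using \<epsilon>(3) unfolding c_def by linarith
    have "kernel_weight K m n w \<le> c^K * ((real u + 1) / real m)^(K - 2) * kernel_weight K m n u"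
      using kernel_weight_step[of K m n u] K m n um2 3 by (simp add: c_def)
    also have "\<dots> \<le> 1 / 2 * (2 * A * (3 / 4)^u)"
      using half less.IH[of u] 3 um kernel_weight_nonneg by (intro mult_mono) (auto simp: A_def c_def)
    also have "\<dots> \<le> 2 * A * (3 / 4)^w" using A 3 by (simp add: power_add power2_eq_square)
    finally show ?thesis by (simp add: A_def c_def)
  qed
qed

text \<open>The binomial coefficient is shared equally among the \<open>K\<close> blocks. The decay
  exponent is made common to all blocks: \<open>n j \<ge> m / K\<close> and
  \<open>K - m / n j \<ge> \<delta>\<close> give
  \<open>n j * (1 - m / (n j * K)) \<ge> m * \<delta> / K^2\<close>.\<close>

lemma kernel_weight_large:
  fixes \<epsilon> \<delta> \<eta> :: real
  assumes K: "K \<ge> 1" and m: "m > 0" and \<delta>: "0 < \<delta>"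
    and n: "\<And>j. j \<in> {1..K} \<Longrightarrow> (2 + \<delta>) * real (n j) \<le> real m \<and> real m \<le> (real K - \<delta>) * real (n j)"
    and \<eta>: "max (1 - \<epsilon>) ((1 + 1 / (1 + \<delta> / 3)) / 2) \<le> \<eta>" "\<eta> < 1"
    and w: "\<epsilon> * real m \<le> real w" "w \<le> m"
  shows "kernel_weight K m n w \<le> (4 * real m * (real m + 1) * \<eta> powr (real m * \<delta> / (real K)^2))^K"
proof -
  define C where "C = real (m choose w)"
  have C: "C \<ge> 1" using w by (simp add: C_def Suc_le_eq)
  have "0 < (1 + 1 / (1 + \<delta> / 3)) / 2" using \<delta> by (simp add: add_pos_pos)
  then have \<eta>0: "0 < \<eta>" using \<eta>(1) by (simp add: max_def split: if_splits)
  have factor: "C powr (1 / real K) * fibre_prob m (n j) w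
      \<le> 4 * real m * (real m + 1) * \<eta> powr (real m * \<delta> / (real K)^2)" if j: "j \<in> {1..K}" for j
  proof -
    define N where "N = real (n j)"
    have nj: "n j > 0" using n[OF j] m by (cases "n j = 0") auto
    then have N: "N > 0" by (simp add: N_def)
    define \<mu> where "\<mu> = real m / N"
    have \<mu>: "2 + \<delta> \<le> \<mu>" "\<mu> \<le> real K - \<delta>" and mN: "real m = \<mu> * N"
      using n[OF j] N by (auto simp: \<mu>_def N_def field_simps)
    obtain z where z: "z \<ge> \<mu> - 2" "tail_mean z = \<mu>" using saddle_exists[of \<mu>] \<mu> \<delta> by auto
    have z0: "0 < z" "\<delta> \<le> z" using z \<mu> \<delta> by auto
    have "(2 + \<delta>) * N > 2 * N" using N \<delta> by simp
    then have m2: "2 * n j < m" using n[OF j] by (simp add: N_def)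
    have mean: "real m = tail_mean z * real (n j)" using mN z by (simp add: N_def)
    have \<alpha>: "\<epsilon> \<le> real w / real m" "real w / real m \<le> 1" "0 \<le> real w / real m" using w m by (auto simp: field_simps)
    have H: "(1 + exp_tail ((1 - 2 * (real w / real m)) * z) / exp_tail z) / 2 \<le> \<eta>"
      using exp_tail_ratio_bound[OF \<delta> z0(2) \<alpha>] \<eta>(1) by linarith
    have "C powr (1 / real K) * fibre_prob m (n j) w
        \<le> 4 * real m * (real m + 1) * \<eta> powr (real (n j) * (1 - tail_mean z / real K))"
      unfolding C_def using \<mu> \<delta> z by (intro fibre_prob_large_weight nj m2 w z0 mean H) auto
    also have "\<dots> \<le> 4 * real m * (real m + 1) * \<eta> powr (real m * \<delta> / (real K)^2)"
    proof (intro mult_left_mono powr_mono')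
      have "real m * \<delta> \<le> (real K * N) * (real K - \<mu>)"
      proof (rule mult_mono)
        show "real m \<le> real K * N" using \<mu> \<delta> N unfolding mN by (intro mult_right_mono) auto
      qed (use \<mu> \<delta> N in auto)
      then show "real m * \<delta> / (real K)^2 \<le> real (n j) * (1 - tail_mean z / real K)"
        using K z by (simp add: field_simps power2_eq_square N_def)
    qed (use \<eta>0 \<eta> in auto)
    finally show ?thesis .
  qed
  have "kernel_weight K m n w = (\<Prod>j = 1..K. C powr (1 / real K) * fibre_prob m (n j) w)"
  proof -
    have "(C powr (1 / real K))^K = C" using C K by (simp add: powr_powr flip: powr_realpow)
    then show ?thesis by (simp add: kernel_weight_def prod.distrib C_def)
  qed
  also have "\<dots> \<le> (\<Prod>j = 1..K. 4 * real m * (real m + 1) * \<eta> powr (real m * \<delta> / (real K)^2))"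
    using factor fibre_prob_nonneg by (intro prod_mono) auto
  finally show ?thesis by simp
qed

text \<open>Quantifying over \<open>n\<close> inside the eventuality makes constant and threshold
  depend on \<open>K\<close> and \<delta> only, so widths varying with the sequence can be
  inserted.\<close>

lemma kernel_weight_sum_bound:
  assumes K: "K \<ge> 3" and \<delta>: "(0::real) < \<delta>"
  shows "\<exists>c. \<forall>\<^sub>F m in sequentially. \<forall>n.
     (\<forall>j\<in>{1..K}. (2 + \<delta>) * real (n j) \<le> real m \<and> real m \<le> (real K - \<delta>) * real (n j)) \<longrightarrow>
     (\<Sum>w = 1..m. kernel_weight K m n w) \<le> c * real m powr (2 - real K)"
proof -
  define D where "D = (2 * real K + 2)^K"
  have D: "D \<ge> 1" by (simp add: D_def)
  \<comment> \<open>The largest fraction for which one step of the small-weight recursion still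
    gains a factor 1/2.\<close>
  define \<epsilon> where "\<epsilon> = 1 / (2 * D)"
  have \<epsilon>: "0 < \<epsilon>" "\<epsilon> \<le> 1 / 2" "D * \<epsilon> \<le> 1 / 2" using D by (auto simp: \<epsilon>_def field_simps)
  define \<eta> where "\<eta> = max (1 - \<epsilon>) ((1 + 1 / (1 + \<delta> / 3)) / 2)"
  have \<eta>: "0 < \<eta>" "\<eta> < 1" using \<epsilon> \<delta> by (auto simp: \<eta>_def max_def field_simps)
  \<comment> \<open>The \<open>K\<close>-th power of \<open>\<eta> powr (m * \<delta> / K^2)\<close>
    is \<open>exp (- \<kappa> * m)\<close>.\<close>
  define \<kappa> where "\<kappa> = - ln \<eta> * \<delta> / real K"
  have \<kappa>: "\<kappa> > 0" using \<eta> \<delta> K by (simp add: \<kappa>_def divide_neg_pos mult_neg_pos)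
  define B where "B m = (4 * real m * (real m + 1) * \<eta> powr (real m * \<delta> / (real K)^2))^K" for m
  have B0: "B m \<ge> 0" for m by (simp add: B_def)
  have "((\<lambda>x::real. x * (4 * x * (x + 1)) powr real K * exp (- \<kappa> * x) / x powr (2 - real K)) \<longlongrightarrow> 0) at_top"
    using \<kappa> by real_asymp
  then have "\<forall>\<^sub>F x in at_top. x * (4 * x * (x + 1)) powr real K * exp (- \<kappa> * x) / x powr (2 - real K) < 1"
    by (rule order_tendstoD) simp
  then have ev: "\<forall>\<^sub>F m in sequentially. real m * (4 * real m * (real m + 1)) powr real K * exp (- \<kappa> * real m) / real m powr (2 - real K) < 1"
    by (rule eventually_compose_filterlim[OF _ filterlim_real_sequentially])
  have "\<forall>\<^sub>F m in sequentially. \<forall>n.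
     (\<forall>j\<in>{1..K}. (2 + \<delta>) * real (n j) \<le> real m \<and> real m \<le> (real K - \<delta>) * real (n j)) \<longrightarrow>
     (\<Sum>w = 1..m. kernel_weight K m n w) \<le> (8 * D + 1) * real m powr (2 - real K)"
    using ev eventually_gt_at_top[of 0]
  proof eventually_elim
    case (elim m)
    note m = elim(2)
    show ?case
    proof (intro allI impI)
      fix n :: "nat \<Rightarrow> nat"
      assume n: "\<forall>j\<in>{1..K}. (2 + \<delta>) * real (n j) \<le> real m \<and> real m \<le> (real K - \<delta>) * real (n j)"
      have n1: "real m \<le> real K * real (n j)" if "j \<in> {1..K}" for j
      proof -
        have "(real K - \<delta>) * real (n j) \<le> real K * real (n j)" using \<delta> by (intro mult_right_mono) auto
        then show ?thesis using n that by fastforce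
      qed
      have pos: "fibre_count (n j) 0 m > 0" if "j \<in> {1..K}" for j
      proof (rule fibre_count_pos)
        show "n j > 0" using n1[OF that] m by (cases "n j = 0") auto
        have "2 * real (n j) \<le> (2 + \<delta>) * real (n j)" using \<delta> by (intro mult_right_mono) auto
        then have "2 * real (n j) \<le> real m" using n that by fastforce
        then show "2 * n j \<le> m" by linarith
      qed
      define A where "A = D * (1 / real m)^(K - 2)"
      have A0: "A \<ge> 0" using D by (simp add: A_def)
      have each: "kernel_weight K m n w \<le> 2 * A * (3 / 4)^w + B m" if w: "w \<in> {1..m}" for w
      proof (cases "real w \<le> \<epsilon> * real m")
        case True
        then have "kernel_weight K m n w \<le> 2 * A * (3 / 4)^w"
          using kernel_weight_small[OF K m n1 pos \<epsilon>(1,2)] \<epsilon>(3) w by (simp add: A_def D_def)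
        then show ?thesis using B0[of m] by simp
      next
        case False
        then have "kernel_weight K m n w \<le> B m"
          unfolding B_def using K m \<delta> n w \<eta>
          by (intro kernel_weight_large[where \<epsilon> = \<epsilon>]) (auto simp: \<eta>_def)
        then show ?thesis using A0 by (simp add: add_increasing)
      qed
      have "(\<Sum>w = 1..m. kernel_weight K m n w) \<le> (\<Sum>w = 1..m. 2 * A * (3 / 4)^w + B m)"
        using each by (rule sum_mono)
      also have "\<dots> = 2 * A * (\<Sum>w = 1..m. (3 / 4)^w) + real m * B m"
        by (simp add: sum.distrib sum_distrib_left)
      finally have total: "(\<Sum>w = 1..m. kernel_weight K m n w) \<le> 2 * A * (\<Sum>w = 1..m. (3 / 4)^w) + real m * B m" .
      have "(\<Sum>w = 1..m. (3 / 4 :: real)^w) \<le> 4"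
      proof -
        have "(\<Sum>w\<in>{1..m}. (3 / 4 :: real)^w) \<le> (\<Sum>w. (3 / 4)^w)"
          by (rule sum_le_suminf) (auto intro: summable_geometric)
        then show ?thesis by (simp add: suminf_geometric)
      qed
      then have geo: "2 * A * (\<Sum>w = 1..m. (3 / 4)^w) \<le> 2 * A * 4"
        using A0 by (intro mult_left_mono) auto
      have tail: "real m * B m \<le> real m powr (2 - real K)"
      proof -
        have "B m = (4 * real m * (real m + 1))^K * (\<eta> powr (real m * \<delta> / (real K)^2))^K"
          by (simp add: B_def power_mult_distrib)
        also have "(4 * real m * (real m + 1))^K = (4 * real m * (real m + 1)) powr real K"
          using m by (subst powr_realpow) auto
        also have "(\<eta> powr (real m * \<delta> / (real K)^2))^K = exp (- \<kappa> * real m)"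
          using \<eta> K by (simp add: powr_def \<kappa>_def power2_eq_square field_simps flip: exp_of_nat_mult)
        finally have "real m * B m = real m * (4 * real m * (real m + 1)) powr real K * exp (- \<kappa> * real m)"
          by simp
        then show ?thesis using elim(1) m by (simp add: divide_less_eq)
      qed
      have "A = D * real m powr (2 - real K)"
      proof -
        have "real m powr (2 - real K) = 1 / real m powr (real (K - 2))"
          using K by (simp add: of_nat_diff powr_minus[symmetric] divide_inverse)
        also have "\<dots> = (1 / real m)^(K - 2)" using m by (simp add: powr_realpow power_one_over)
        finally show ?thesis by (simp add: A_def)
      qed
      \<comment> \<open>The geometric sum is at most 4, which gives \<open>8 * D\<close>; all large
        weights together cost the additional 1.\<close>
      then have "2 * A * 4 + real m powr (2 - real K) = (8 * D + 1) * real m powr (2 - real K)"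
        by (simp add: algebra_simps)
      then show "(\<Sum>w = 1..m. kernel_weight K m n w) \<le> (8 * D + 1) * real m powr (2 - real K)"
        using total geo tail by linarith
    qed
  qed
  then show ?thesis by blast
qed

section \<open>The two regimes\<close>

lemma sat_prob_nonneg: "0 \<le> sat_prob K m n" and sat_prob_le_1: "sat_prob K m n \<le> 1"
  by (simp_all add: sat_prob_def)

lemma satisfiable_regime:
  fixes K :: nat and m :: "nat \<Rightarrow> nat" and n :: "nat \<Rightarrow> nat \<Rightarrow> nat" and L :: "nat \<Rightarrow> real"
  assumes K: "K \<ge> 3" and m: "filterlim m at_top sequentially"
    and lim: "\<forall>j\<in>{1..K}. (\<lambda>t. real (m t) / real (n t j)) \<longlonglongrightarrow> L j"
    and npos: "\<forall>j\<in>{1..K}. filterlim (\<lambda>t. n t j) at_top sequentially"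
    and L: "\<forall>j\<in>{1..K}. 2 < L j \<and> L j < real K"
  shows "(\<lambda>t. 1 - sat_prob K (m t) (n t)) \<in> O(\<lambda>t. real (m t) powr (2 - real K))"
    and "(\<lambda>t. sat_prob K (m t) (n t)) \<longlonglongrightarrow> 1"
proof -
  \<comment> \<open>Half the smallest distance of a limit from 2 and from \<open>K\<close>: the
    ratios eventually stay at distance \<delta> from both ends.\<close>
  define \<delta> where "\<delta> = Min ((\<lambda>j. min (L j - 2) (real K - L j)) ` {1..K}) / 2"
  have ne: "{1..K} \<noteq> {}" using K by simp
  have \<delta>0: "\<delta> > 0" using L ne by (simp add: \<delta>_def)
  have \<delta>: "2 * \<delta> \<le> min (L j - 2) (real K - L j)" if "j \<in> {1..K}" for j
  proof -
    have "2 * \<delta> = Min ((\<lambda>j. min (L j - 2) (real K - L j)) ` {1..K})" by (simp add: \<delta>_def)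
    also have "\<dots> \<le> min (L j - 2) (real K - L j)" by (rule Min_le) (use that in auto)
    finally show ?thesis .
  qed
  have "\<forall>\<^sub>F t in sequentially. (2 + \<delta>) * real (n t j) \<le> real (m t) \<and> real (m t) \<le> (real K - \<delta>) * real (n t j)"
    if j: "j \<in> {1..K}" for j
  proof -
    have "\<forall>\<^sub>F t in sequentially. 2 + \<delta> < real (m t) / real (n t j)"
      using lim j \<delta>[OF j] \<delta>0 by (intro order_tendstoD(1)) auto
    moreover have "\<forall>\<^sub>F t in sequentially. real (m t) / real (n t j) < real K - \<delta>"
      using lim j \<delta>[OF j] \<delta>0 by (intro order_tendstoD(2)) auto
    moreover have "\<forall>\<^sub>F t in sequentially. n t j > 0"
      by (rule eventually_compose_filterlim[OF eventually_gt_at_top npos[rule_format, OF j]])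
    ultimately show ?thesis by eventually_elim (auto simp: field_simps)
  qed
  then have ev: "\<forall>\<^sub>F t in sequentially. \<forall>j\<in>{1..K}. (2 + \<delta>) * real (n t j) \<le> real (m t) \<and> real (m t) \<le> (real K - \<delta>) * real (n t j)"
    by (simp add: eventually_ball_finite)
  obtain c where c: "\<forall>\<^sub>F m in sequentially. \<forall>n.
     (\<forall>j\<in>{1..K}. (2 + \<delta>) * real (n j) \<le> real m \<and> real m \<le> (real K - \<delta>) * real (n j)) \<longrightarrow>
     (\<Sum>w = 1..m. kernel_weight K m n w) \<le> c * real m powr (2 - real K)"
    using kernel_weight_sum_bound[OF K \<delta>0] by blast
  have bound: "\<forall>\<^sub>F t in sequentially. 1 - sat_prob K (m t) (n t) \<le> c * real (m t) powr (2 - real K)"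
    using eventually_compose_filterlim[OF c m] ev eventually_compose_filterlim[OF eventually_gt_at_top[of 0] m]
  proof eventually_elim
    case (elim t)
    have "fibre_count (n t j) 0 (m t) > 0" if j: "j \<in> {1..K}" for j
    proof (rule fibre_count_pos)
      have "real (m t) \<le> (real K - \<delta>) * real (n t j)" using elim(2) j by blast
      then show "n t j > 0" using elim(3) by (cases "n t j = 0") auto
      have "2 * real (n t j) \<le> (2 + \<delta>) * real (n t j)" using \<delta>0 by (intro mult_right_mono) auto
      then have "2 * real (n t j) \<le> real (m t)" using elim(2) j by fastforce
      then show "2 * n t j \<le> m t" by linarith
    qed
    then have "1 - sat_prob K (m t) (n t) \<le> (\<Sum>w = 1..m t. kernel_weight K (m t) (n t) w)"
      unfolding kernel_weight_def by (rule unsat_prob_upper)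
    also have "\<dots> \<le> c * real (m t) powr (2 - real K)" using elim by blast
    finally show ?case .
  qed
  show O: "(\<lambda>t. 1 - sat_prob K (m t) (n t)) \<in> O(\<lambda>t. real (m t) powr (2 - real K))"
    using bound by (intro bigoI[where c = c]) (auto elim!: eventually_mono simp: sat_prob_le_1)
  have "(\<lambda>x. real x powr (2 - real K)) \<longlonglongrightarrow> 0"
    using K by (intro tendsto_neg_powr filterlim_real_sequentially) auto
  from filterlim_compose[OF this m] have "(\<lambda>t. real (m t) powr (2 - real K)) \<longlonglongrightarrow> 0" .
  from tendsto_mult_right_zero[OF this, of c] have "(\<lambda>t. c * real (m t) powr (2 - real K)) \<longlonglongrightarrow> 0" .
  then have "(\<lambda>t. 1 - sat_prob K (m t) (n t)) \<longlonglongrightarrow> 0"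
    by (rule tendsto_sandwich[OF _ bound tendsto_const, rotated]) (simp add: sat_prob_le_1)
  from tendsto_diff[OF tendsto_const[of 1] this] show "(\<lambda>t. sat_prob K (m t) (n t)) \<longlonglongrightarrow> 1" by simp
qed

lemma unsatisfiable_regime:
  fixes K :: nat and m :: "nat \<Rightarrow> nat" and n :: "nat \<Rightarrow> nat \<Rightarrow> nat" and L :: "nat \<Rightarrow> real"
  assumes K: "K \<ge> 3" and m: "filterlim m at_top sequentially"
    and npos: "\<forall>j\<in>{1..K}. filterlim (\<lambda>t. n t j) at_top sequentially"
    and lim: "\<forall>j\<in>{1..K}. (\<lambda>t. real (m t) / real (n t j)) \<longlonglongrightarrow> L j"
    and L: "\<forall>j\<in>{1..K}. real K < L j"
  shows "(\<lambda>t. sat_prob K (m t) (n t)) \<in> O(\<lambda>t. 2 powr (- (real (m t) - real (total_width K (n t)))))"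
    and "(\<lambda>t. sat_prob K (m t) (n t)) \<longlonglongrightarrow> 0"
proof -
  have "\<forall>\<^sub>F t in sequentially. 0 < n t j \<and> 2 * n t j \<le> m t" if j: "j \<in> {1..K}" for j
  proof -
    have "\<forall>\<^sub>F t in sequentially. 2 < real (m t) / real (n t j)"
      using lim L j K by (intro order_tendstoD(1)[of _ "L j"]) fastforce+
    moreover have "\<forall>\<^sub>F t in sequentially. n t j > 0"
      by (rule eventually_compose_filterlim[OF eventually_gt_at_top npos[rule_format, OF j]])
    ultimately show ?thesis by eventually_elim (auto simp: field_simps)
  qed
  then have "\<forall>\<^sub>F t in sequentially. \<forall>j\<in>{1..K}. 0 < n t j \<and> 2 * n t j \<le> m t"
    by (simp add: eventually_ball_finite)
  then have bound: "\<forall>\<^sub>F t in sequentially. sat_prob K (m t) (n t) \<le> 2 powr (- (real (m t) - real (total_width K (n t))))"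
  proof eventually_elim
    case (elim t)
    then have "card (xorgame_matrices K (m t) (n t)) > 0"
      by (auto simp: card_xorgame_matrices intro!: prod_pos fibre_count_pos)
    then show ?case by (intro sat_prob_upper) auto
  qed
  show "(\<lambda>t. sat_prob K (m t) (n t)) \<in> O(\<lambda>t. 2 powr (- (real (m t) - real (total_width K (n t)))))"
    using bound by (intro bigoI[where c = 1]) (auto elim!: eventually_mono simp: sat_prob_nonneg)
  \<comment> \<open>\<open>S\<close> is the limit of \<open>|n| / m\<close>. Each of its
    \<open>K\<close> terms is below \<open>1 / K\<close>, so \<open>m - |n|\<close> grows like
    \<open>(1 - S) * m\<close>.\<close>
  define S where "S = (\<Sum>j = 1..K. 1 / L j)"
  have S: "S < 1"
  proof -
    have "S < (\<Sum>j = 1..K. 1 / real K)"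
      unfolding S_def
    proof (rule sum_strict_mono)
      fix j assume j: "j \<in> {1..K}"
      show "1 / L j < 1 / real K" by (rule frac_less2) (use L j K in auto)
    qed (use K in auto)
    then show ?thesis using K by simp
  qed
  have ratio: "(\<lambda>t. real (n t j) / real (m t)) \<longlonglongrightarrow> 1 / L j" if j: "j \<in> {1..K}" for j
  proof -
    have "L j \<noteq> 0" using L j K by fastforce
    with tendsto_inverse[OF lim[rule_format, OF j]] show ?thesis
      by (simp add: inverse_eq_divide)
  qed
  have "(\<lambda>t. 1 - (\<Sum>j = 1..K. real (n t j) / real (m t))) \<longlonglongrightarrow> 1 - S"
    unfolding S_def by (intro tendsto_diff tendsto_const tendsto_sum ratio)
  moreover have "filterlim (\<lambda>t. real (m t)) at_top sequentially"
    by (rule filterlim_compose[OF filterlim_real_sequentially m])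
  ultimately have prod: "filterlim (\<lambda>t. (1 - (\<Sum>j = 1..K. real (n t j) / real (m t))) * real (m t)) at_top sequentially"
    using S by (intro filterlim_tendsto_pos_mult_at_top[of _ "1 - S"]) auto
  have eq: "\<forall>\<^sub>F t in sequentially. (1 - (\<Sum>j = 1..K. real (n t j) / real (m t))) * real (m t)
      = real (m t) - real (total_width K (n t))"
    using eventually_compose_filterlim[OF eventually_gt_at_top[of 0] m]
    by eventually_elim (simp add: total_width_def sum_divide_distrib[symmetric] field_simps)
  have diff: "filterlim (\<lambda>t. real (m t) - real (total_width K (n t))) at_top sequentially"
    by (rule filterlim_cong[OF refl refl eq, THEN iffD1, OF prod])
  have "((\<lambda>t. 2 powr (- (real (m t) - real (total_width K (n t))))) \<longlongrightarrow> 0) sequentially"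
  proof -
    have "((\<lambda>x::real. 2 powr (- x)) \<longlongrightarrow> 0) at_top" by real_asymp
    then show ?thesis using diff by (rule filterlim_compose)
  qed
  then show "(\<lambda>t. sat_prob K (m t) (n t)) \<longlonglongrightarrow> 0"
    by (rule tendsto_sandwich[OF _ bound tendsto_const, rotated]) (simp add: sat_prob_nonneg)
qed

theorem theorem1p2:
  fixes K :: nat
    and m :: "nat \<Rightarrow> nat"
    and n :: "nat \<Rightarrow> nat \<Rightarrow> nat"
    and L :: "nat \<Rightarrow> real"
  assumes "K \<ge> 3"
    and "filterlim m at_top sequentially"
    and "\<forall>j\<in>{1..K}. filterlim (\<lambda>t. n t j) at_top sequentially"
    and "\<forall>j\<in>{1..K}. (\<lambda>t. real (m t) / real (n t j)) \<longlonglongrightarrow> L j"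
  shows
    "((\<forall>j\<in>{1..K}. 2 < L j \<and> L j < real K) \<longrightarrow>
        (\<lambda>t. sat_prob K (m t) (n t)) \<longlonglongrightarrow> 1 \<and>
        (\<lambda>t. 1 - sat_prob K (m t) (n t)) \<in> O(\<lambda>t. real (m t) powr (2 - real K))) \<and>
     ((\<forall>j\<in>{1..K}. real K < L j) \<longrightarrow>
        (\<lambda>t. sat_prob K (m t) (n t)) \<longlonglongrightarrow> 0 \<and>
        (\<lambda>t. sat_prob K (m t) (n t)) \<in>
          O(\<lambda>t. 2 powr (- (real (m t) - real (total_width K (n t))))))"
  using satisfiable_regime[OF assms(1,2,4,3)] unsatisfiable_regime[OF assms] by blast

end
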